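(* Let $d\in\mathbb N$, $\alpha>1/2$, let $0<\gamma_j\le 1$ for $j=1,\ldots,d$, let $N>2$ be prime, and let $\delta\in(0,1)$ and $K>1$. Choose $$M=\max_{1/\alpha<\lambda\le 2}\left((N-1)(1-\delta)\prod_{j=1}^d\bigl(1+2\gamma_j^\lambda\zeta(\alpha\lambda)\bigr)^{-1}\right)^{1/\lambda},$$ assume that $M>1$, let $m_0\in\mathbb N$ satisfy $2^{m_0-1}<M^{1/\alpha}\le 2^{m_0}$, and set $R_*=1+(3^d-1)(m_0+d)^{d-1}$. Choose $\boldsymbol g$ uniformly at random from $\{1,\ldots,N-1\}^d$. Conditional on $\boldsymbol g$, put $R=R_{\alpha,\boldsymbol\gamma,N}(\boldsymbol g)$ and $S=\lceil 2KR\log N\rceil$, and choose the shifts $\boldsymbol y_m^{(s)}$, $m=1,\ldots,R$, $s=1,\ldots,S$, independently and uniformly from $[0,1)^d$. Then: (1) With probability at least $\delta$ the generating vector satisfies $\rho(\boldsymbol g)\ge M$ and $R_{\alpha,\boldsymbol\gamma,N}(\boldsymbol g)\le R_*$. (2) For all sufficiently large $N$ (with $d,\alpha,\boldsymbol\gamma,\delta,K$ fixed) one has $2N^{1-K}R_*^2<1$. For such $N$, conditional on a generating vector with the properties in (1), the shifts satisfy $\|[B_j^HB_j]^{-1}\|_2\le 1/S$ for all fibers ($j=1,\ldots,J$) with probability at least $1-2N^{1-K}R_*^2$. Consequently the conditions on $\boldsymbol g$ in (1) and this condition on the shifts hold jointly with probability at least $\delta\,(1-2N^{1-K}R_*^2)$,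 which is positive. (3) On this joint event, for every $\tau\in(0,1]$, $$\mathrm e_\infty^{\mathrm{wor}}(\mathcal A,\mathcal K_{d,\alpha,\boldsymbol\gamma})\le C_{d,\alpha,\boldsymbol\gamma,\delta,K,\tau}\;p^{-\alpha+1/2+\tau},$$ where $\mathcal A$ is the deterministic shifted-lattice algorithm defined by $N,M,\boldsymbol g$ and the shifts, $p=NRS$ is the total number of function evaluations, and the constant $C_{d,\alpha,\boldsymbol\gamma,\delta,K,\tau}$ depends only on the displayed parameters. (4) If, in addition, $\alpha\in\mathbb N$, and instead $\boldsymbol g$ is constructed using the component-by-component (CBC) algorithm, $M$ is chosen as $$M=\max_{1/\alpha<\lambda\le2}\left(\frac N2\prod_{j=1}^d\bigl(1+2\gamma_j^\lambda\zeta(\alpha\lambda)\bigr)^{-1}\right)^{1/\lambda}$$ and satisfies $M>1$, and the shifts satisfy $\|[B_j^HB_j]^{-1}\|_2\le1/S$ for all fibers, with $S=\lceil 2KR\log N\rceil$, $R=R_{\alpha,\boldsymbol\gamma,N}(\boldsymbol g)$, then the error bound in (3) also holds.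
   Context: $\mathbb N=\{1,2,\ldots\}$, $\log$ is the natural logarithm, $\zeta$ is the Riemann zeta function, $\|\cdot\|_2$ of a matrix is the spectral norm, $B^H$ is the Hermitian transpose, and $\{\cdot\}$ applied to a vector is the componentwise fractional part. Function space. For $\boldsymbol k\in\mathbb Z^d$ let $r_{\alpha,\boldsymbol\gamma}(\boldsymbol k)=\prod_{j:\,k_j\ne0}|k_j|^\alpha/\gamma_j$ (empty product $=1$). The weighted Korobov space $\mathcal K_{d,\alpha,\boldsymbol\gamma}$ consists of the 1-periodic functions $f:[0,1)^d\to\mathbb C$ given by an absolutely convergent Fourier series $f(\boldsymbol x)=\sum_{\boldsymbol k\in\mathbb Z^d}\widehat f(\boldsymbol k)\mathrm e^{2\pi\mathrm i\boldsymbol k\cdot\boldsymbol x}$ with $\|f\|_{d,\alpha,\boldsymbol\gamma}=\bigl(\sum_{\boldsymbol k}|\widehat f(\boldsymbol k)|^2r_{\alpha,\boldsymbol\gamma}(\boldsymbol k)^2\bigr)^{1/2}<\infty$. The worst-case $L_\infty$ error is $$\mathrm e_\infty^{\mathrm{wor}}(\mathcal A,\mathcal K_{d,\alpha,\boldsymbol\gamma})=\sup_{\|f\|_{d,\alpha,\boldsymbol\gamma}\le1}\ \sup_{\boldsymbol x\in[0,1)^d}|f(\boldsymbol x)-\mathcal A(f)(\boldsymbol x)|.$$ Lattice notions. For $\boldsymbol g\in\{1,\ldots,N-1\}^d$, the dual lattice is $\mathcal L_N^\perp(\boldsymbol g)=\{\boldsymbol k\in\mathbb Z^d:\boldsymbol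 g\cdot\boldsymbol k\equiv0\pmod N\}$, and the figure of merit is $\rho(\boldsymbol g)=\min_{\boldsymbol\ell\in\mathcal L_N^\perp(\boldsymbol g)\setminus\{\boldsymbol0\}}r_{\alpha,\boldsymbol\gamma}(\boldsymbol\ell)$. Let $A_{\alpha,\boldsymbol\gamma,M}=\{\boldsymbol k\in\mathbb Z^d:r_{\alpha,\boldsymbol\gamma}(\boldsymbol k)<M\}$. The fiber along $\boldsymbol\ell\in\mathbb Z^d$ is $\Gamma_{\alpha,\boldsymbol\gamma,N}(\boldsymbol\ell;\boldsymbol g)=\{\boldsymbol k\in A_{\alpha,\boldsymbol\gamma,M}:\boldsymbol k\cdot\boldsymbol g\equiv\boldsymbol\ell\cdot\boldsymbol g\pmod N\}$, and the maximal fiber length is $R_{\alpha,\boldsymbol\gamma,N}(\boldsymbol g)=\max_{\boldsymbol\ell\in\mathbb Z^d}|\Gamma_{\alpha,\boldsymbol\gamma,N}(\boldsymbol\ell;\boldsymbol g)|$. Choose $\boldsymbol\ell^{(1)},\ldots,\boldsymbol\ell^{(J)}\in A_{\alpha,\boldsymbol\gamma,M}$ such that the fibers $\Gamma_{\alpha,\boldsymbol\gamma,N}(\boldsymbol\ell^{(j)};\boldsymbol g)$, $j=1,\ldots,J$, are pairwise disjoint with union $A_{\alpha,\boldsymbol\gamma,M}$; put $v_j=|\Gamma_{\alpha,\boldsymbol\gamma,N}(\boldsymbol\ell^{(j)};\boldsymbol g)|$. Deterministic algorithm. Given shifts $\boldsymbol y_m^{(s)}\in[0,1)^d$, $1\le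 m\le R$, $1\le s\le S$ (the same shifts are used for all fibers). For the $j$-th fiber, enumerated as $\{\boldsymbol\ell_1,\ldots,\boldsymbol\ell_{v_j}\}$, let $B_j\in\mathbb C^{v_jS\times v_j}$ be the matrix with rows indexed by $(m,s)$, $1\le m\le v_j$, $1\le s\le S$, columns indexed by $i=1,\ldots,v_j$, and entries $\mathrm e^{2\pi\mathrm i\boldsymbol\ell_i\cdot\boldsymbol y_m^{(s)}}$. The statement $\|[B_j^HB_j]^{-1}\|_2\le 1/S$ includes invertibility of $B_j^HB_j$. For $1\le m\le v_j$, $1\le s\le S$ let $$\mathcal F_N(f,\boldsymbol\ell_m,\boldsymbol y_m^{(s)})=\frac1N\sum_{n=0}^{N-1}f(\{n\boldsymbol g/N+\boldsymbol y_m^{(s)}\})\,\mathrm e^{-2\pi\mathrm i\boldsymbol\ell_m\cdot(n\boldsymbol g/N)},$$ and let $(\mathcal B_N(f,\boldsymbol\ell_1),\ldots,\mathcal B_N(f,\boldsymbol\ell_{v_j}))^\top=[B_j^HB_j]^{-1}B_j^H\bigl(\mathcal F_N(f,\boldsymbol\ell_m,\boldsymbol y_m^{(s)})\bigr)_{(m,s)}$. Then $\mathcal A(f)(\boldsymbol x)=\sum_{\boldsymbol k\in A_{\alpha,\boldsymbol\gamma,M}}\mathcal B_N(f,\boldsymbol k)\,\mathrm e^{2\pi\mathrm i\boldsymbol k\cdot\boldsymbol x}$. CBC algorithm (for $\alpha\in\mathbb N$, $N$ prime). For $1\le s\le d$ and $(g_1,\ldots,g_s)\in\{1,\ldots,N-1\}^s$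 let $P_{\alpha,\boldsymbol\gamma,N}((g_1,\ldots,g_s))=\sum_{\boldsymbol k}r_{\alpha,\boldsymbol\gamma}(\boldsymbol k)^{-2}$, the sum being over $\boldsymbol k\in\mathbb Z^s\setminus\{\boldsymbol0\}$ with $k_1g_1+\cdots+k_sg_s\equiv0\pmod N$, where $r_{\alpha,\boldsymbol\gamma}$ on $\mathbb Z^s$ uses the weights $\gamma_1,\ldots,\gamma_s$. Set $g_1=1$; for $s=1,\ldots,d-1$, with $g_1,\ldots,g_s$ already found, choose $g_{s+1}\in\{1,\ldots,N-1\}$ minimizing $g\mapsto P_{\alpha,\boldsymbol\gamma,N}((g_1,\ldots,g_s,g))$. The output is $\boldsymbol g=(g_1,\ldots,g_d)$. *)

theory Defs
  imports
    "HOL-Probability.Probability"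
    "HOL-Number_Theory.Cong"
    "Jordan_Normal_Form.Gauss_Jordan_Elimination"
    "Jordan_Normal_Form.Schur_Decomposition"
begin

text \<open>
  All indices start from 0: coordinates are \<open>j < d\<close>, and the shift with (one-based) labels
  \<open>m, s\<close> is \<open>y (m - 1, s - 1)\<close>. Vectors with \<open>d\<close> entries are functions on \<open>{..<d}\<close> that are
  extensional, so that the dimension can vary (as it must in the component-by-component
  construction).
\<close>

definition int_vecs :: "nat \<Rightarrow> (nat \<Rightarrow> int) set" where
  "int_vecs d = {..<d} \<rightarrow>\<^sub>E UNIV"

definition zero_int_vec :: "nat \<Rightarrow> nat \<Rightarrow> int" where
  "zero_int_vec d = (\<lambda>j\<in>{..<d}. 0)"

definition unit_cube :: "nat \<Rightarrow> (nat \<Rightarrow> real) set" where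
  "unit_cube d = {..<d} \<rightarrow>\<^sub>E {0..<1}"

definition cube_measure :: "nat \<Rightarrow> (nat \<Rightarrow> real) measure" where
  "cube_measure d = PiM {..<d} (\<lambda>_. restrict_space lborel {0..<1})"

definition gen_vecs :: "nat \<Rightarrow> nat \<Rightarrow> (nat \<Rightarrow> int) set" where
  "gen_vecs d N = {..<d} \<rightarrow>\<^sub>E {1..int N - 1}"

definition dot :: "nat \<Rightarrow> (nat \<Rightarrow> 'a::comm_semiring_0) \<Rightarrow> (nat \<Rightarrow> 'a) \<Rightarrow> 'a" where
  "dot d x y = (\<Sum>j<d. x j * y j)"

definition frac_vec :: "nat \<Rightarrow> (nat \<Rightarrow> real) \<Rightarrow> nat \<Rightarrow> real" where
  "frac_vec d x = (\<lambda>j\<in>{..<d}. frac (x j))"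

definition fourier_char :: "nat \<Rightarrow> (nat \<Rightarrow> int) \<Rightarrow> (nat \<Rightarrow> real) \<Rightarrow> complex" where
  "fourier_char d k x = exp (2 * of_real pi * \<i> * of_real (dot d (\<lambda>j. real_of_int (k j)) x))"

text \<open>The Riemann zeta function; only used for real arguments greater than 1.\<close>

definition zeta :: "real \<Rightarrow> real" where
  "zeta s = (\<Sum>n. 1 / real (Suc n) powr s)"

definition korobov_weight :: "nat \<Rightarrow> real \<Rightarrow> (nat \<Rightarrow> real) \<Rightarrow> (nat \<Rightarrow> int) \<Rightarrow> real" where
  "korobov_weight d \<alpha> \<gamma> k = (\<Prod>j\<in>{j. j < d \<and> k j \<noteq> 0}. \<bar>real_of_int (k j)\<bar> powr \<alpha> / \<gamma> j)"

definition fourier_coeff :: "nat \<Rightarrow> ((nat \<Rightarrow> real) \<Rightarrow> complex) \<Rightarrow> (nat \<Rightarrow> int) \<Rightarrow> complex" where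
  "fourier_coeff d f k = (LINT x|cube_measure d. f x * cnj (fourier_char d k x))"

text \<open>
  A 1-periodic function is represented by its values on \<open>[0,1)\<^sup>d\<close>; values elsewhere are
  unconstrained and are never evaluated.
\<close>

definition korobov_space ::
    "nat \<Rightarrow> real \<Rightarrow> (nat \<Rightarrow> real) \<Rightarrow> ((nat \<Rightarrow> real) \<Rightarrow> complex) set" where
  "korobov_space d \<alpha> \<gamma> = {f.
     (\<lambda>k. cmod (fourier_coeff d f k)) summable_on int_vecs d \<and>
     (\<forall>x\<in>unit_cube d.
        ((\<lambda>k. fourier_coeff d f k * fourier_char d k x) has_sum f x) (int_vecs d)) \<and>
     (\<lambda>k. (cmod (fourier_coeff d f k))\<^sup>2 * (korobov_weight d \<alpha> \<gamma> k)\<^sup>2) summable_on int_vecs d}"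

definition korobov_norm ::
    "nat \<Rightarrow> real \<Rightarrow> (nat \<Rightarrow> real) \<Rightarrow> ((nat \<Rightarrow> real) \<Rightarrow> complex) \<Rightarrow> real" where
  "korobov_norm d \<alpha> \<gamma> f =
     sqrt (\<Sum>\<^sub>\<infinity>k\<in>int_vecs d. (cmod (fourier_coeff d f k))\<^sup>2 * (korobov_weight d \<alpha> \<gamma> k)\<^sup>2)"

text \<open>Extended reals, so that the supremum of an unbounded set is \<open>\<infinity>\<close>.\<close>

definition worst_case_error ::
    "(((nat \<Rightarrow> real) \<Rightarrow> complex) \<Rightarrow> (nat \<Rightarrow> real) \<Rightarrow> complex) \<Rightarrow>
     nat \<Rightarrow> real \<Rightarrow> (nat \<Rightarrow> real) \<Rightarrow> ereal" where
  "worst_case_error Alg d \<alpha> \<gamma> =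
     (SUP f\<in>{f \<in> korobov_space d \<alpha> \<gamma>. korobov_norm d \<alpha> \<gamma> f \<le> 1}.
        SUP x\<in>unit_cube d. ereal (cmod (f x - Alg f x)))"

definition dual_lattice :: "nat \<Rightarrow> nat \<Rightarrow> (nat \<Rightarrow> int) \<Rightarrow> (nat \<Rightarrow> int) set" where
  "dual_lattice d N g = {k \<in> int_vecs d. [dot d g k = 0] (mod int N)}"

definition merit :: "nat \<Rightarrow> real \<Rightarrow> (nat \<Rightarrow> real) \<Rightarrow> nat \<Rightarrow> (nat \<Rightarrow> int) \<Rightarrow> real" where
  "merit d \<alpha> \<gamma> N g =
     (LEAST t. \<exists>l\<in>dual_lattice d N g - {zero_int_vec d}. t = korobov_weight d \<alpha> \<gamma> l)"

definition freq_set :: "nat \<Rightarrow> real \<Rightarrow> (nat \<Rightarrow> real) \<Rightarrow> real \<Rightarrow> (nat \<Rightarrow> int) set" where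
  "freq_set d \<alpha> \<gamma> M = {k \<in> int_vecs d. korobov_weight d \<alpha> \<gamma> k < M}"

definition fiber ::
    "nat \<Rightarrow> real \<Rightarrow> (nat \<Rightarrow> real) \<Rightarrow> nat \<Rightarrow> real \<Rightarrow> (nat \<Rightarrow> int) \<Rightarrow> (nat \<Rightarrow> int) \<Rightarrow> (nat \<Rightarrow> int) set" where
  "fiber d \<alpha> \<gamma> N M g l = {k \<in> freq_set d \<alpha> \<gamma> M. [dot d k g = dot d l g] (mod int N)}"

definition max_fiber ::
    "nat \<Rightarrow> real \<Rightarrow> (nat \<Rightarrow> real) \<Rightarrow> nat \<Rightarrow> real \<Rightarrow> (nat \<Rightarrow> int) \<Rightarrow> nat" where
  "max_fiber d \<alpha> \<gamma> N M g = Max ((\<lambda>l. card (fiber d \<alpha> \<gamma> N M g l)) ` int_vecs d)"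

text \<open>
  A choice of the fibers together with an enumeration of each of them: the list \<open>L ! j\<close>
  enumerates the \<open>j\<close>-th fiber without repetition, so \<open>J = length L\<close> and
  \<open>v\<^sub>j = length (L ! j)\<close>.
\<close>

definition fiber_enumeration ::
    "nat \<Rightarrow> real \<Rightarrow> (nat \<Rightarrow> real) \<Rightarrow> nat \<Rightarrow> real \<Rightarrow> (nat \<Rightarrow> int) \<Rightarrow> (nat \<Rightarrow> int) list list \<Rightarrow> bool" where
  "fiber_enumeration d \<alpha> \<gamma> N M g L \<longleftrightarrow>
     (\<forall>j<length L. distinct (L ! j) \<and>
        (\<exists>l\<in>freq_set d \<alpha> \<gamma> M. set (L ! j) = fiber d \<alpha> \<gamma> N M g l)) \<and>
     disjoint_family_on (\<lambda>j. set (L ! j)) {..<length L} \<and>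
     (\<Union>j<length L. set (L ! j)) = freq_set d \<alpha> \<gamma> M"

text \<open>The operator norm with respect to the Euclidean norms.\<close>

definition spectral_norm :: "complex Matrix.mat \<Rightarrow> real" where
  "spectral_norm A =
     (SUP v\<in>{v \<in> carrier_vec (dim_col A). L2_set (\<lambda>i. cmod (vec_index v i)) {..<dim_col A} \<le> 1}.
        L2_set (\<lambda>i. cmod (vec_index (A *\<^sub>v v) i)) {..<dim_row A})"

text \<open>The row \<open>m * S + s\<close> of the matrix (for \<open>m < v\<close>, \<open>s < S\<close>) is the one with label \<open>(m, s)\<close>.\<close>

definition shift_matrix ::
    "nat \<Rightarrow> nat \<Rightarrow> (nat \<times> nat \<Rightarrow> nat \<Rightarrow> real) \<Rightarrow> (nat \<Rightarrow> int) list \<Rightarrow> complex Matrix.mat" where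
  "shift_matrix d S y ls = Matrix.mat (length ls * S) (length ls)
     (\<lambda>(r, i). fourier_char d (ls ! i) (y (r div S, r mod S)))"

definition gram_matrix ::
    "nat \<Rightarrow> nat \<Rightarrow> (nat \<times> nat \<Rightarrow> nat \<Rightarrow> real) \<Rightarrow> (nat \<Rightarrow> int) list \<Rightarrow> complex Matrix.mat" where
  "gram_matrix d S y ls = mat_adjoint (shift_matrix d S y ls) * shift_matrix d S y ls"

definition good_shifts ::
    "nat \<Rightarrow> nat \<Rightarrow> (nat \<times> nat \<Rightarrow> nat \<Rightarrow> real) \<Rightarrow> (nat \<Rightarrow> int) list list \<Rightarrow> bool" where
  "good_shifts d S y L \<longleftrightarrow>
     (\<forall>j<length L. \<exists>X. mat_inverse (gram_matrix d S y (L ! j)) = Some X \<and>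
        spectral_norm X \<le> 1 / real S)"

definition lattice_sum ::
    "nat \<Rightarrow> nat \<Rightarrow> (nat \<Rightarrow> int) \<Rightarrow> ((nat \<Rightarrow> real) \<Rightarrow> complex) \<Rightarrow> (nat \<Rightarrow> int) \<Rightarrow> (nat \<Rightarrow> real) \<Rightarrow> complex" where
  "lattice_sum d N g f l y =
     1 / of_nat N * (\<Sum>n<N. f (frac_vec d (\<lambda>j. real n * real_of_int (g j) / real N + y j)) *
        fourier_char d (\<lambda>j. - l j) (\<lambda>j. real n * real_of_int (g j) / real N))"

definition fiber_coeffs ::
    "nat \<Rightarrow> nat \<Rightarrow> (nat \<Rightarrow> int) \<Rightarrow> nat \<Rightarrow> (nat \<times> nat \<Rightarrow> nat \<Rightarrow> real) \<Rightarrow>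
     ((nat \<Rightarrow> real) \<Rightarrow> complex) \<Rightarrow> (nat \<Rightarrow> int) list \<Rightarrow> complex Matrix.vec" where
  "fiber_coeffs d N g S y f ls =
     (the (mat_inverse (gram_matrix d S y ls)) * mat_adjoint (shift_matrix d S y ls)) *\<^sub>v
       Matrix.vec (length ls * S)
         (\<lambda>r. lattice_sum d N g f (ls ! (r div S)) (y (r div S, r mod S)))"

definition approx_coeff ::
    "nat \<Rightarrow> nat \<Rightarrow> (nat \<Rightarrow> int) \<Rightarrow> (nat \<Rightarrow> int) list list \<Rightarrow> nat \<Rightarrow> (nat \<times> nat \<Rightarrow> nat \<Rightarrow> real) \<Rightarrow>
     ((nat \<Rightarrow> real) \<Rightarrow> complex) \<Rightarrow> (nat \<Rightarrow> int) \<Rightarrow> complex" where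
  "approx_coeff d N g L S y f k =
     (let (j, i) = (THE (j, i). j < length L \<and> i < length (L ! j) \<and> L ! j ! i = k)
      in vec_index (fiber_coeffs d N g S y f (L ! j)) i)"

definition lattice_algorithm ::
    "nat \<Rightarrow> real \<Rightarrow> (nat \<Rightarrow> real) \<Rightarrow> nat \<Rightarrow> real \<Rightarrow> (nat \<Rightarrow> int) \<Rightarrow> (nat \<Rightarrow> int) list list \<Rightarrow>
     nat \<Rightarrow> (nat \<times> nat \<Rightarrow> nat \<Rightarrow> real) \<Rightarrow> ((nat \<Rightarrow> real) \<Rightarrow> complex) \<Rightarrow> (nat \<Rightarrow> real) \<Rightarrow> complex" where
  "lattice_algorithm d \<alpha> \<gamma> N M g L S y f x =
     (\<Sum>k\<in>freq_set d \<alpha> \<gamma> M. approx_coeff d N g L S y f k * fourier_char d k x)"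

definition cbc_criterion :: "nat \<Rightarrow> real \<Rightarrow> (nat \<Rightarrow> real) \<Rightarrow> nat \<Rightarrow> (nat \<Rightarrow> int) \<Rightarrow> real" where
  "cbc_criterion s \<alpha> \<gamma> N g =
     (\<Sum>\<^sub>\<infinity>k\<in>dual_lattice s N g - {zero_int_vec s}. 1 / (korobov_weight s \<alpha> \<gamma> k)\<^sup>2)"

text \<open>Ties in the component-by-component construction may be broken arbitrarily.\<close>

definition cbc_output :: "nat \<Rightarrow> real \<Rightarrow> (nat \<Rightarrow> real) \<Rightarrow> nat \<Rightarrow> (nat \<Rightarrow> int) \<Rightarrow> bool" where
  "cbc_output d \<alpha> \<gamma> N g \<longleftrightarrow> g \<in> gen_vecs d N \<and> g 0 = 1 \<and>
     (\<forall>s\<in>{1..<d}. is_arg_min (\<lambda>h. cbc_criterion (Suc s) \<alpha> \<gamma> N ((restrict g {..<s})(s := h)))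
                     (\<lambda>h. h \<in> {1..int N - 1}) (g s))"

text \<open>
  The maximum is attained for \<open>c > 0\<close>, \<open>\<alpha> > 1/2\<close>, \<open>d \<ge> 1\<close>: the expression is continuous
  in \<open>l\<close> and tends to 0 as \<open>l\<close> decreases to \<open>1/\<alpha>\<close>.
\<close>

definition threshold :: "nat \<Rightarrow> real \<Rightarrow> (nat \<Rightarrow> real) \<Rightarrow> real \<Rightarrow> real" where
  "threshold d \<alpha> \<gamma> c = (GREATEST t. \<exists>l\<in>{1 / \<alpha><..2}.
     t = (c * (\<Prod>j<d. inverse (1 + 2 * \<gamma> j powr l * zeta (\<alpha> * l)))) powr (1 / l))"

definition random_threshold :: "nat \<Rightarrow> real \<Rightarrow> (nat \<Rightarrow> real) \<Rightarrow> real \<Rightarrow> nat \<Rightarrow> real" where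
  "random_threshold d \<alpha> \<gamma> \<delta> N = threshold d \<alpha> \<gamma> ((real N - 1) * (1 - \<delta>))"

definition cbc_threshold :: "nat \<Rightarrow> real \<Rightarrow> (nat \<Rightarrow> real) \<Rightarrow> nat \<Rightarrow> real" where
  "cbc_threshold d \<alpha> \<gamma> N = threshold d \<alpha> \<gamma> (real N / 2)"

definition dyadic_level :: "real \<Rightarrow> real \<Rightarrow> nat \<Rightarrow> bool" where
  "dyadic_level \<alpha> M m\<^sub>0 \<longleftrightarrow> 1 \<le> m\<^sub>0 \<and> 2 ^ (m\<^sub>0 - 1) < M powr (1 / \<alpha>) \<and> M powr (1 / \<alpha>) \<le> 2 ^ m\<^sub>0"

definition R_star :: "nat \<Rightarrow> nat \<Rightarrow> nat" where
  "R_star d m\<^sub>0 = 1 + (3 ^ d - 1) * (m\<^sub>0 + d) ^ (d - 1)"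

definition num_shifts :: "real \<Rightarrow> nat \<Rightarrow> nat \<Rightarrow> nat" where
  "num_shifts K N R = nat \<lceil>2 * K * real R * ln (real N)\<rceil>"

definition random_setting ::
    "nat \<Rightarrow> real \<Rightarrow> (nat \<Rightarrow> real) \<Rightarrow> real \<Rightarrow> nat \<Rightarrow> real \<Rightarrow> nat \<Rightarrow> bool" where
  "random_setting d \<alpha> \<gamma> \<delta> N M m\<^sub>0 \<longleftrightarrow> prime N \<and> 2 < N \<and>
     M = random_threshold d \<alpha> \<gamma> \<delta> N \<and> 1 < M \<and> dyadic_level \<alpha> M m\<^sub>0"

definition good_generator ::
    "nat \<Rightarrow> real \<Rightarrow> (nat \<Rightarrow> real) \<Rightarrow> nat \<Rightarrow> real \<Rightarrow> nat \<Rightarrow> (nat \<Rightarrow> int) \<Rightarrow> bool" where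
  "good_generator d \<alpha> \<gamma> N M m\<^sub>0 g \<longleftrightarrow>
     M \<le> merit d \<alpha> \<gamma> N g \<and> max_fiber d \<alpha> \<gamma> N M g \<le> R_star d m\<^sub>0"

text \<open>
  The joint law of the generating vector and the shifts. The number of shifts depends on the
  generating vector, so an infinite array of independent uniform shifts is drawn,
  independently of the generating vector; only its entries \<open>(m, s)\<close> with \<open>m < R\<close>, \<open>s < S\<close>
  are ever used, and given the generating vector these are independent and uniform.
\<close>

definition joint_measure ::
    "nat \<Rightarrow> nat \<Rightarrow> ((nat \<Rightarrow> int) \<times> (nat \<times> nat \<Rightarrow> nat \<Rightarrow> real)) measure" where
  "joint_measure d N =
     uniform_count_measure (gen_vecs d N) \<Otimes>\<^sub>M PiM (UNIV :: (nat \<times> nat) set) (\<lambda>_. cube_measure d)"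

end

theory Submission
  imports Defs "HOL-Library.Discrete_Functions"
begin

text \<open>
  Write \<open>r\<close> for the Korobov weight, \<open>A = {r < M}\<close> for the set of frequencies that are
  reconstructed, and \<open>Z\<^sub>l\<close> for the product of the factors \<open>1 + 2 \<gamma>\<^sub>j\<^sup>l \<zeta>(\<alpha>l)\<close>, which is the sum
  of \<open>r(k)\<^sup>-\<^sup>l\<close> over all frequencies \<open>k\<close>.

  \<^emph>\<open>Error.\<close> A lattice sum cannot distinguish frequencies in one residue class of \<open>k \<cdot> g\<close> modulo
  \<open>N\<close>. The \<open>v\<close> unknown coefficients of a fiber are therefore recovered by least squares from
  \<open>v S\<close> shifted lattice sums, each of which is perturbed by at most the Fourier mass that \<open>f\<close>
  has outside \<open>A\<close> in that residue class. When the inverse Gram matrix has norm at most \<open>1/S\<close>, the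
  least squares map has norm at most \<open>1/\<surd>S\<close>, so that the coefficients of a fiber are off by at
  most \<open>v \<le> R\<close> times this mass, in the sum norm. Different fibers belong to different residue
  classes. Hence the total error is at most \<open>1 + R\<close> times the Fourier mass outside \<open>A\<close>
  (\<open>approximation_error\<close>). By the Cauchy-Schwarz inequality and \<open>r\<^sup>-\<^sup>2 \<le> M\<^sup>l\<^sup>-\<^sup>2 r\<^sup>-\<^sup>l\<close> outside \<open>A\<close>
  it is at most \<open>(1 + R) \<surd>(M\<^sup>l\<^sup>-\<^sup>2 Z\<^sub>l)\<close> (\<open>worst_case_error_le\<close>). The threshold \<open>M\<close> is at least a
  constant times \<open>N\<close> to the power \<open>1/l\<close>, the exponent \<open>l\<close> may be taken close to \<open>1/\<alpha>\<close>, and \<open>R\<close>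
  and \<open>S\<close> are polylogarithmic in \<open>N\<close>; this gives the rate (\<open>worst_case_error_rate\<close>).

  \<^emph>\<open>Generators.\<close> What has to be achieved is that no nonzero vector of the dual lattice lies in \<open>A\<close>
  (\<open>separated\<close>). Two elements of a fiber with the same signs and the same dyadic sizes in all
  but one coordinate would differ by such a vector, and counting signs and sizes
  gives \<open>R \<le> R\<^sub>*\<close> (\<open>card_fiber_le_R_star\<close>). For random \<open>g\<close> this is a union bound: \<open>M\<close> is
  chosen so that \<open>A\<close> has at most \<open>(N - 1)(1 - \<delta>)\<close> elements (\<open>card_freq_set_le\<close>), and a fixed
  nonzero one, whose entries are smaller than \<open>N\<close> in modulus, is in the dual lattice with
  probability at most \<open>1/(N - 1)\<close>. For the
  component-by-component construction, averaging over the next component shows by induction that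
  the sum of \<open>r\<^sup>-\<^sup>2\<close> over the nonzero dual vectors is at most \<open>(Z\<^sub>l/(N - 1))\<close> to the power \<open>2/l\<close>
  (\<open>cbc_criterion_le\<close>), so that no single term can exceed \<open>M\<^sup>-\<^sup>2\<close> (\<open>cbc_separated\<close>).

  \<^emph>\<open>Shifts.\<close> An off-diagonal entry of a Gram matrix is a sum of \<open>v S\<close> independent uniform points
  of the unit circle. The moment generating function of their real part is at most
  \<open>exp (a\<^sup>2/4)\<close>, already after averaging over four quarter turns (\<open>mgf_fourier_char_le\<close>). The
  Chernoff bound makes the entry exceed \<open>S\<close> with probability at most \<open>4 N\<^sup>-\<^sup>K\<close>; there are at most
  \<open>N\<close> fibers with at most \<open>R(R - 1)/2\<close> pairs each, which adds up to \<open>2 N\<^sup>1\<^sup>-\<^sup>K R\<^sup>2\<close>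
  (\<open>prob_good_shifts_ge\<close>). If no entry exceeds \<open>S\<close>, the diagonal \<open>v S\<close> dominates the
  off-diagonal part, whose norm is at most \<open>(v - 1) S\<close>, and the Gram matrix is bounded below by \<open>S\<close>.
\<close>

section \<open>The zeta function and the truncation threshold\<close>

lemma summable_zeta:
  assumes "1 < s"
  shows "summable (\<lambda>n. 1 / real (Suc n) powr s)"
proof -
  have "summable (\<lambda>n. real n powr (- s))"
    using assms by (simp add: summable_real_powr_iff)
  then have "summable (\<lambda>n. real (Suc n) powr (- s))"
    by (subst summable_Suc_iff)
  then show ?thesis
    by (simp add: powr_minus_divide)
qed

lemma sum_le_zeta:
  assumes "1 < s" "finite A"
  shows "(\<Sum>n\<in>A. 1 / real (Suc n) powr s) \<le> zeta s"
  unfolding zeta_def using summable_zeta[OF assms(1)] assms(2)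
  by (intro sum_le_suminf) auto

lemma zeta_ge_1: "1 < s \<Longrightarrow> 1 \<le> zeta s"
  using sum_le_zeta[of s "{0}"] by simp

lemma continuous_on_zeta:
  assumes "1 < a"
  shows "continuous_on {a..} zeta"
proof -
  have "uniform_limit {a..} (\<lambda>n s. \<Sum>i<n. 1 / real (Suc i) powr s)
      (\<lambda>s. \<Sum>i. 1 / real (Suc i) powr s) sequentially"
  proof (rule Weierstrass_m_test)
    show "summable (\<lambda>n. 1 / real (Suc n) powr a)"
      by (rule summable_zeta[OF assms])
    show "norm (1 / real (Suc n) powr s) \<le> 1 / real (Suc n) powr a" if "s \<in> {a..}" for n s
      using that by (auto intro!: divide_left_mono powr_mono)
  qed
  then have "uniform_limit {a..} (\<lambda>n s. \<Sum>i<n. 1 / real (Suc i) powr s) zeta sequentially"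
    unfolding zeta_def[abs_def] .
  moreover have "continuous_on {a..} (\<lambda>s. \<Sum>i<n. 1 / real (Suc i) powr s)" for n
    by (intro continuous_intros) auto
  ultimately show ?thesis
    by (intro uniform_limit_theorem) auto
qed

text \<open>
  Each partial sum is continuous at 1, where the partial sums are the unbounded harmonic numbers.
\<close>

lemma zeta_large_near_1:
  obtains a where "1 < a" "\<And>s. 1 < s \<Longrightarrow> s \<le> a \<Longrightarrow> B \<le> zeta s"
proof -
  have "\<not> summable (\<lambda>n. 1 / real (Suc n))"
    using not_summable_harmonic[where 'a=real]
    by (metis (no_types, lifting) ext inverse_eq_divide summable_Suc_iff)
  then have "\<not> (\<forall>n. (\<Sum>i<n. 1 / real (Suc i)) \<le> B + 1)"
    by (metis (no_types, lifting) bounded_imp_summable divide_nonneg_nonneg of_nat_0_le_iff zero_le_one lessThan_Suc_atMost)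
  then obtain n where n: "B + 1 < (\<Sum>i<n. 1 / real (Suc i))"
    by (auto simp: not_le)
  have "continuous (at 1) (\<lambda>s. \<Sum>i<n. 1 / real (Suc i) powr s)"
    by (intro continuous_intros) auto
  then have "((\<lambda>s. \<Sum>i<n. 1 / real (Suc i) powr s) \<longlongrightarrow> (\<Sum>i<n. 1 / real (Suc i))) (at 1)"
    by (simp add: continuous_within)
  then have "eventually (\<lambda>s. B < (\<Sum>i<n. 1 / real (Suc i) powr s)) (at 1)"
    using n by (intro order_tendstoD(1)) auto
  then obtain e where e: "e > 0"
    "\<And>s. s \<noteq> 1 \<Longrightarrow> dist s 1 < e \<Longrightarrow> B < (\<Sum>i<n. 1 / real (Suc i) powr s)"
    by (auto simp: eventually_at)
  show ?thesis
  proof (rule that[of "1 + e / 2"])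
    show "1 < 1 + e / 2" using e by simp
    fix s :: real assume s: "1 < s" "s \<le> 1 + e / 2"
    then have "B < (\<Sum>i<n. 1 / real (Suc i) powr s)"
      using e by (intro e(2)) (auto simp: dist_real_def)
    then show "B \<le> zeta s" using sum_le_zeta[OF s(1), of "{..<n}"] by simp
  qed
qed

definition zeta_prod :: "nat \<Rightarrow> real \<Rightarrow> (nat \<Rightarrow> real) \<Rightarrow> real \<Rightarrow> real" where
  "zeta_prod d \<alpha> \<gamma> l = (\<Prod>j<d. 1 + 2 * \<gamma> j powr l * zeta (\<alpha> * l))"

locale korobov =
  fixes d :: nat and \<alpha> :: real and \<gamma> :: "nat \<Rightarrow> real"
  assumes smooth: "1 / 2 < \<alpha>"
    and gamma: "\<And>j. j < d \<Longrightarrow> 0 < \<gamma> j \<and> \<gamma> j \<le> 1"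
begin

lemma alpha_pos: "0 < \<alpha>"
  using smooth by simp

lemma exponent_bounds:
  assumes "l \<in> {1 / \<alpha><..2}"
  shows "1 < \<alpha> * l" "0 < l" "l \<le> 2"
proof -
  show "1 < \<alpha> * l" using assms alpha_pos by (simp add: field_simps)
  show "0 < l" using assms alpha_pos
    by (metis greaterThanAtMost_iff order_less_trans zero_less_divide_1_iff)
qed (use assms in auto)

lemma zeta_prod_factor_ge:
  assumes "l \<in> {1 / \<alpha><..2}" "j < d"
  shows "1 \<le> 1 + 2 * \<gamma> j powr l * zeta (\<alpha> * l)"
  using zeta_ge_1[OF exponent_bounds(1)[OF assms(1)]] by simp

lemma zeta_prod_ge_1:
  assumes "l \<in> {1 / \<alpha><..2}"
  shows "1 \<le> zeta_prod d \<alpha> \<gamma> l"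
  unfolding zeta_prod_def using zeta_prod_factor_ge[OF assms] by (intro prod_ge_1) auto

text \<open>
  The expression tends to 0 as \<open>l\<close> decreases to \<open>1/\<alpha>\<close>, because already the factor of the first
  coordinate blows up there with \<open>\<zeta>\<close>. So to the left of some \<open>l1\<close> it stays below its value at 2,
  and on the compact interval from \<open>l1\<close> to 2 it is continuous.
\<close>

lemma threshold_attained:
  assumes "1 \<le> d" "0 < c"
  shows "\<exists>l\<in>{1 / \<alpha><..2}. threshold d \<alpha> \<gamma> c = (c / zeta_prod d \<alpha> \<gamma> l) powr (1 / l)"
    and "\<And>l. l \<in> {1 / \<alpha><..2} \<Longrightarrow> (c / zeta_prod d \<alpha> \<gamma> l) powr (1 / l) \<le> threshold d \<alpha> \<gamma> c"
proof -
  define f where "f l = (c / zeta_prod d \<alpha> \<gamma> l) powr (1 / l)" for l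
  have two: "2 \<in> {1 / \<alpha><..2}"
    using smooth alpha_pos by (simp add: field_simps)
  have f2: "0 < f 2"
    using zeta_prod_ge_1[OF two] \<open>0 < c\<close> by (simp add: f_def)
  \<comment> \<open>If the base of the power is at most \<open>e \<le> 1\<close>, the power with exponent \<open>1/l \<ge> 1/2\<close> is at most
    \<open>\<surd>e \<le> f 2\<close>.\<close>
  define e where "e = min 1 ((f 2)\<^sup>2)"
  have e: "0 < e" "e \<le> 1" "sqrt e \<le> f 2"
    using f2 by (auto simp: e_def min_def real_le_lsqrt real_sqrt_le_iff intro: real_le_lsqrt)
  have g0: "0 < \<gamma> 0" "\<gamma> 0 \<le> 1" using gamma[of 0] assms(1) by auto
  obtain a where a: "1 < a" "\<And>s. 1 < s \<Longrightarrow> s \<le> a \<Longrightarrow> c / (e * (2 * (\<gamma> 0)\<^sup>2)) \<le> zeta s"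
    using zeta_large_near_1 by blast
  define l1 where "l1 = min 2 (a / \<alpha>)"
  have l1: "l1 \<in> {1 / \<alpha><..2}"
    using two a(1) alpha_pos by (auto simp: l1_def divide_strict_right_mono)
  have small: "f l \<le> f 2" if l: "1 / \<alpha> < l" "l \<le> l1" for l
  proof -
    have l': "l \<in> {1 / \<alpha><..2}" using l l1 by auto
    have "\<alpha> * l \<le> a" using l alpha_pos by (simp add: l1_def field_simps)
    then have z: "c / (e * (2 * (\<gamma> 0)\<^sup>2)) \<le> zeta (\<alpha> * l)"
      using a(2) exponent_bounds(1)[OF l'] by blast
    have zge: "1 \<le> zeta (\<alpha> * l)" using zeta_ge_1 exponent_bounds(1)[OF l'] by blast
    have "(\<gamma> 0)\<^sup>2 \<le> \<gamma> 0 powr l"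
      using g0 l' powr_mono'[of l 2 "\<gamma> 0"] by (simp add: powr_numeral)
    then have "2 * (\<gamma> 0)\<^sup>2 * (c / (e * (2 * (\<gamma> 0)\<^sup>2))) \<le> 2 * \<gamma> 0 powr l * zeta (\<alpha> * l)"
      using z zge \<open>0 < c\<close> e g0 by (intro mult_mono) auto
    then have "c / e \<le> 1 + 2 * \<gamma> 0 powr l * zeta (\<alpha> * l)"
      using g0 e by (simp add: field_simps)
    also have "\<dots> \<le> zeta_prod d \<alpha> \<gamma> l"
    proof -
      have "(\<Prod>j\<in>{0}. 1 + 2 * \<gamma> j powr l * zeta (\<alpha> * l)) \<le> zeta_prod d \<alpha> \<gamma> l"
        unfolding zeta_prod_def using assms(1) zeta_prod_factor_ge[OF l'] order_trans[OF zero_le_one zeta_prod_factor_ge[OF l']]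
        by (intro prod_mono2) auto
      then show ?thesis by simp
    qed
    finally have "c / zeta_prod d \<alpha> \<gamma> l \<le> e"
      using e zeta_prod_ge_1[OF l'] \<open>0 < c\<close> by (simp add: field_simps)
    then have "f l \<le> e powr (1 / l)"
      unfolding f_def using \<open>0 < c\<close> zeta_prod_ge_1[OF l'] exponent_bounds(2)[OF l']
      by (intro powr_mono2) auto
    also have "\<dots> \<le> e powr (1 / 2)"
      using e exponent_bounds[OF l'] by (intro powr_mono') (auto simp: field_simps)
    also have "\<dots> = sqrt e" using e by (simp add: powr_half_sqrt)
    finally show ?thesis using e(3) by simp
  qed
  have cont: "continuous_on {l1..2} f"
  proof -
    have al: "1 < \<alpha> * l1" by (rule exponent_bounds(1)[OF l1])
    have "continuous_on {l1..2} (\<lambda>l. zeta (\<alpha> * l))"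
      using alpha_pos by (intro continuous_on_compose2[OF continuous_on_zeta[OF al]] continuous_intros) auto
    then have "continuous_on {l1..2} (zeta_prod d \<alpha> \<gamma>)"
      unfolding zeta_prod_def[abs_def] using gamma
      by (intro continuous_intros) (auto simp: less_le)
    moreover have "zeta_prod d \<alpha> \<gamma> l \<noteq> 0" "l \<noteq> 0" if "l \<in> {l1..2}" for l
      using zeta_prod_ge_1[of l] exponent_bounds(2)[of l] that l1 by auto
    ultimately show ?thesis
      unfolding f_def[abs_def] using \<open>0 < c\<close>
      by (intro continuous_intros) auto
  qed
  have "\<exists>l\<in>{l1..2}. \<forall>l'\<in>{l1..2}. f l' \<le> f l"
    using l1 cont by (intro continuous_attains_sup) auto
  then obtain m where m: "m \<in> {l1..2}" "\<And>l. l \<in> {l1..2} \<Longrightarrow> f l \<le> f m" by blast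
  have max: "f l \<le> f m" if "l \<in> {1 / \<alpha><..2}" for l
  proof (cases "l \<le> l1")
    case True
    then have "f l \<le> f 2" using small that by auto
    also have "f 2 \<le> f m" using m(2) l1 by auto
    finally show ?thesis .
  qed (use that m in auto)
  have mm: "m \<in> {1 / \<alpha><..2}" using m(1) l1 by auto
  have "threshold d \<alpha> \<gamma> c = (GREATEST t. \<exists>l\<in>{1 / \<alpha><..2}. t = f l)"
    by (simp add: threshold_def f_def zeta_prod_def prod_inversef[symmetric] divide_inverse o_def)
  also have "\<dots> = f m"
    using max mm by (intro Greatest_equality) auto
  finally have eq: "threshold d \<alpha> \<gamma> c = f m" .
  show "\<exists>l\<in>{1 / \<alpha><..2}. threshold d \<alpha> \<gamma> c = (c / zeta_prod d \<alpha> \<gamma> l) powr (1 / l)"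
    using mm eq by (auto simp: f_def)
  show "\<And>l. l \<in> {1 / \<alpha><..2} \<Longrightarrow> (c / zeta_prod d \<alpha> \<gamma> l) powr (1 / l) \<le> threshold d \<alpha> \<gamma> c"
    using max eq by (auto simp: f_def)
qed

text \<open>
  The exponent \<open>1/l\<close> is strictly below \<open>\<alpha>\<close>. This keeps all frequencies below the threshold
  inside the box with entries smaller than \<open>N\<close>.
\<close>

lemma threshold_less:
  assumes "1 \<le> d" "0 < c" "c \<le> real N" "1 < N" "1 < threshold d \<alpha> \<gamma> c"
  shows "threshold d \<alpha> \<gamma> c < real N powr \<alpha>"
proof -
  obtain l where l: "l \<in> {1 / \<alpha><..2}"
    and eq: "threshold d \<alpha> \<gamma> c = (c / zeta_prod d \<alpha> \<gamma> l) powr (1 / l)"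
    using threshold_attained(1)[OF assms(1,2)] by blast
  note b = exponent_bounds[OF l] and z = zeta_prod_ge_1[OF l]
  have "c / zeta_prod d \<alpha> \<gamma> l \<le> c / 1"
    using z assms(2) by (intro divide_left_mono) auto
  then have "(c / zeta_prod d \<alpha> \<gamma> l) powr (1 / l) \<le> real N powr (1 / l)"
    using assms z b by (intro powr_mono2) auto
  also have "\<dots> < real N powr \<alpha>"
    using assms b by (intro powr_less_mono) (auto simp: field_simps)
  finally show ?thesis using eq by simp
qed

section \<open>The weights of the Korobov space\<close>

lemma korobov_weight_eq:
  "korobov_weight d \<alpha> \<gamma> k = (\<Prod>j<d. if k j = 0 then 1 else \<bar>real_of_int (k j)\<bar> powr \<alpha> / \<gamma> j)"
proof -
  have "korobov_weight d \<alpha> \<gamma> k = (\<Prod>j\<in>{j. j < d \<and> k j \<noteq> 0}. if k j = 0 then 1 else \<bar>real_of_int (k j)\<bar> powr \<alpha> / \<gamma> j)"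
    unfolding korobov_weight_def by (intro prod.cong) auto
  also have "\<dots> = (\<Prod>j<d. if k j = 0 then 1 else \<bar>real_of_int (k j)\<bar> powr \<alpha> / \<gamma> j)"
    by (intro prod.mono_neutral_left) auto
  finally show ?thesis .
qed

lemma weight_factor_ge_1:
  assumes "j < d" "t \<noteq> 0"
  shows "1 \<le> \<bar>real_of_int t\<bar> powr \<alpha> / \<gamma> j"
proof -
  have "1 \<le> \<bar>real_of_int t\<bar>" using assms(2) by linarith
  then have "1 \<le> \<bar>real_of_int t\<bar> powr \<alpha>" using alpha_pos by (simp add: ge_one_powr_ge_zero)
  then show ?thesis using gamma[OF assms(1)] by (simp add: field_simps)
qed

lemma korobov_weight_ge_1: "1 \<le> korobov_weight d \<alpha> \<gamma> k"
  unfolding korobov_weight_eq using weight_factor_ge_1 by (intro prod_ge_1) auto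

lemma korobov_weight_pos: "0 < korobov_weight d \<alpha> \<gamma> k"
  using korobov_weight_ge_1[of k] by simp

lemma abs_powr_le_korobov_weight:
  assumes "j < d"
  shows "\<bar>real_of_int (k j)\<bar> powr \<alpha> \<le> korobov_weight d \<alpha> \<gamma> k"
proof (cases "k j = 0")
  case True
  then show ?thesis using korobov_weight_pos[of k] alpha_pos by simp
next
  case False
  have "\<bar>real_of_int (k j)\<bar> powr \<alpha> \<le> \<bar>real_of_int (k j)\<bar> powr \<alpha> / \<gamma> j"
    using gamma[OF assms] by (simp add: field_simps mult_left_le_one_le)
  also have "\<dots> = (\<Prod>j\<in>{j}. if k j = 0 then 1 else \<bar>real_of_int (k j)\<bar> powr \<alpha> / \<gamma> j)"
    using False by simp
  also have "\<dots> \<le> korobov_weight d \<alpha> \<gamma> k"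
    unfolding korobov_weight_eq using assms weight_factor_ge_1
    by (intro prod_mono2) (auto intro: order_trans[OF zero_le_one])
  finally show ?thesis .
qed

lemma finite_freq_set: "finite (freq_set d \<alpha> \<gamma> M)"
proof -
  have "k j \<in> {-\<lceil>M powr (1 / \<alpha>)\<rceil>..\<lceil>M powr (1 / \<alpha>)\<rceil>}" if k: "k \<in> freq_set d \<alpha> \<gamma> M" and j: "j < d" for k j
  proof -
    have "\<bar>real_of_int (k j)\<bar> powr \<alpha> \<le> M"
      using abs_powr_le_korobov_weight[OF j, of k] k by (simp add: freq_set_def)
    then have "(\<bar>real_of_int (k j)\<bar> powr \<alpha>) powr (1 / \<alpha>) \<le> M powr (1 / \<alpha>)"
      using alpha_pos by (intro powr_mono2) auto
    then have "\<bar>real_of_int (k j)\<bar> \<le> M powr (1 / \<alpha>)"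
      using alpha_pos by (simp add: powr_powr)
    then show ?thesis by (auto simp: abs_le_iff) linarith+
  qed
  then have "freq_set d \<alpha> \<gamma> M \<subseteq> {..<d} \<rightarrow>\<^sub>E {-\<lceil>M powr (1 / \<alpha>)\<rceil>..\<lceil>M powr (1 / \<alpha>)\<rceil>}"
    by (intro subsetI PiE_I) (simp_all add: freq_set_def int_vecs_def PiE_iff extensional_def)
  then show ?thesis
    by (rule finite_subset) (auto intro: finite_PiE)
qed

lemma sum_abs_powr_le:
  assumes "1 < s" "finite F"
  shows "(\<Sum>t\<in>F - {0}. 1 / \<bar>real_of_int t\<bar> powr s) \<le> 2 * zeta s"
proof -
  have half: "(\<Sum>t\<in>A. 1 / \<bar>real_of_int t\<bar> powr s) \<le> zeta s"
    if A: "finite A" "0 \<notin> A" "inj_on (\<lambda>t. nat \<bar>t\<bar> - 1) A" for A :: "int set"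
  proof -
    have "(\<Sum>t\<in>A. 1 / \<bar>real_of_int t\<bar> powr s) = (\<Sum>t\<in>A. 1 / real (Suc (nat \<bar>t\<bar> - 1)) powr s)"
    proof (intro sum.cong refl)
      fix t assume "t \<in> A"
      then have "t \<noteq> 0" using A by auto
      then have "real (Suc (nat \<bar>t\<bar> - 1)) = \<bar>real_of_int t\<bar>" by linarith
      then show "1 / \<bar>real_of_int t\<bar> powr s = 1 / real (Suc (nat \<bar>t\<bar> - 1)) powr s" by simp
    qed
    also have "\<dots> = (\<Sum>n\<in>(\<lambda>t. nat \<bar>t\<bar> - 1) ` A. 1 / real (Suc n) powr s)"
      using A(3) by (simp add: sum.reindex)
    also have "\<dots> \<le> zeta s" using assms(1) A by (intro sum_le_zeta) auto
    finally show ?thesis .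
  qed
  let ?u = "\<lambda>t::int. 1 / \<bar>real_of_int t\<bar> powr s"
  have split: "F - {0} = {t\<in>F. t > 0} \<union> {t\<in>F. t < 0}" by auto
  have "sum ?u ({t\<in>F. t > 0} \<union> {t\<in>F. t < 0}) = sum ?u {t\<in>F. t > 0} + sum ?u {t\<in>F. t < 0}"
    by (rule sum.union_disjoint) (use assms(2) in auto)
  then have "sum ?u (F - {0}) = sum ?u {t\<in>F. t > 0} + sum ?u {t\<in>F. t < 0}"
    by (simp only: split)
  also have "\<dots> \<le> zeta s + zeta s"
  proof (intro add_mono half)
    show "inj_on (\<lambda>t. nat \<bar>t\<bar> - 1) {t\<in>F. t > 0}" by (rule inj_onI, simp, arith)
    show "inj_on (\<lambda>t. nat \<bar>t\<bar> - 1) {t\<in>F. t < 0}" by (rule inj_onI, simp, arith)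
  qed (use assms(2) in auto)
  finally show ?thesis by simp
qed

lemma korobov_weight_powr:
  "korobov_weight d \<alpha> \<gamma> k powr (- l)
    = (\<Prod>j<d. if k j = 0 then 1 else \<gamma> j powr l * (1 / \<bar>real_of_int (k j)\<bar> powr (\<alpha> * l)))"
proof -
  have "korobov_weight d \<alpha> \<gamma> k powr (- l)
      = (\<Prod>j<d. (if k j = 0 then 1 else \<bar>real_of_int (k j)\<bar> powr \<alpha> / \<gamma> j) powr (- l))"
    unfolding korobov_weight_eq
    by (subst prod_powr_distrib) (use gamma in \<open>auto simp: less_le\<close>)
  also have "\<dots> = (\<Prod>j<d. if k j = 0 then 1 else \<gamma> j powr l * (1 / \<bar>real_of_int (k j)\<bar> powr (\<alpha> * l)))"
    using gamma by (intro prod.cong refl)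
      (auto simp: powr_divide powr_powr powr_minus field_simps less_le)
  finally show ?thesis .
qed

text \<open>
  The summand is a product over the coordinates, so that the sum over a box factors, and each
  one-dimensional sum is at most \<open>1 + 2 \<gamma>\<^sub>j\<^sup>l \<zeta>(\<alpha>l)\<close>.
\<close>

lemma sum_korobov_weight_powr_le:
  assumes l: "l \<in> {1 / \<alpha><..2}" and F: "finite F" "F \<subseteq> int_vecs d"
  shows "(\<Sum>k\<in>F. korobov_weight d \<alpha> \<gamma> k powr (- l)) \<le> zeta_prod d \<alpha> \<gamma> l"
proof -
  define w where "w j t = (if t = 0 then 1 else \<gamma> j powr l * (1 / \<bar>real_of_int t\<bar> powr (\<alpha> * l)))" for j t
  define B where "B j = insert 0 ((\<lambda>k. k j) ` F)" for j
  have w0: "0 \<le> w j t" for j t by (simp add: w_def)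
  have "F \<subseteq> (\<Pi>\<^sub>E j\<in>{..<d}. B j)"
    using F(2) by (auto simp: B_def int_vecs_def PiE_iff)
  then have "(\<Sum>k\<in>F. korobov_weight d \<alpha> \<gamma> k powr (- l)) \<le> (\<Sum>k\<in>(\<Pi>\<^sub>E j\<in>{..<d}. B j). korobov_weight d \<alpha> \<gamma> k powr (- l))"
    using F(1) by (intro sum_mono2 finite_PiE) (auto simp: B_def)
  also have "\<dots> = (\<Sum>k\<in>(\<Pi>\<^sub>E j\<in>{..<d}. B j). \<Prod>j<d. w j (k j))"
    by (simp only: korobov_weight_powr w_def)
  also have "\<dots> = (\<Prod>j<d. \<Sum>t\<in>B j. w j t)"
    using F(1) by (intro prod_sum_PiE[symmetric]) (auto simp: B_def)
  also have "\<dots> \<le> (\<Prod>j<d. 1 + 2 * \<gamma> j powr l * zeta (\<alpha> * l))"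
  proof (intro prod_mono conjI sum_nonneg w0)
    fix j assume "j \<in> {..<d}"
    have fin: "finite (B j)" "0 \<in> B j" using F(1) by (auto simp: B_def)
    have "(\<Sum>t\<in>B j. w j t) = w j 0 + (\<Sum>t\<in>B j - {0}. w j t)"
      using fin by (intro sum.remove)
    also have "(\<Sum>t\<in>B j - {0}. w j t) = \<gamma> j powr l * (\<Sum>t\<in>B j - {0}. 1 / \<bar>real_of_int t\<bar> powr (\<alpha> * l))"
      unfolding sum_distrib_left by (intro sum.cong) (auto simp: w_def)
    also have "\<dots> \<le> \<gamma> j powr l * (2 * zeta (\<alpha> * l))"
      using fin exponent_bounds(1)[OF l] by (intro mult_left_mono sum_abs_powr_le) auto
    finally show "(\<Sum>t\<in>B j. w j t) \<le> 1 + 2 * \<gamma> j powr l * zeta (\<alpha> * l)"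
      by (simp add: w_def)
  qed
  finally show ?thesis by (simp add: zeta_prod_def)
qed

end

section \<open>Generating vectors without short dual vectors\<close>

lemma finite_gen_vecs [simp]: "finite (gen_vecs d N)"
  by (simp add: gen_vecs_def finite_PiE)

lemma card_gen_vecs: "1 \<le> N \<Longrightarrow> card (gen_vecs d N) = (N - 1) ^ d"
  by (simp add: gen_vecs_def card_PiE nat_diff_distrib)

lemma dot_remove:
  "j < d \<Longrightarrow> dot d x y = x j * y j + (\<Sum>i\<in>{..<d} - {j}. x i * y i)"
  unfolding dot_def by (rule sum.remove) auto

lemma eq_of_dvd_diff:
  fixes a b :: int
  assumes "a \<in> {1..int N - 1}" "b \<in> {1..int N - 1}" "int N dvd a - b"
  shows "a = b"
proof (rule ccontr)
  assume "a \<noteq> b"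
  then have "int N \<le> \<bar>a - b\<bar>" using assms(3) dvd_imp_le_int[of "a - b" "int N"] by simp
  then show False using assms by auto
qed

text \<open>
  The entry \<open>l\<^sub>j\<close> is invertible modulo \<open>N\<close>, so the other coordinates of \<open>g\<close> determine \<open>g\<^sub>j\<close>.
\<close>

lemma card_annihilating_generators_le:
  assumes "prime N" "j < d" "\<not> int N dvd l j"
  shows "card {g \<in> gen_vecs d N. [dot d g l = 0] (mod int N)} \<le> (N - 1) ^ (d - 1)"
proof -
  let ?A = "{g \<in> gen_vecs d N. [dot d g l = 0] (mod int N)}"
  let ?B = "({..<d} - {j}) \<rightarrow>\<^sub>E {1..int N - 1}"
  have "inj_on (\<lambda>g. restrict g ({..<d} - {j})) ?A"
  proof (rule inj_onI)
    fix g h assume g: "g \<in> ?A" and h: "h \<in> ?A"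
      and eq: "restrict g ({..<d} - {j}) = restrict h ({..<d} - {j})"
    have off: "g i = h i" if "i < d" "i \<noteq> j" for i
      using fun_cong[OF eq, of i] that by simp
    have "dot d g l - dot d h l = (g j - h j) * l j"
      using off by (simp add: dot_remove[OF assms(2)] algebra_simps)
    moreover have "int N dvd dot d g l - dot d h l"
      using g h by (simp add: cong_0_iff)
    ultimately have "int N dvd (g j - h j) * l j" by simp
    then have "int N dvd g j - h j"
      using assms(1,3) by (simp add: prime_dvd_mult_iff)
    moreover have "g j \<in> {1..int N - 1}" "h j \<in> {1..int N - 1}"
      using g h assms(2) by (auto simp: gen_vecs_def PiE_iff)
    ultimately have "g j = h j" using eq_of_dvd_diff by blast
    then show "g = h"
      using g h off by (intro PiE_ext[of g "{..<d}" "\<lambda>_. {1..int N - 1}" h]) (auto simp: gen_vecs_def)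
  qed
  moreover have "(\<lambda>g. restrict g ({..<d} - {j})) ` ?A \<subseteq> ?B"
    by (intro image_subsetI) (simp add: gen_vecs_def PiE_iff)
  moreover have "finite ?B" by (simp add: finite_PiE)
  ultimately have "card ?A \<le> card ?B" by (rule card_inj_on_le)
  also have "\<dots> = (N - 1) ^ (d - 1)"
    using assms(2) prime_ge_1_nat[OF assms(1)] by (simp add: card_PiE nat_diff_distrib)
  finally show ?thesis .
qed

lemma int_vec_nonzero_entry:
  assumes "l \<in> int_vecs d" "l \<noteq> zero_int_vec d"
  obtains j where "j < d" "l j \<noteq> 0"
proof -
  have "\<exists>j<d. l j \<noteq> 0"
  proof (rule ccontr)
    assume "\<not> (\<exists>j<d. l j \<noteq> 0)"
    then have "l j = zero_int_vec d j" for j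
      using assms(1) by (cases "j < d") (simp_all add: int_vecs_def zero_int_vec_def PiE_iff extensional_def)
    then show False using assms(2) by blast
  qed
  then show thesis using that by blast
qed

text \<open>
  The condition on the figure of merit, stated without the minimum: no nonzero dual vector is
  among the frequencies of weight below \<open>M\<close>.
\<close>

definition separated :: "nat \<Rightarrow> real \<Rightarrow> (nat \<Rightarrow> real) \<Rightarrow> nat \<Rightarrow> real \<Rightarrow> (nat \<Rightarrow> int) \<Rightarrow> bool" where
  "separated d \<alpha> \<gamma> N M g \<longleftrightarrow>
     (\<forall>l\<in>dual_lattice d N g - {zero_int_vec d}. M \<le> korobov_weight d \<alpha> \<gamma> l)"

context korobov
begin

text \<open>
  Every frequency counted satisfies \<open>1 \<le> (M / r(k))\<^sup>l\<close>. With the exponent \<open>l\<close> at which the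
  threshold is attained, \<open>M\<^sup>l\<close> times the sum of \<open>r(k)\<^sup>-\<^sup>l\<close> is at most \<open>c\<close>.
\<close>

lemma card_freq_set_le:
  assumes "1 \<le> d" "0 < c" "1 < threshold d \<alpha> \<gamma> c"
  shows "real (card (freq_set d \<alpha> \<gamma> (threshold d \<alpha> \<gamma> c))) \<le> c"
proof -
  define M where "M = threshold d \<alpha> \<gamma> c"
  obtain l where l: "l \<in> {1 / \<alpha><..2}" and M: "M = (c / zeta_prod d \<alpha> \<gamma> l) powr (1 / l)"
    using threshold_attained(1)[OF assms(1,2)] unfolding M_def by blast
  note b = exponent_bounds[OF l] and z = zeta_prod_ge_1[OF l]
  have M1: "1 < M" using assms(3) by (simp add: M_def)
  have "real (card (freq_set d \<alpha> \<gamma> M)) = (\<Sum>k\<in>freq_set d \<alpha> \<gamma> M. 1)" by simp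
  also have "\<dots> \<le> (\<Sum>k\<in>freq_set d \<alpha> \<gamma> M. M powr l * korobov_weight d \<alpha> \<gamma> k powr (- l))"
  proof (intro sum_mono)
    fix k assume "k \<in> freq_set d \<alpha> \<gamma> M"
    then have "1 \<le> M / korobov_weight d \<alpha> \<gamma> k"
      using korobov_weight_pos[of k] by (simp add: freq_set_def field_simps)
    then have "1 \<le> (M / korobov_weight d \<alpha> \<gamma> k) powr l"
      using b by (simp add: ge_one_powr_ge_zero)
    then show "1 \<le> M powr l * korobov_weight d \<alpha> \<gamma> k powr (- l)"
      using M1 korobov_weight_pos[of k] by (simp add: powr_divide powr_minus_divide)
  qed
  also have "\<dots> = M powr l * (\<Sum>k\<in>freq_set d \<alpha> \<gamma> M. korobov_weight d \<alpha> \<gamma> k powr (- l))"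
    by (simp add: sum_distrib_left)
  also have "\<dots> \<le> M powr l * zeta_prod d \<alpha> \<gamma> l"
    using l finite_freq_set by (intro mult_left_mono sum_korobov_weight_powr_le) (auto simp: freq_set_def)
  also have "\<dots> = c"
    using b z assms(2) by (simp add: M powr_powr)
  finally show ?thesis by (simp add: M_def)
qed

lemma freq_set_entry_less:
  assumes "k \<in> freq_set d \<alpha> \<gamma> M" "M \<le> x powr \<alpha>" "0 < x" "j < d"
  shows "\<bar>real_of_int (k j)\<bar> < x"
proof -
  have "\<bar>real_of_int (k j)\<bar> powr \<alpha> < x powr \<alpha>"
    using abs_powr_le_korobov_weight[OF assms(4), of k] assms(1,2) by (simp add: freq_set_def)
  then show ?thesis
    using assms(3) alpha_pos by (meson abs_ge_zero less_le_not_le linorder_not_le powr_mono2)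
qed

text \<open>
  Union bound over the nonzero frequencies below the threshold. Each of them has a nonzero entry,
  which is not divisible by \<open>N\<close> because it is smaller than \<open>N\<close> in modulus.
\<close>

lemma card_not_separated_le:
  assumes "1 \<le> d" "prime N" "0 < c" "c \<le> real N"
    and M: "M = threshold d \<alpha> \<gamma> c" "1 < M"
  shows "real (card {g \<in> gen_vecs d N. \<not> separated d \<alpha> \<gamma> N M g}) \<le> c * real (N - 1) ^ (d - 1)"
proof -
  let ?F = "freq_set d \<alpha> \<gamma> M - {zero_int_vec d}"
  let ?Z = "\<lambda>l. {g \<in> gen_vecs d N. [dot d g l = 0] (mod int N)}"
  have N: "1 < N" using assms(2) prime_gt_1_nat by blast
  have "{g \<in> gen_vecs d N. \<not> separated d \<alpha> \<gamma> N M g} \<subseteq> (\<Union>l\<in>?F. ?Z l)"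
    by (auto simp: separated_def dual_lattice_def freq_set_def not_le)
  then have "card {g \<in> gen_vecs d N. \<not> separated d \<alpha> \<gamma> N M g} \<le> card (\<Union>l\<in>?F. ?Z l)"
    using finite_freq_set by (intro card_mono) auto
  also have "\<dots> \<le> (\<Sum>l\<in>?F. card (?Z l))"
    using finite_freq_set by (intro card_UN_le) auto
  also have "\<dots> \<le> (\<Sum>l\<in>?F. (N - 1) ^ (d - 1))"
  proof (intro sum_mono)
    fix l assume l: "l \<in> ?F"
    then have "l \<in> int_vecs d" "l \<noteq> zero_int_vec d" by (auto simp: freq_set_def)
    then obtain j where j: "j < d" "l j \<noteq> 0"
      using int_vec_nonzero_entry by blast
    have "M \<le> real N powr \<alpha>"
      using threshold_less[OF assms(1,3,4) N] M by simp
    then have "\<bar>real_of_int (l j)\<bar> < real N"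
      using freq_set_entry_less[of l M "real N" j] l j N by simp
    then have "\<not> int N dvd l j"
      using j(2) dvd_imp_le_int[of "l j" "int N"] by linarith
    then show "card (?Z l) \<le> (N - 1) ^ (d - 1)"
      by (rule card_annihilating_generators_le[OF assms(2) j(1)])
  qed
  also have "\<dots> \<le> card (freq_set d \<alpha> \<gamma> M) * (N - 1) ^ (d - 1)"
    using finite_freq_set by (simp add: card_mono)
  finally have "real (card {g \<in> gen_vecs d N. \<not> separated d \<alpha> \<gamma> N M g})
      \<le> real (card (freq_set d \<alpha> \<gamma> M)) * real (N - 1) ^ (d - 1)"
    by (metis of_nat_le_iff of_nat_mult of_nat_power)
  also have "\<dots> \<le> c * real (N - 1) ^ (d - 1)"
    using card_freq_set_le[OF assms(1,3)] M by (intro mult_right_mono) auto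
  finally show ?thesis .
qed

text \<open>
  The minimum defining the figure of merit is attained: the dual lattice contains
  \<open>(N, \<dots>, N)\<close>, and only finitely many frequencies have at most the weight of this one.
\<close>

lemma merit_ge:
  assumes "1 \<le> d" "0 < N" "separated d \<alpha> \<gamma> N M g"
  shows "M \<le> merit d \<alpha> \<gamma> N g"
proof -
  let ?D = "dual_lattice d N g - {zero_int_vec d}"
  let ?k = "(\<lambda>j\<in>{..<d}. int N)"
  have "?k \<in> ?D"
  proof -
    have "dot d g ?k = (\<Sum>j<d. g j) * int N"
      unfolding dot_def sum_distrib_right by (intro sum.cong) auto
    moreover have "?k \<noteq> zero_int_vec d"
    proof
      assume "?k = zero_int_vec d"
      then have "?k 0 = zero_int_vec d 0" by (rule fun_cong)
      then show False using assms by (simp add: zero_int_vec_def)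
    qed
    ultimately show ?thesis
      by (auto simp: dual_lattice_def cong_0_iff int_vecs_def)
  qed
  define B where "B = ?D \<inter> freq_set d \<alpha> \<gamma> (korobov_weight d \<alpha> \<gamma> ?k + 1)"
  have B: "finite B" "?k \<in> B"
    using finite_freq_set \<open>?k \<in> ?D\<close> by (auto simp: B_def freq_set_def dual_lattice_def)
  obtain l where l: "l \<in> B" "\<And>k. k \<in> B \<Longrightarrow> korobov_weight d \<alpha> \<gamma> l \<le> korobov_weight d \<alpha> \<gamma> k"
    using ex_is_arg_min_if_finite[OF B(1), of "korobov_weight d \<alpha> \<gamma>"] B(2)
    unfolding is_arg_min_linorder by auto
  have "merit d \<alpha> \<gamma> N g = korobov_weight d \<alpha> \<gamma> l"
    unfolding merit_def
  proof (rule Least_equality)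
    show "\<exists>l'\<in>?D. korobov_weight d \<alpha> \<gamma> l = korobov_weight d \<alpha> \<gamma> l'" using l(1) by (auto simp: B_def)
    fix t assume "\<exists>k\<in>?D. t = korobov_weight d \<alpha> \<gamma> k"
    then obtain k where k: "k \<in> ?D" "t = korobov_weight d \<alpha> \<gamma> k" by blast
    show "korobov_weight d \<alpha> \<gamma> l \<le> t"
    proof (cases "k \<in> B")
      case False
      then have "korobov_weight d \<alpha> \<gamma> ?k + 1 \<le> t"
        using k by (auto simp: B_def freq_set_def dual_lattice_def)
      then show ?thesis using l(2)[OF B(2)] by simp
    qed (use l(2) k in auto)
  qed
  then show ?thesis using l(1) assms(3) by (auto simp: B_def separated_def)
qed

lemma korobov_weight_mono:
  assumes "\<And>j. j < d \<Longrightarrow> \<bar>h j\<bar> \<le> \<bar>k j\<bar>"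
  shows "korobov_weight d \<alpha> \<gamma> h \<le> korobov_weight d \<alpha> \<gamma> k"
  unfolding korobov_weight_eq
proof (intro prod_mono conjI)
  fix j assume j: "j \<in> {..<d}"
  have "\<bar>real_of_int (h j)\<bar> \<le> \<bar>real_of_int (k j)\<bar>"
    using assms[of j] j by (metis lessThan_iff of_int_abs of_int_le_iff)
  then show "(if h j = 0 then 1 else \<bar>real_of_int (h j)\<bar> powr \<alpha> / \<gamma> j)
      \<le> (if k j = 0 then 1 else \<bar>real_of_int (k j)\<bar> powr \<alpha> / \<gamma> j)"
    using weight_factor_ge_1[of j "k j"] gamma[of j] j alpha_pos
    by (auto intro!: divide_right_mono powr_mono2)
  show "0 \<le> (if h j = 0 then 1 else \<bar>real_of_int (h j)\<bar> powr \<alpha> / \<gamma> j)"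
    using gamma[of j] j by auto
qed

text \<open>
  Two elements \<open>k\<close>, \<open>k'\<close> of a fiber differ by a dual vector. Suppose that they have the same signs
  and, in every coordinate except \<open>p\<close>, the same dyadic size. Then \<open>\<bar>k\<^sub>j - k'\<^sub>j\<bar> \<le> \<bar>k\<^sub>j\<bar>\<close> for
  all \<open>j \<noteq> p\<close>, and also for \<open>j = p\<close> when \<open>k\<close> is the one with the larger entry there. The
  difference then has weight at most \<open>r(k) < M\<close>, which separation excludes unless \<open>k = k'\<close>. So the
  dyadic sizes away from \<open>p\<close> identify the element. Sparing one coordinate gives the exponent \<open>d - 1\<close>.
\<close>

lemma card_fiber_signs_le:
  assumes sep: "separated d \<alpha> \<gamma> N M g" and m0: "dyadic_level \<alpha> M m\<^sub>0"
    and \<sigma>: "p < d" "\<sigma> p \<noteq> 0"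
  shows "card {k \<in> fiber d \<alpha> \<gamma> N M g l. (\<lambda>j\<in>{..<d}. sgn (k j)) = \<sigma>} \<le> m\<^sub>0 ^ (d - 1)"
proof -
  let ?F = "{k \<in> fiber d \<alpha> \<gamma> N M g l. (\<lambda>j\<in>{..<d}. sgn (k j)) = \<sigma>}"
  let ?level = "\<lambda>t::int. floor_log (nat \<bar>t\<bar>)"
  let ?code = "\<lambda>k. \<lambda>j\<in>{..<d} - {p}. ?level (k j)"
  have F: "k \<in> int_vecs d" "korobov_weight d \<alpha> \<gamma> k < M" "[dot d k g = dot d l g] (mod int N)"
    "\<And>j. j < d \<Longrightarrow> sgn (k j) = \<sigma> j" if "k \<in> ?F" for k
    using that by (auto simp: fiber_def freq_set_def)
  have key: "k = k'" if k: "k \<in> ?F" and k': "k' \<in> ?F" and eq: "?code k = ?code k'" and le: "\<bar>k' p\<bar> \<le> \<bar>k p\<bar>" for k k'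
  proof (rule ccontr)
    assume ne: "k \<noteq> k'"
    define h where "h = (\<lambda>j\<in>{..<d}. k j - k' j)"
    have "dot d g h = dot d k g - dot d k' g"
      by (simp add: dot_def h_def sum_subtractf[symmetric] algebra_simps)
    moreover have "[dot d k g = dot d k' g] (mod int N)"
      using F(3)[OF k] F(3)[OF k'] cong_trans cong_sym by blast
    ultimately have "h \<in> dual_lattice d N g"
      by (auto simp: dual_lattice_def int_vecs_def h_def cong_iff_dvd_diff)
    moreover have "h \<noteq> zero_int_vec d"
    proof
      assume "h = zero_int_vec d"
      then have "h j = 0" if "j < d" for j
        using that by (simp add: zero_int_vec_def)
      then have "k j = k' j" if "j < d" for j
        using that by (simp add: h_def)
      then show False
        using F(1)[OF k] F(1)[OF k'] ne PiE_ext[of k "{..<d}" "\<lambda>_. UNIV" k'] by (auto simp: int_vecs_def)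
    qed
    ultimately have "M \<le> korobov_weight d \<alpha> \<gamma> h"
      using sep by (auto simp: separated_def)
    also have "\<dots> \<le> korobov_weight d \<alpha> \<gamma> k"
    proof (rule korobov_weight_mono)
      fix j assume j: "j < d"
      have sgn: "sgn (k j) = sgn (k' j)" using F(4)[OF k j] F(4)[OF k' j] by simp
      have "\<bar>k j - k' j\<bar> \<le> \<bar>k j\<bar>"
      proof (cases "j = p \<or> k j = 0")
        case True
        then show ?thesis using le sgn by (auto simp: sgn_if split: if_splits)
      next
        case False
        then have nz: "k j \<noteq> 0" "k' j \<noteq> 0" and "j \<noteq> p" using sgn by (auto simp: sgn_if split: if_splits)
        have "?level (k j) = ?level (k' j)"
          using fun_cong[OF eq, of j] j \<open>j \<noteq> p\<close> by simp
        moreover have "2 ^ ?level (k j) \<le> nat \<bar>k j\<bar>"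
          using nz by (intro floor_log_exp2_le) simp
        moreover have "nat \<bar>k' j\<bar> < 2 * 2 ^ ?level (k' j)"
          by (rule floor_log_exp2_gt)
        ultimately have "nat \<bar>k' j\<bar> < 2 * nat \<bar>k j\<bar>"
          by (metis le_less_trans less_le_trans mult_le_mono2)
        then show ?thesis using sgn by (auto simp: sgn_if split: if_splits)
      qed
      then show "\<bar>h j\<bar> \<le> \<bar>k j\<bar>" using j by (simp add: h_def)
    qed
    finally show False using F(2)[OF k] by simp
  qed
  have "inj_on ?code ?F"
  proof (rule inj_onI)
    fix k k' assume "k \<in> ?F" "k' \<in> ?F" "?code k = ?code k'"
    then show "k = k'" using key[of k k'] key[of k' k] by (cases "\<bar>k' p\<bar> \<le> \<bar>k p\<bar>") auto
  qed
  moreover have "?code ` ?F \<subseteq> ({..<d} - {p}) \<rightarrow>\<^sub>E {..<m\<^sub>0}"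
  proof (rule image_subsetI)
    fix k assume "k \<in> ?F"
    then have k: "k \<in> freq_set d \<alpha> \<gamma> M" by (simp add: fiber_def)
    have "floor_log (nat \<bar>k j\<bar>) < m\<^sub>0" if "j < d" for j
    proof -
    have "1 < M"
      using k korobov_weight_ge_1[of k] by (simp add: freq_set_def)
    have "M = (M powr (1 / \<alpha>)) powr \<alpha>" using \<open>1 < M\<close> alpha_pos by (simp add: powr_powr)
    also have "\<dots> \<le> (2 ^ m\<^sub>0) powr \<alpha>" using m0 alpha_pos by (intro powr_mono2) (auto simp: dyadic_level_def)
    finally have "\<bar>real_of_int (k j)\<bar> < 2 ^ m\<^sub>0"
      using freq_set_entry_less[OF k, of "2 ^ m\<^sub>0" j] \<open>j < d\<close> by simp
    then have "\<bar>k j\<bar> < 2 ^ m\<^sub>0" by (metis of_int_abs of_int_less_iff of_int_numeral of_int_power)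
    then have lt: "nat \<bar>k j\<bar> < 2 ^ m\<^sub>0" by (simp add: nat_less_iff)
    show ?thesis
    proof (cases "k j = 0")
      case True
      then show ?thesis using m0 by (simp add: dyadic_level_def)
    next
      case False
      then have "2 ^ floor_log (nat \<bar>k j\<bar>) \<le> nat \<bar>k j\<bar>"
        by (intro floor_log_exp2_le) simp
      then have "(2::nat) ^ floor_log (nat \<bar>k j\<bar>) < 2 ^ m\<^sub>0"
        using lt by (rule le_less_trans)
      then show ?thesis by simp
    qed
    qed
    then show "?code k \<in> ({..<d} - {p}) \<rightarrow>\<^sub>E {..<m\<^sub>0}" by simp
  qed
  moreover have "finite (({..<d} - {p}) \<rightarrow>\<^sub>E {..<m\<^sub>0})" by (simp add: finite_PiE)
  ultimately have "card ?F \<le> card (({..<d} - {p}) \<rightarrow>\<^sub>E {..<m\<^sub>0})" by (rule card_inj_on_le)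
  also have "\<dots> = m\<^sub>0 ^ (d - 1)" using \<sigma>(1) by (simp add: card_PiE)
  finally show ?thesis .
qed

lemma finite_fiber: "finite (fiber d \<alpha> \<gamma> N M g l)"
  using finite_freq_set by (rule finite_subset[rotated]) (auto simp: fiber_def)

text \<open>
  There are \<open>3\<^sup>d\<close> sign patterns, and the zero pattern belongs to the zero frequency only.
\<close>

lemma card_fiber_le_R_star:
  assumes "separated d \<alpha> \<gamma> N M g" "dyadic_level \<alpha> M m\<^sub>0"
  shows "card (fiber d \<alpha> \<gamma> N M g l) \<le> R_star d m\<^sub>0"
proof -
  let ?\<Sigma> = "{..<d} \<rightarrow>\<^sub>E {-1, 0, 1::int}"
  let ?F = "\<lambda>\<sigma>. {k \<in> fiber d \<alpha> \<gamma> N M g l. (\<lambda>j\<in>{..<d}. sgn (k j)) = \<sigma>}"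
  have fin: "finite ?\<Sigma>" by (simp add: finite_PiE)
  have z: "zero_int_vec d \<in> ?\<Sigma>" by (auto simp: zero_int_vec_def)
  have "fiber d \<alpha> \<gamma> N M g l \<subseteq> (\<Union>\<sigma>\<in>?\<Sigma>. ?F \<sigma>)"
    by (auto simp: sgn_if)
  then have "card (fiber d \<alpha> \<gamma> N M g l) \<le> card (\<Union>\<sigma>\<in>?\<Sigma>. ?F \<sigma>)"
    using fin finite_fiber by (intro card_mono) auto
  also have "\<dots> \<le> (\<Sum>\<sigma>\<in>?\<Sigma>. card (?F \<sigma>))"
    using fin by (rule card_UN_le)
  also have "\<dots> = card (?F (zero_int_vec d)) + (\<Sum>\<sigma>\<in>?\<Sigma> - {zero_int_vec d}. card (?F \<sigma>))"
    using fin z by (rule sum.remove)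
  also have "\<dots> \<le> 1 + (\<Sum>\<sigma>\<in>?\<Sigma> - {zero_int_vec d}. m\<^sub>0 ^ (d - 1))"
  proof (intro add_mono sum_mono)
    have "k = zero_int_vec d" if "k \<in> ?F (zero_int_vec d)" for k
    proof (rule ccontr)
      assume "k \<noteq> zero_int_vec d"
      moreover have "k \<in> int_vecs d" using that by (simp add: fiber_def freq_set_def)
      ultimately obtain j where "j < d" "k j \<noteq> 0"
        using int_vec_nonzero_entry by blast
      moreover have "(\<lambda>j\<in>{..<d}. sgn (k j)) j = zero_int_vec d j" using that by simp
      ultimately show False by (simp add: zero_int_vec_def sgn_if split: if_splits)
    qed
    then have "?F (zero_int_vec d) \<subseteq> {zero_int_vec d}" by blast
    then show "card (?F (zero_int_vec d)) \<le> 1"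
      using card_mono[of "{zero_int_vec d}"] by fastforce
    fix \<sigma> assume \<sigma>: "\<sigma> \<in> ?\<Sigma> - {zero_int_vec d}"
    then have "\<sigma> \<in> int_vecs d" "\<sigma> \<noteq> zero_int_vec d" by (simp_all add: int_vecs_def PiE_iff)
    then obtain p where "p < d" "\<sigma> p \<noteq> 0"
      using int_vec_nonzero_entry by blast
    then show "card (?F \<sigma>) \<le> m\<^sub>0 ^ (d - 1)"
      by (rule card_fiber_signs_le[OF assms])
  qed
  also have "\<dots> = 1 + (3 ^ d - 1) * m\<^sub>0 ^ (d - 1)"
    using fin z by (simp add: card_PiE card_Diff_singleton eval_nat_numeral)
  also have "\<dots> \<le> R_star d m\<^sub>0"
    unfolding R_star_def by (intro add_mono mult_mono power_mono) auto
  finally show ?thesis .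
qed

lemma card_fiber_le_max_fiber:
  assumes "l \<in> int_vecs d"
  shows "card (fiber d \<alpha> \<gamma> N M g l) \<le> max_fiber d \<alpha> \<gamma> N M g"
proof -
  have "(\<lambda>l. card (fiber d \<alpha> \<gamma> N M g l)) ` int_vecs d \<subseteq> {..card (freq_set d \<alpha> \<gamma> M)}"
    using finite_freq_set by (auto simp: fiber_def intro!: card_mono)
  then show ?thesis
    unfolding max_fiber_def using assms by (intro Max_ge) (auto intro: finite_subset)
qed

lemma max_fiber_le:
  assumes "\<And>l. card (fiber d \<alpha> \<gamma> N M g l) \<le> b"
  shows "max_fiber d \<alpha> \<gamma> N M g \<le> b"
proof -
  have "zero_int_vec d \<in> int_vecs d" by (auto simp: zero_int_vec_def int_vecs_def)
  moreover have "(\<lambda>l. card (fiber d \<alpha> \<gamma> N M g l)) ` int_vecs d \<subseteq> {..b}"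
    using assms by auto
  ultimately show ?thesis
    unfolding max_fiber_def using assms by (intro Max.boundedI) (auto intro: finite_subset)
qed

lemma max_fiber_pos:
  assumes "1 < M"
  shows "1 \<le> max_fiber d \<alpha> \<gamma> N M g"
proof -
  let ?z = "zero_int_vec d"
  have z: "?z \<in> int_vecs d" by (auto simp: zero_int_vec_def int_vecs_def)
  have "korobov_weight d \<alpha> \<gamma> ?z = 1"
    by (simp add: korobov_weight_eq zero_int_vec_def)
  then have "?z \<in> fiber d \<alpha> \<gamma> N M g ?z"
    using assms z by (simp add: fiber_def freq_set_def)
  then have "1 \<le> card (fiber d \<alpha> \<gamma> N M g ?z)"
    using finite_fiber by (metis One_nat_def Suc_leI card_gt_0_iff empty_iff)
  then show ?thesis using card_fiber_le_max_fiber[OF z, of N M g] by linarith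
qed

lemma good_generator_if_separated:
  assumes "1 \<le> d" "0 < N" "separated d \<alpha> \<gamma> N M g" "dyadic_level \<alpha> M m\<^sub>0"
  shows "good_generator d \<alpha> \<gamma> N M m\<^sub>0 g"
  unfolding good_generator_def
  using merit_ge[OF assms(1-3)] max_fiber_le card_fiber_le_R_star[OF assms(3,4)] by blast

lemma prob_good_generator_ge:
  assumes "1 \<le> d" "0 < \<delta>" "\<delta> < 1" "random_setting d \<alpha> \<gamma> \<delta> N M m\<^sub>0"
  shows "\<delta> \<le> \<P>(g in uniform_count_measure (gen_vecs d N). good_generator d \<alpha> \<gamma> N M m\<^sub>0 g)"
proof -
  let ?G = "gen_vecs d N" and ?good = "{g \<in> gen_vecs d N. good_generator d \<alpha> \<gamma> N M m\<^sub>0 g}"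
  let ?bad = "{g \<in> gen_vecs d N. \<not> separated d \<alpha> \<gamma> N M g}"
  have N: "prime N" "2 < N" and M: "M = threshold d \<alpha> \<gamma> ((real N - 1) * (1 - \<delta>))" "1 < M"
    and m0: "dyadic_level \<alpha> M m\<^sub>0"
    using assms(4) by (auto simp: random_setting_def random_threshold_def)
  have le: "(real N - 1) * (1 - \<delta>) \<le> real N * 1"
    using N assms(2,3) by (intro mult_mono) auto
  have bad: "real (card ?bad) \<le> (real N - 1) * (1 - \<delta>) * real (N - 1) ^ (d - 1)"
    using N assms(2,3) le M by (intro card_not_separated_le[OF assms(1)]) auto
  have pow: "(real N - 1) * real (N - 1) ^ (d - 1) = real (N - 1) ^ d"
    using N assms(1) by (cases d) (simp_all add: of_nat_diff)
  have "(real N - 1) * (1 - \<delta>) * real (N - 1) ^ (d - 1)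
      = (1 - \<delta>) * ((real N - 1) * real (N - 1) ^ (d - 1))"
    by (simp only: mult_ac)
  also have "\<dots> = (1 - \<delta>) * real (N - 1) ^ d" by (simp only: pow)
  finally have eq: "(real N - 1) * (1 - \<delta>) * real (N - 1) ^ (d - 1) = (1 - \<delta>) * real (N - 1) ^ d" .
  have cG: "real (card ?G) = real (N - 1) ^ d" using N by (simp add: card_gen_vecs)
  have bad': "real (card ?bad) \<le> (1 - \<delta>) * real (card ?G)"
    using bad by (simp only: eq cG)
  have pos: "0 < card ?G" using N by (simp add: card_gen_vecs)
  have "?G - ?bad \<subseteq> ?good"
    using good_generator_if_separated[OF assms(1) _ _ m0] N by auto
  then have "card (?G - ?bad) \<le> card ?good" by (intro card_mono) auto
  then have "real (card ?G) - real (card ?bad) \<le> real (card ?good)"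
    by (subst (asm) card_Diff_subset) auto
  then have "\<delta> * real (card ?G) \<le> real (card ?good)"
    using bad' by (simp add: algebra_simps)
  then show ?thesis
    using pos by (simp add: space_uniform_count_measure measure_uniform_count_measure field_simps)
qed

end

section \<open>Stability of least squares\<close>

definition l2norm :: "nat \<Rightarrow> (nat \<Rightarrow> complex) \<Rightarrow> real" where
  "l2norm n u = L2_set (\<lambda>i. cmod (u i)) {..<n}"

lemma l2norm_nonneg [simp]: "0 \<le> l2norm n u"
  by (simp add: l2norm_def)

lemma l2norm_cong: "(\<And>i. i < n \<Longrightarrow> u i = v i) \<Longrightarrow> l2norm n u = l2norm n v"
  unfolding l2norm_def by (rule L2_set_cong) auto

lemma l2norm_eq_0_iff: "l2norm n u = 0 \<longleftrightarrow> (\<forall>i<n. u i = 0)"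
  by (auto simp: l2norm_def L2_set_eq_0_iff)

lemma l2norm_scale: "l2norm n (\<lambda>i. c * u i) = cmod c * l2norm n u"
  by (simp add: l2norm_def norm_mult L2_set_right_distrib)

lemma cmod_le_l2norm: "i < n \<Longrightarrow> cmod (u i) \<le> l2norm n u"
  unfolding l2norm_def using member_le_L2_set[of "{..<n}" i "\<lambda>i. cmod (u i)"] by simp

lemma l2norm_le_sum: "l2norm n u \<le> (\<Sum>i<n. cmod (u i))"
  unfolding l2norm_def by (rule L2_set_le_sum) simp

lemma l2norm_power2: "complex_of_real ((l2norm n u)\<^sup>2) = (\<Sum>i<n. cnj (u i) * u i)"
  by (simp add: l2norm_def L2_set_def sum_nonneg complex_norm_square mult.commute del: of_real_power)

lemma cmod_inner_le: "cmod (\<Sum>i<n. cnj (u i) * v i) \<le> l2norm n u * l2norm n v"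
proof -
  have "cmod (\<Sum>i<n. cnj (u i) * v i) \<le> (\<Sum>i<n. cmod (cnj (u i) * v i))"
    by (rule norm_sum)
  also have "\<dots> = (\<Sum>i<n. \<bar>cmod (u i)\<bar> * \<bar>cmod (v i)\<bar>)"
    by (simp add: norm_mult)
  also have "\<dots> \<le> l2norm n u * l2norm n v"
    unfolding l2norm_def by (rule L2_set_mult_ineq)
  finally show ?thesis .
qed

lemma sum_cmod_le_l2norm: "(\<Sum>i<n. cmod (u i)) \<le> sqrt (real n) * l2norm n u"
  using L2_set_mult_ineq[of "\<lambda>_. 1" "\<lambda>i. cmod (u i)" "{..<n}"]
  by (simp add: l2norm_def L2_set_constant)

lemma l2norm_le_sqrt_card:
  assumes "\<And>i. i < n \<Longrightarrow> cmod (u i) \<le> T" "0 \<le> T"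
  shows "l2norm n u \<le> sqrt (real n) * T"
proof -
  have "l2norm n u \<le> L2_set (\<lambda>_. T) {..<n}"
    unfolding l2norm_def using assms by (intro L2_set_mono) auto
  then show ?thesis using assms(2) by (simp add: L2_set_constant)
qed

lemma gram_mult_vec:
  fixes B :: "nat \<Rightarrow> nat \<Rightarrow> complex"
  shows "(\<Sum>j<n. (\<Sum>r<m. cnj (B r i) * B r j) * u j) = (\<Sum>r<m. cnj (B r i) * (\<Sum>j<n. B r j * u j))"
proof -
  have "(\<Sum>j<n. (\<Sum>r<m. cnj (B r i) * B r j) * u j) = (\<Sum>j<n. \<Sum>r<m. cnj (B r i) * B r j * u j)"
    by (simp only: sum_distrib_right)
  also have "\<dots> = (\<Sum>r<m. \<Sum>j<n. cnj (B r i) * B r j * u j)"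
    by (rule sum.swap)
  also have "\<dots> = (\<Sum>r<m. cnj (B r i) * (\<Sum>j<n. B r j * u j))"
    by (simp only: sum_distrib_left mult.assoc)
  finally show ?thesis .
qed

text \<open>
  With \<open>G = B\<^sup>H B\<close>, \<open>G z = w\<close> and \<open>G w = B\<^sup>H E\<close>, the lower bound gives \<open>S \<parallel>z\<parallel> \<le> \<parallel>w\<parallel>\<close>, hence
  \<open>\<parallel>B z\<parallel>\<^sup>2 = \<langle>z, w\<rangle> \<le> \<parallel>w\<parallel>\<^sup>2 / S\<close>, and
  \<open>\<parallel>w\<parallel>\<^sup>2 = \<langle>G z, w\<rangle> = \<langle>z, G w\<rangle> = \<langle>B z, E\<rangle> \<le> \<parallel>w\<parallel> \<parallel>E\<parallel> / \<surd>S\<close>.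
\<close>

lemma least_squares_stability:
  fixes B :: "nat \<Rightarrow> nat \<Rightarrow> complex" and n m :: nat
  defines "G \<equiv> \<lambda>i j. \<Sum>r<m. cnj (B r i) * B r j"
  assumes "0 < S"
    and lower: "\<And>v. S * l2norm n v \<le> l2norm n (\<lambda>i. \<Sum>j<n. G i j * v j)"
    and normal: "\<And>i. i < n \<Longrightarrow> (\<Sum>j<n. G i j * w j) = (\<Sum>r<m. cnj (B r i) * E r)"
    and solvable: "\<And>i. i < n \<Longrightarrow> (\<Sum>j<n. G i j * z j) = w i"
  shows "sqrt S * l2norm n w \<le> l2norm m E"
proof (cases "l2norm n w = 0")
  case False
  then have pos: "0 < l2norm n w" using l2norm_nonneg[of n w] by linarith
  define Bz where "Bz r = (\<Sum>i<n. B r i * z i)" for r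
  have adj: "(\<Sum>i<n. cnj (z i) * (\<Sum>r<m. cnj (B r i) * F r)) = (\<Sum>r<m. cnj (Bz r) * F r)" for F
  proof -
    have "(\<Sum>i<n. cnj (z i) * (\<Sum>r<m. cnj (B r i) * F r))
        = (\<Sum>i<n. \<Sum>r<m. cnj (z i) * (cnj (B r i) * F r))"
      by (simp only: sum_distrib_left)
    also have "\<dots> = (\<Sum>r<m. \<Sum>i<n. cnj (z i) * (cnj (B r i) * F r))"
      by (rule sum.swap)
    also have "\<dots> = (\<Sum>r<m. cnj (Bz r) * F r)"
      unfolding Bz_def cnj_sum sum_distrib_right by (intro sum.cong refl) simp
    finally show ?thesis .
  qed
  have gram: "(\<Sum>j<n. G i j * u j) = (\<Sum>r<m. cnj (B r i) * (\<Sum>j<n. B r j * u j))" for i u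
    unfolding G_def by (rule gram_mult_vec)
  have z: "S * l2norm n z \<le> l2norm n w"
    using lower[of z] l2norm_cong[of n "\<lambda>i. \<Sum>j<n. G i j * z j" w] solvable by simp
  have "complex_of_real ((l2norm m Bz)\<^sup>2) = (\<Sum>r<m. cnj (Bz r) * Bz r)"
    by (rule l2norm_power2)
  also have "\<dots> = (\<Sum>i<n. cnj (z i) * (\<Sum>r<m. cnj (B r i) * Bz r))"
    by (rule adj[symmetric])
  also have "\<dots> = (\<Sum>i<n. cnj (z i) * w i)"
    using solvable gram[of _ z] by (intro sum.cong refl) (simp add: Bz_def)
  finally have "cmod (complex_of_real ((l2norm m Bz)\<^sup>2)) \<le> l2norm n z * l2norm n w"
    using cmod_inner_le[of z w n] by simp
  then have "S * (l2norm m Bz)\<^sup>2 \<le> S * (l2norm n z * l2norm n w)"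
    using \<open>0 < S\<close> by (simp add: norm_power)
  also have "\<dots> \<le> (l2norm n w)\<^sup>2"
    using mult_right_mono[OF z, of "l2norm n w"] by (simp add: mult_ac power2_eq_square)
  finally have "(sqrt S * l2norm m Bz)\<^sup>2 \<le> (l2norm n w)\<^sup>2"
    using \<open>0 < S\<close> by (simp add: power_mult_distrib)
  then have Bz: "sqrt S * l2norm m Bz \<le> l2norm n w"
    by (rule power2_le_imp_le) simp
  have "complex_of_real ((l2norm n w)\<^sup>2) = (\<Sum>i<n. cnj (\<Sum>j<n. G i j * z j) * w i)"
    unfolding l2norm_power2 using solvable by simp
  also have "\<dots> = (\<Sum>i<n. \<Sum>j<n. cnj (z j) * (G j i * w i))"
    unfolding cnj_sum sum_distrib_right by (intro sum.cong refl) (simp add: G_def mult_ac)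
  also have "\<dots> = (\<Sum>j<n. cnj (z j) * (\<Sum>i<n. G j i * w i))"
    by (subst sum.swap) (simp only: sum_distrib_left)
  also have "\<dots> = (\<Sum>j<n. cnj (z j) * (\<Sum>r<m. cnj (B r j) * E r))"
    using normal by simp
  also have "\<dots> = (\<Sum>r<m. cnj (Bz r) * E r)"
    by (rule adj)
  finally have "cmod (complex_of_real ((l2norm n w)\<^sup>2)) \<le> l2norm m Bz * l2norm m E"
    using cmod_inner_le[of Bz E m] by simp
  then have "sqrt S * (l2norm n w)\<^sup>2 \<le> sqrt S * (l2norm m Bz * l2norm m E)"
    using \<open>0 < S\<close> by (simp add: norm_power)
  also have "\<dots> \<le> l2norm n w * l2norm m E"
    using mult_right_mono[OF Bz, of "l2norm m E"] by (simp add: mult_ac)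
  finally have "l2norm n w * (sqrt S * l2norm n w) \<le> l2norm n w * l2norm m E"
    by (simp add: power2_eq_square mult_ac)
  then show ?thesis using pos by (simp only: mult_le_cancel_left_pos)
qed simp

lemma vec_index_mult_mat_vec:
  assumes "i < dim_row A" "dim_vec v = dim_col A"
  shows "vec_index (A *\<^sub>v v) i = (\<Sum>j<dim_col A. A $$ (i, j) * vec_index v j)"
  using assms by (simp add: scalar_prod_def atLeast0LessThan)

lemma spectral_norm_bound:
  assumes X: "X \<in> carrier_mat m n" and v: "v \<in> carrier_vec n"
  shows "l2norm m (vec_index (X *\<^sub>v v)) \<le> spectral_norm X * l2norm n (vec_index v)"
proof (cases "l2norm n (vec_index v) = 0")
  case True
  then have "\<forall>i<n. vec_index v i = 0" by (simp add: l2norm_eq_0_iff)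
  then have "\<forall>i<m. vec_index (X *\<^sub>v v) i = 0"
    using X v by (auto simp: vec_index_mult_mat_vec simp del: index_mult_mat_vec)
  then have "l2norm m (vec_index (X *\<^sub>v v)) = 0"
    by (simp add: l2norm_eq_0_iff)
  then show ?thesis using True by simp
next
  case False
  let ?V = "{v \<in> carrier_vec (dim_col X). L2_set (\<lambda>i. cmod (vec_index v i)) {..<dim_col X} \<le> 1}"
  let ?f = "\<lambda>v. L2_set (\<lambda>i. cmod (vec_index (X *\<^sub>v v) i)) {..<dim_row X}"
  define a where "a = l2norm n (vec_index v)"
  have a: "0 < a" using False l2norm_nonneg[of n "vec_index v"] unfolding a_def by linarith
  have bdd: "bdd_above (?f ` ?V)"
  proof (rule bdd_aboveI2)
    fix u assume u: "u \<in> ?V"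
    have "?f u \<le> (\<Sum>i<m. cmod (vec_index (X *\<^sub>v u) i))"
      using X l2norm_le_sum[of m "vec_index (X *\<^sub>v u)"] by (simp add: l2norm_def)
    also have "\<dots> \<le> (\<Sum>i<m. \<Sum>j<n. cmod (X $$ (i, j)) * 1)"
    proof (intro sum_mono)
      fix i assume i: "i \<in> {..<m}"
      have "cmod (vec_index (X *\<^sub>v u) i) = cmod (\<Sum>j<n. X $$ (i, j) * vec_index u j)"
        using i X u by (subst vec_index_mult_mat_vec) auto
      also have "\<dots> \<le> (\<Sum>j<n. cmod (X $$ (i, j) * vec_index u j))" by (rule norm_sum)
      also have "\<dots> \<le> (\<Sum>j<n. cmod (X $$ (i, j)) * 1)"
      proof (intro sum_mono)
        fix j assume "j \<in> {..<n}"
        then have "cmod (vec_index u j) \<le> 1"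
          using cmod_le_l2norm[of j n "vec_index u"] u X by (simp add: l2norm_def)
        then show "cmod (X $$ (i, j) * vec_index u j) \<le> cmod (X $$ (i, j)) * 1"
          unfolding norm_mult by (intro mult_left_mono) auto
      qed
      finally show "cmod (vec_index (X *\<^sub>v u) i) \<le> (\<Sum>j<n. cmod (X $$ (i, j)) * 1)" .
    qed
    finally show "?f u \<le> (\<Sum>i<m. \<Sum>j<n. cmod (X $$ (i, j)) * 1)" .
  qed
  define u where "u = complex_of_real (1 / a) \<cdot>\<^sub>v v"
  have u: "u \<in> carrier_vec n" using v by (simp add: u_def)
  have "l2norm n (vec_index u) = l2norm n (\<lambda>i. complex_of_real (1 / a) * vec_index v i)"
    using v by (intro l2norm_cong) (simp add: u_def)
  also have "\<dots> = 1" unfolding l2norm_scale using a by (simp add: a_def[symmetric] norm_divide)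
  finally have "u \<in> ?V" using u X by (simp add: l2norm_def)
  then have le: "?f u \<le> spectral_norm X"
    unfolding spectral_norm_def by (rule cSUP_upper[OF _ bdd])
  have "X *\<^sub>v u = complex_of_real (1 / a) \<cdot>\<^sub>v (X *\<^sub>v v)"
    unfolding u_def by (rule mult_mat_vec[OF X v])
  then have "l2norm m (vec_index (X *\<^sub>v u)) = l2norm m (\<lambda>i. complex_of_real (1 / a) * vec_index (X *\<^sub>v v) i)"
    using X by (intro l2norm_cong) simp
  also have "\<dots> = l2norm m (vec_index (X *\<^sub>v v)) / a"
    unfolding l2norm_scale using a by (simp add: norm_divide)
  finally have "l2norm m (vec_index (X *\<^sub>v v)) / a \<le> spectral_norm X"
    using le X by (simp add: l2norm_def)
  then show ?thesis using a by (simp add: a_def field_simps)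
qed

text \<open>
  Invertibility together with the bound on the inverse becomes an inequality for each vector
  separately. In this form it follows from diagonal dominance, and it is visibly a measurable
  condition on the matrix.
\<close>

lemma inverse_norm_le_iff:
  assumes A: "A \<in> carrier_mat n n" and S: "0 < S"
  shows "(\<exists>X. mat_inverse A = Some X \<and> spectral_norm X \<le> 1 / S)
    \<longleftrightarrow> (\<forall>v. S * l2norm n v \<le> l2norm n (\<lambda>i. \<Sum>j<n. A $$ (i, j) * v j))"
    (is "?L \<longleftrightarrow> ?R")
proof
  assume ?L
  then obtain X where inv: "mat_inverse A = Some X" and norm: "spectral_norm X \<le> 1 / S" by blast
  have X: "X * A = 1\<^sub>m n" "X \<in> carrier_mat n n" using mat_inverse(2)[OF A inv] by auto
  show ?R
  proof
    fix v :: "nat \<Rightarrow> complex"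
    let ?v = "Matrix.vec n v"
    have "X *\<^sub>v (A *\<^sub>v ?v) = (X * A) *\<^sub>v ?v"
      using A X(2) by (simp add: assoc_mult_mat_vec[of X n n A n])
    also have "\<dots> = ?v" using X(1) by simp
    finally have "l2norm n (vec_index ?v) = l2norm n (vec_index (X *\<^sub>v (A *\<^sub>v ?v)))" by simp
    also have "\<dots> \<le> spectral_norm X * l2norm n (vec_index (A *\<^sub>v ?v))"
      using A X by (intro spectral_norm_bound) auto
    also have "\<dots> \<le> 1 / S * l2norm n (vec_index (A *\<^sub>v ?v))"
      using norm by (intro mult_right_mono) auto
    finally have "S * l2norm n (vec_index ?v) \<le> l2norm n (vec_index (A *\<^sub>v ?v))"
      using S by (simp add: field_simps)
    moreover have "l2norm n (vec_index ?v) = l2norm n v" by (intro l2norm_cong) simp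
    moreover have "l2norm n (vec_index (A *\<^sub>v ?v)) = l2norm n (\<lambda>i. \<Sum>j<n. A $$ (i, j) * v j)"
      using A by (intro l2norm_cong) (subst vec_index_mult_mat_vec; simp)
    ultimately show "S * l2norm n v \<le> l2norm n (\<lambda>i. \<Sum>j<n. A $$ (i, j) * v j)" by simp
  qed
next
  assume R: ?R
  have lower: "S * l2norm n (vec_index v) \<le> l2norm n (vec_index (A *\<^sub>v v))" if v: "v \<in> carrier_vec n" for v
  proof -
    have "l2norm n (vec_index (A *\<^sub>v v)) = l2norm n (\<lambda>i. \<Sum>j<n. A $$ (i, j) * vec_index v j)"
      using A v by (intro l2norm_cong) (subst vec_index_mult_mat_vec; simp)
    then show ?thesis using R by simp
  qed
  have "Determinant.det A \<noteq> 0"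
  proof
    assume "Determinant.det A = 0"
    then obtain v where v: "v \<in> carrier_vec n" "v \<noteq> 0\<^sub>v n" "A *\<^sub>v v = 0\<^sub>v n"
      using det_0_iff_vec_prod_zero[OF A] by blast
    have "l2norm n (vec_index (A *\<^sub>v v)) = 0" using v(3) by (simp add: l2norm_eq_0_iff)
    then have "S * l2norm n (vec_index v) \<le> 0" using lower[OF v(1)] by simp
    then have "l2norm n (vec_index v) = 0"
      using S l2norm_nonneg[of n "vec_index v"] by (simp add: mult_le_0_iff)
    then have "v = 0\<^sub>v n" using v(1) by (intro eq_vecI) (auto simp: l2norm_eq_0_iff)
    then show False using v(2) by simp
  qed
  then have "A \<in> Units (ring_mat TYPE(complex) n ())" by (rule det_non_zero_imp_unit[OF A])
  then obtain X where inv: "mat_inverse A = Some X"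
    using mat_inverse(1)[OF A, where b = "()"] by (cases "mat_inverse A") auto
  have X: "A * X = 1\<^sub>m n" "X \<in> carrier_mat n n" using mat_inverse(2)[OF A inv] by auto
  have "spectral_norm X \<le> 1 / S"
    unfolding spectral_norm_def
  proof (rule cSUP_least)
    have "0\<^sub>v (dim_col X) \<in> {v \<in> carrier_vec (dim_col X). L2_set (\<lambda>i. cmod (vec_index v i)) {..<dim_col X} \<le> 1}"
      by (simp add: L2_set_def)
    then show "{v \<in> carrier_vec (dim_col X). L2_set (\<lambda>i. cmod (vec_index v i)) {..<dim_col X} \<le> 1} \<noteq> {}" by blast
    fix v assume v: "v \<in> {v \<in> carrier_vec (dim_col X). L2_set (\<lambda>i. cmod (vec_index v i)) {..<dim_col X} \<le> 1}"
    then have vc: "v \<in> carrier_vec n" and v1: "l2norm n (vec_index v) \<le> 1" using X by (auto simp: l2norm_def)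
    have "A *\<^sub>v (X *\<^sub>v v) = v"
      using A X vc by (simp add: assoc_mult_mat_vec[symmetric, of A n n X n])
    then have "S * l2norm n (vec_index (X *\<^sub>v v)) \<le> 1"
      using lower[of "X *\<^sub>v v"] X vc v1 by simp
    then show "L2_set (\<lambda>i. cmod (vec_index (X *\<^sub>v v) i)) {..<dim_row X} \<le> 1 / S"
      using S X by (simp add: l2norm_def field_simps)
  qed
  then show ?L using inv by blast
qed

lemma shift_matrix_carrier [simp]:
  "shift_matrix d S y ls \<in> carrier_mat (length ls * S) (length ls)"
  by (simp add: shift_matrix_def)

lemma mat_adjoint_carrier [simp]: "A \<in> carrier_mat m n \<Longrightarrow> mat_adjoint A \<in> carrier_mat n m"
  by (auto simp: mat_adjoint_def intro!: carrier_matI)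

lemma mat_adjoint_index:
  "A \<in> carrier_mat m n \<Longrightarrow> i < n \<Longrightarrow> j < m \<Longrightarrow> mat_adjoint A $$ (i, j) = cnj (A $$ (j, i))"
  by (auto simp: mat_adjoint_def mat_of_rows_def)

lemma gram_matrix_carrier [simp]: "gram_matrix d S y ls \<in> carrier_mat (length ls) (length ls)"
  unfolding gram_matrix_def using shift_matrix_carrier mat_adjoint_carrier mult_carrier_mat by blast

lemma gram_matrix_index:
  assumes "i < length ls" "j < length ls"
  shows "gram_matrix d S y ls $$ (i, j)
    = (\<Sum>r<length ls * S. cnj (shift_matrix d S y ls $$ (r, i)) * shift_matrix d S y ls $$ (r, j))"
proof -
  let ?B = "shift_matrix d S y ls"
  have B: "?B \<in> carrier_mat (length ls * S) (length ls)" by simp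
  have "gram_matrix d S y ls $$ (i, j) = (\<Sum>r<length ls * S. mat_adjoint ?B $$ (i, r) * ?B $$ (r, j))"
    using assms carrier_matD[OF B] carrier_matD[OF mat_adjoint_carrier[OF B]]
    by (simp add: gram_matrix_def scalar_prod_def atLeast0LessThan)
  then show ?thesis using assms mat_adjoint_index[OF B] by simp
qed

text \<open>
  Here \<open>a\<close> stands for the true coefficients and \<open>E\<close> for the perturbation of the data. The factor
  \<open>1/\<surd>S\<close> of the least squares map cancels against the number \<open>n S\<close> of data; passing to the sum
  norm costs another \<open>\<surd>n\<close>.
\<close>

lemma fiber_coeffs_error:
  fixes a E :: "nat \<Rightarrow> complex" and ls :: "(nat \<Rightarrow> int) list"
  defines "n \<equiv> length ls"
  assumes S: "0 < S"
    and good: "\<exists>X. mat_inverse (gram_matrix d S y ls) = Some X \<and> spectral_norm X \<le> 1 / real S"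
    and data: "\<And>r. r < n * S \<Longrightarrow> lattice_sum d N g f (ls ! (r div S)) (y (r div S, r mod S))
        = (\<Sum>i<n. fourier_char d (ls ! i) (y (r div S, r mod S)) * a i) + E r"
    and E: "\<And>r. r < n * S \<Longrightarrow> cmod (E r) \<le> T" "0 \<le> T"
  shows "(\<Sum>i<n. cmod (vec_index (fiber_coeffs d N g S y f ls) i - a i)) \<le> real n * T"
proof -
  let ?B = "shift_matrix d S y ls" and ?G = "gram_matrix d S y ls"
  let ?F = "Matrix.vec (n * S) (\<lambda>r. lattice_sum d N g f (ls ! (r div S)) (y (r div S, r mod S)))"
  define B where "B r i = ?B $$ (r, i)" for r i
  define G where "G = (\<lambda>i j. \<Sum>r<n * S. cnj (B r i) * B r j)"
  define c where "c = vec_index (fiber_coeffs d N g S y f ls)"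
  have Bc: "?B \<in> carrier_mat (n * S) n" and Gc: "?G \<in> carrier_mat n n"
    and Ac: "mat_adjoint ?B \<in> carrier_mat n (n * S)"
    unfolding n_def using mat_adjoint_carrier[OF shift_matrix_carrier] by simp_all
  have G: "?G $$ (i, j) = G i j" if "i < n" "j < n" for i j
    using that by (simp add: gram_matrix_index G_def B_def n_def)
  obtain X where inv: "mat_inverse ?G = Some X" using good by blast
  have X: "?G * X = 1\<^sub>m n" "X \<in> carrier_mat n n" using mat_inverse(2)[OF Gc inv] by auto
  have lower: "real S * l2norm n v \<le> l2norm n (\<lambda>i. \<Sum>j<n. G i j * v j)" for v
  proof -
    have "l2norm n (\<lambda>i. \<Sum>j<n. G i j * v j) = l2norm n (\<lambda>i. \<Sum>j<n. ?G $$ (i, j) * v j)"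
      using G by (intro l2norm_cong) simp
    then show ?thesis using inverse_norm_le_iff[OF Gc, of "real S"] good S by simp
  qed
  have cv: "fiber_coeffs d N g S y f ls = (X * mat_adjoint ?B) *\<^sub>v ?F"
    by (simp add: fiber_coeffs_def inv n_def)
  have cc: "fiber_coeffs d N g S y f ls \<in> carrier_vec n"
    unfolding cv using X Ac by (intro mult_mat_vec_carrier[of _ n "n * S"] mult_carrier_mat[of _ _ n]) auto
  have "?G *\<^sub>v fiber_coeffs d N g S y f ls = (?G * (X * mat_adjoint ?B)) *\<^sub>v ?F"
    unfolding cv using X Ac Gc by (intro assoc_mult_mat_vec[symmetric, of _ n n _ "n * S"]) auto
  also have "?G * (X * mat_adjoint ?B) = mat_adjoint ?B"
    using X Ac Gc by (simp add: assoc_mult_mat[symmetric, of ?G n n X n "mat_adjoint ?B" "n * S"])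
  finally have eq: "?G *\<^sub>v fiber_coeffs d N g S y f ls = mat_adjoint ?B *\<^sub>v ?F" .
  have Gcoef: "(\<Sum>j<n. G i j * c j) = (\<Sum>r<n * S. cnj (B r i) * vec_index ?F r)" if i: "i < n" for i
  proof -
    have "vec_index (?G *\<^sub>v fiber_coeffs d N g S y f ls) i = (\<Sum>j<n. G i j * c j)"
      using i Gc cc G by (subst vec_index_mult_mat_vec) (auto simp: c_def)
    moreover have "vec_index (mat_adjoint ?B *\<^sub>v ?F) i = (\<Sum>r<n * S. cnj (B r i) * vec_index ?F r)"
      using i Ac mat_adjoint_index[OF Bc i] by (subst vec_index_mult_mat_vec) (auto simp: B_def)
    ultimately show ?thesis using eq by simp
  qed
  define w where "w i = c i - a i" for i
  define z where "z = vec_index (X *\<^sub>v Matrix.vec n w)"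
  have normal: "(\<Sum>j<n. G i j * w j) = (\<Sum>r<n * S. cnj (B r i) * E r)" if i: "i < n" for i
  proof -
    have "(\<Sum>j<n. G i j * w j) = (\<Sum>r<n * S. cnj (B r i) * vec_index ?F r) - (\<Sum>j<n. G i j * a j)"
      using Gcoef[OF i] by (simp add: w_def right_diff_distrib sum_subtractf)
    also have "(\<Sum>j<n. G i j * a j) = (\<Sum>r<n * S. cnj (B r i) * (\<Sum>j<n. B r j * a j))"
      unfolding G_def by (rule gram_mult_vec)
    also have "(\<Sum>r<n * S. cnj (B r i) * vec_index ?F r) - \<dots> = (\<Sum>r<n * S. cnj (B r i) * E r)"
    proof -
      have "vec_index ?F r = (\<Sum>j<n. B r j * a j) + E r" if "r < n * S" for r
        using data[OF that] that by (simp add: B_def shift_matrix_def n_def)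
      then show ?thesis by (simp add: sum_subtractf[symmetric] right_diff_distrib[symmetric])
    qed
    finally show ?thesis .
  qed
  have solvable: "(\<Sum>j<n. G i j * z j) = w i" if i: "i < n" for i
  proof -
    have "?G *\<^sub>v (X *\<^sub>v Matrix.vec n w) = (?G * X) *\<^sub>v Matrix.vec n w"
      using X Gc by (intro assoc_mult_mat_vec[symmetric, of _ n n _ n]) auto
    then have "vec_index (?G *\<^sub>v (X *\<^sub>v Matrix.vec n w)) i = w i"
      using X i by simp
    moreover have "vec_index (?G *\<^sub>v (X *\<^sub>v Matrix.vec n w)) i = (\<Sum>j<n. G i j * z j)"
      using i Gc X G by (subst vec_index_mult_mat_vec) (auto simp: z_def simp del: index_mult_mat_vec)
    ultimately show ?thesis by simp
  qed
  have "sqrt (real S) * l2norm n w \<le> l2norm (n * S) E"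
    using S by (intro least_squares_stability[where B = B and z = z, OF _ lower[unfolded G_def]
      normal[unfolded G_def] solvable[unfolded G_def]]) simp_all
  also have "\<dots> \<le> sqrt (real (n * S)) * T"
    using E by (rule l2norm_le_sqrt_card)
  finally have "l2norm n w \<le> sqrt (real n) * T"
    using S by (simp add: real_sqrt_mult mult_ac)
  then have "sqrt (real n) * l2norm n w \<le> sqrt (real n) * (sqrt (real n) * T)"
    by (intro mult_left_mono) auto
  moreover have "(\<Sum>i<n. cmod (w i)) \<le> sqrt (real n) * l2norm n w"
    by (rule sum_cmod_le_l2norm)
  moreover have "sqrt (real n) * (sqrt (real n) * T) = real n * T"
    by (simp add: mult.assoc[symmetric])
  ultimately show ?thesis by (simp add: w_def c_def)
qed

section \<open>Aliasing and the error of the algorithm\<close>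

lemma fourier_char_cis: "fourier_char d k x = cis (2 * pi * dot d (\<lambda>j. real_of_int (k j)) x)"
  by (simp add: fourier_char_def cis_conv_exp mult_ac)

lemma cmod_fourier_char [simp]: "cmod (fourier_char d k x) = 1"
  by (simp add: fourier_char_cis)

lemma fourier_char_add:
  "fourier_char d k (\<lambda>j. x j + y j) = fourier_char d k x * fourier_char d k y"
  by (simp add: fourier_char_cis cis_mult dot_def algebra_simps sum.distrib)

lemma cis_2pi_add_int: "cis (2 * pi * (a + of_int m)) = cis (2 * pi * a)"
  by (simp add: distrib_left cis_mult[symmetric])

lemma fourier_char_frac: "fourier_char d k (frac_vec d x) = fourier_char d k x"
proof -
  have "dot d (\<lambda>j. real_of_int (k j)) x
      = dot d (\<lambda>j. real_of_int (k j)) (frac_vec d x) + of_int (\<Sum>j<d. k j * \<lfloor>x j\<rfloor>)"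
    by (simp add: dot_def frac_vec_def frac_def sum.distrib[symmetric] algebra_simps)
  then show ?thesis by (simp only: fourier_char_cis cis_2pi_add_int)
qed

lemma frac_vec_in_unit_cube: "frac_vec d x \<in> unit_cube d"
  by (auto simp: frac_vec_def unit_cube_def frac_lt_1)

text \<open>
  For \<open>m\<close> not divisible by \<open>N\<close> this is a geometric sum over a full period.
\<close>

lemma mean_roots_of_unity:
  assumes "0 < N"
  shows "1 / of_nat N * (\<Sum>n<N. cis (2 * pi * (real n * (real_of_int m / real N))))
    = (if int N dvd m then 1 else 0)"
proof -
  define z where "z = cis (2 * pi * (real_of_int m / real N))"
  have pow: "cis (2 * pi * (real n * (real_of_int m / real N))) = z ^ n" for n
    by (simp add: z_def Complex.DeMoivre mult_ac)
  have "z ^ N = cis (2 * pi * of_int m)"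
    using assms by (simp add: z_def Complex.DeMoivre)
  then have zN: "z ^ N = 1" by simp
  have "z = 1 \<longleftrightarrow> int N dvd m"
  proof
    assume "z = 1"
    then have "cos (2 * pi * (real_of_int m / real N)) = 1"
      by (simp add: z_def complex_eq_iff)
    then obtain k :: int where "2 * pi * (real_of_int m / real N) = of_int k * 2 * pi"
      by (auto simp: cos_one_2pi_int)
    then have "real_of_int m = of_int (k * int N)"
      using assms by (simp add: field_simps)
    then have "m = k * int N" by (simp only: of_int_eq_iff)
    then show "int N dvd m" by simp
  next
    assume "int N dvd m"
    then obtain k where "m = int N * k" by blast
    then show "z = 1" using assms by (simp add: z_def)
  qed
  then show ?thesis
    unfolding pow sum_gp_strict using zN assms by simp
qed

lemma has_sum_finite_sum:
  fixes f :: "'i \<Rightarrow> 'a \<Rightarrow> 'b :: topological_comm_monoid_add"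
  assumes "finite I" "\<And>i. i \<in> I \<Longrightarrow> (f i has_sum s i) A"
  shows "((\<lambda>x. \<Sum>i\<in>I. f i x) has_sum (\<Sum>i\<in>I. s i)) A"
  using assms by (induction I rule: finite_induct) (auto intro!: has_sum_add)

lemma dot_minus_left: "dot d (\<lambda>j. - x j) y = - dot d x (y :: nat \<Rightarrow> 'a :: comm_ring)"
  by (simp add: dot_def sum_negf)

text \<open>
  Aliasing: the lattice sum averages the factor \<open>exp (2\<pi>i n (k - l) \<cdot> g / N)\<close> over \<open>n\<close>, which leaves
  exactly the frequencies in the residue class of \<open>l\<close>.
\<close>

lemma lattice_sum_has_sum:
  assumes f: "f \<in> korobov_space d \<alpha> \<gamma>" and N: "0 < N"
  shows "((\<lambda>k. fourier_coeff d f k * fourier_char d k y) has_sum lattice_sum d N g f l y)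
    {k \<in> int_vecs d. [dot d k g = dot d l g] (mod int N)}"
proof -
  define t where "t n = (\<lambda>j. real n * real_of_int (g j) / real N)" for n
  let ?x = "\<lambda>n. frac_vec d (\<lambda>j. t n j + y j)"
  let ?a = "fourier_coeff d f"
  have inner: "dot d (\<lambda>j. real_of_int (k j)) (t n) = real n * (real_of_int (dot d k g) / real N)" for k n
    by (simp add: dot_def t_def sum_divide_distrib sum_distrib_left mult_ac)
  have "((\<lambda>k. \<Sum>n<N. 1 / of_nat N * (?a k * fourier_char d k (?x n) * fourier_char d (\<lambda>j. - l j) (t n)))
      has_sum (\<Sum>n<N. 1 / of_nat N * (f (?x n) * fourier_char d (\<lambda>j. - l j) (t n)))) (int_vecs d)"
    using f frac_vec_in_unit_cube
    by (intro has_sum_finite_sum has_sum_cmult_right has_sum_cmult_left) (auto simp: korobov_space_def)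
  moreover have "(\<Sum>n<N. 1 / of_nat N * (f (?x n) * fourier_char d (\<lambda>j. - l j) (t n))) = lattice_sum d N g f l y"
    by (simp add: lattice_sum_def t_def sum_distrib_left)
  moreover have "(\<Sum>n<N. 1 / of_nat N * (?a k * fourier_char d k (?x n) * fourier_char d (\<lambda>j. - l j) (t n)))
      = (if [dot d k g = dot d l g] (mod int N) then ?a k * fourier_char d k y else 0)" for k
  proof -
    have "fourier_char d k (t n) * fourier_char d (\<lambda>j. - l j) (t n)
        = cis (2 * pi * (real n * (real_of_int (dot d k g - dot d l g) / real N)))" for n
    proof -
      have "(\<lambda>j. real_of_int (- l j)) = (\<lambda>j. - real_of_int (l j))" by auto
      then have "fourier_char d (\<lambda>j. - l j) (t n) = cis (2 * pi * (- (real n * (real_of_int (dot d l g) / real N))))"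
        unfolding fourier_char_cis by (simp only: dot_minus_left inner)
      moreover have "fourier_char d k (t n) = cis (2 * pi * (real n * (real_of_int (dot d k g) / real N)))"
        unfolding fourier_char_cis by (simp only: inner)
      ultimately show ?thesis
        by (simp add: cis_mult algebra_simps diff_divide_distrib)
    qed
    then have "(\<Sum>n<N. 1 / of_nat N * (?a k * fourier_char d k (?x n) * fourier_char d (\<lambda>j. - l j) (t n)))
        = (\<Sum>n<N. ?a k * fourier_char d k y * (1 / of_nat N * cis (2 * pi * (real n * (real_of_int (dot d k g - dot d l g) / real N)))))"
      unfolding fourier_char_frac fourier_char_add by (intro sum.cong refl) (simp add: mult_ac)
    also have "\<dots> = ?a k * fourier_char d k y *
        (1 / of_nat N * (\<Sum>n<N. cis (2 * pi * (real n * (real_of_int (dot d k g - dot d l g) / real N)))))"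
      by (simp only: sum_distrib_left)
    also have "\<dots> = (if [dot d k g = dot d l g] (mod int N) then ?a k * fourier_char d k y else 0)"
      unfolding mean_roots_of_unity[OF N] by (simp add: cong_iff_dvd_diff)
    finally show ?thesis .
  qed
  ultimately have "((\<lambda>k. if [dot d k g = dot d l g] (mod int N) then ?a k * fourier_char d k y else 0)
      has_sum lattice_sum d N g f l y) (int_vecs d)"
    by (simp only:)
  then show ?thesis
    by (subst has_sum_cong_neutral[where T = "int_vecs d" and
      g = "\<lambda>k. if [dot d k g = dot d l g] (mod int N) then ?a k * fourier_char d k y else 0"]) auto
qed

context korobov
begin

lemma fiber_enumeration_fibers:
  assumes "fiber_enumeration d \<alpha> \<gamma> N M g L"
  obtains l where "\<And>j. j < length L \<Longrightarrow> l j \<in> freq_set d \<alpha> \<gamma> M"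
    "\<And>j. j < length L \<Longrightarrow> set (L ! j) = fiber d \<alpha> \<gamma> N M g (l j)"
    "\<And>i j. i < length L \<Longrightarrow> j < length L \<Longrightarrow> [dot d (l i) g = dot d (l j) g] (mod int N) \<Longrightarrow> i = j"
proof -
  have "\<forall>j<length L. \<exists>l. l \<in> freq_set d \<alpha> \<gamma> M \<and> set (L ! j) = fiber d \<alpha> \<gamma> N M g l"
    using assms by (auto simp: fiber_enumeration_def)
  then obtain l where l: "\<And>j. j < length L \<Longrightarrow> l j \<in> freq_set d \<alpha> \<gamma> M \<and> set (L ! j) = fiber d \<alpha> \<gamma> N M g (l j)"
    by metis
  have "i = j" if ij: "i < length L" "j < length L" and c: "[dot d (l i) g = dot d (l j) g] (mod int N)" for i j
  proof (rule ccontr)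
    assume "i \<noteq> j"
    then have "set (L ! i) \<inter> set (L ! j) = {}"
      using assms ij unfolding fiber_enumeration_def disjoint_family_on_def by blast
    moreover have "l i \<in> set (L ! i)" using l[OF ij(1)] by (simp add: fiber_def)
    moreover have "l i \<in> set (L ! j)" using l[OF ij(1)] l[OF ij(2)] c by (simp add: fiber_def)
    ultimately show False by blast
  qed
  with l show thesis by (intro that[of l]) simp_all
qed

lemma length_fiber_le_max_fiber:
  assumes "fiber_enumeration d \<alpha> \<gamma> N M g L" "j < length L"
  shows "length (L ! j) \<le> max_fiber d \<alpha> \<gamma> N M g"
proof -
  obtain l where l: "l \<in> freq_set d \<alpha> \<gamma> M" "set (L ! j) = fiber d \<alpha> \<gamma> N M g l" and "distinct (L ! j)"
    using assms by (auto simp: fiber_enumeration_def)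
  then have "length (L ! j) = card (fiber d \<alpha> \<gamma> N M g l)"
    using distinct_card[of "L ! j"] by simp
  then show ?thesis using card_fiber_le_max_fiber l(1) by (simp add: freq_set_def)
qed

lemma approx_coeff_eq:
  assumes "fiber_enumeration d \<alpha> \<gamma> N M g L" "j < length L" "i < length (L ! j)"
  shows "approx_coeff d N g L S y f (L ! j ! i) = vec_index (fiber_coeffs d N g S y f (L ! j)) i"
proof -
  have "(THE (j', i'). j' < length L \<and> i' < length (L ! j') \<and> L ! j' ! i' = L ! j ! i) = (j, i)"
  proof (rule the_equality)
    show "case (j, i) of (j', i') \<Rightarrow> j' < length L \<and> i' < length (L ! j') \<and> L ! j' ! i' = L ! j ! i"
      using assms by simp
    fix p assume "case p of (j', i') \<Rightarrow> j' < length L \<and> i' < length (L ! j') \<and> L ! j' ! i' = L ! j ! i"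
    then obtain j' i' where p: "p = (j', i')" "j' < length L" "i' < length (L ! j')" "L ! j' ! i' = L ! j ! i"
      by (cases p) auto
    have "L ! j ! i \<in> set (L ! j) \<inter> set (L ! j')"
      using p assms by (metis IntI nth_mem)
    then have "j' = j"
      using assms p unfolding fiber_enumeration_def disjoint_family_on_def by blast
    moreover have "distinct (L ! j)" using assms by (simp add: fiber_enumeration_def)
    ultimately show "p = (j, i)"
      using p assms by (simp add: nth_eq_iff_index_eq)
  qed
  then show ?thesis by (simp add: approx_coeff_def)
qed

text \<open>
  A fiber together with the frequencies \<open>D j\<close> of its residue class outside \<open>A\<close> forms the whole
  residue class, so the lattice sums of the fiber are perturbed by at most the Fourier mass \<open>t j\<close> of
  \<open>D j\<close>. The sets \<open>D j\<close> are disjoint, and all the masses together are at most the truncation error.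
\<close>

lemma approximation_error:
  assumes f: "f \<in> korobov_space d \<alpha> \<gamma>" and N: "0 < N" and S: "0 < S"
    and L: "fiber_enumeration d \<alpha> \<gamma> N M g L" and good: "good_shifts d S y L"
    and tail: "\<And>F. finite F \<Longrightarrow> F \<subseteq> int_vecs d - freq_set d \<alpha> \<gamma> M \<Longrightarrow> (\<Sum>k\<in>F. cmod (fourier_coeff d f k)) \<le> T"
    and x: "x \<in> unit_cube d"
  shows "cmod (f x - lattice_algorithm d \<alpha> \<gamma> N M g L S y f x) \<le> (1 + real (max_fiber d \<alpha> \<gamma> N M g)) * T"
proof -
  let ?a = "fourier_coeff d f" and ?A = "freq_set d \<alpha> \<gamma> M" and ?R = "real (max_fiber d \<alpha> \<gamma> N M g)"
  let ?I = "int_vecs d - ?A"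
  obtain l where l: "\<And>j. j < length L \<Longrightarrow> l j \<in> ?A"
    "\<And>j. j < length L \<Longrightarrow> set (L ! j) = fiber d \<alpha> \<gamma> N M g (l j)"
    "\<And>i j. i < length L \<Longrightarrow> j < length L \<Longrightarrow> [dot d (l i) g = dot d (l j) g] (mod int N) \<Longrightarrow> i = j"
    using fiber_enumeration_fibers[OF L] by blast
  have summ: "(\<lambda>k. cmod (?a k)) summable_on int_vecs d"
    using f by (simp add: korobov_space_def)
  have abs: "(\<lambda>k. cmod (?a k * fourier_char d k z)) summable_on int_vecs d" for z
    using summ by (simp add: norm_mult)
  define D where "D j = {k \<in> ?I. [dot d k g = dot d (l j) g] (mod int N)}" for j
  define t where "t j = (\<Sum>\<^sub>\<infinity>k\<in>D j. cmod (?a k))" for j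
  have summD: "(\<lambda>k. cmod (?a k)) summable_on D j" for j
    using summ by (rule summable_on_subset_banach) (auto simp: D_def)
  have absD: "(\<lambda>k. cmod (?a k * fourier_char d k z)) summable_on D j" for z j
    using summD[of j] by (simp add: norm_mult)
  have t0: "0 \<le> t j" for j unfolding t_def by (rule infsum_nonneg) simp
  have tail_inf: "(\<Sum>\<^sub>\<infinity>k\<in>B. cmod (?a k)) \<le> T" if "B \<subseteq> ?I" for B
    using tail that summ by (intro infsum_le_finite_sums summable_on_subset_banach[of _ "int_vecs d" B]) auto
  have t_sum: "(\<Sum>j<length L. t j) \<le> T"
  proof -
    have "((\<lambda>k. cmod (?a k)) has_sum (\<Sum>j<length L. t j)) (\<Union>j<length L. D j)"
    proof (rule sum_has_sum)
      fix i j assume ij: "i \<in> {..<length L}" "j \<in> {..<length L}" "i \<noteq> j"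
      show "D i \<inter> D j = {}"
      proof (rule ccontr)
        assume "D i \<inter> D j \<noteq> {}"
        then obtain k where "[dot d k g = dot d (l i) g] (mod int N)" "[dot d k g = dot d (l j) g] (mod int N)"
          by (auto simp: D_def)
        then have "[dot d (l i) g = dot d (l j) g] (mod int N)"
          using cong_sym cong_trans by blast
        then show False using l(3)[of i j] ij by simp
      qed
    qed (use summD in \<open>auto simp: t_def\<close>)
    then have "(\<Sum>j<length L. t j) = (\<Sum>\<^sub>\<infinity>k\<in>(\<Union>j<length L. D j). cmod (?a k))"
      by (simp add: infsumI)
    also have "\<dots> \<le> T" by (rule tail_inf) (auto simp: D_def)
    finally show ?thesis .
  qed
  have fiber_err: "(\<Sum>i<length (L ! j). cmod (vec_index (fiber_coeffs d N g S y f (L ! j)) i - ?a (L ! j ! i)))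
      \<le> real (length (L ! j)) * t j" if j: "j < length L" for j
  proof (rule fiber_coeffs_error[OF S])
    let ?ls = "L ! j"
    let ?y = "\<lambda>r. y (r div S, r mod S)"
    define E where "E r = (\<Sum>\<^sub>\<infinity>k\<in>D j. ?a k * fourier_char d k (?y r))" for r
    show "\<exists>X. mat_inverse (gram_matrix d S y ?ls) = Some X \<and> spectral_norm X \<le> 1 / real S"
      using good j by (simp add: good_shifts_def)
    show "lattice_sum d N g f (?ls ! (r div S)) (?y r)
        = (\<Sum>i<length ?ls. fourier_char d (?ls ! i) (?y r) * ?a (?ls ! i)) + E r"
      if r: "r < length ?ls * S" for r
    proof -
      have "r div S < length ?ls" using r S by (simp add: less_mult_imp_div_less)
      then have "?ls ! (r div S) \<in> fiber d \<alpha> \<gamma> N M g (l j)"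
        using l(2)[OF j] nth_mem by blast
      then have c: "[dot d (?ls ! (r div S)) g = dot d (l j) g] (mod int N)"
        by (simp add: fiber_def)
      have "{k \<in> int_vecs d. [dot d k g = dot d (?ls ! (r div S)) g] (mod int N)}
          = {k \<in> int_vecs d. [dot d k g = dot d (l j) g] (mod int N)}"
        using c cong_trans cong_sym by blast
      also have "\<dots> = set ?ls \<union> D j"
        unfolding l(2)[OF j] D_def fiber_def by (auto simp: freq_set_def)
      finally have "((\<lambda>k. ?a k * fourier_char d k (?y r)) has_sum lattice_sum d N g f (?ls ! (r div S)) (?y r)) (set ?ls \<union> D j)"
        using lattice_sum_has_sum[OF f N, of "?y r" g "?ls ! (r div S)"] by simp
      moreover have "((\<lambda>k. ?a k * fourier_char d k (?y r)) has_sum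
          (\<Sum>k\<in>set ?ls. ?a k * fourier_char d k (?y r)) + E r) (set ?ls \<union> D j)"
      proof (rule has_sum_Un_disjoint)
        show "((\<lambda>k. ?a k * fourier_char d k (?y r)) has_sum E r) (D j)"
          unfolding E_def using absD by (intro has_sum_infsum) (rule abs_summable_summable)
        show "set ?ls \<inter> D j = {}" unfolding l(2)[OF j] D_def fiber_def by auto
      qed simp
      ultimately have "lattice_sum d N g f (?ls ! (r div S)) (?y r)
          = (\<Sum>k\<in>set ?ls. ?a k * fourier_char d k (?y r)) + E r"
        by (rule has_sum_unique)
      also have "(\<Sum>k\<in>set ?ls. ?a k * fourier_char d k (?y r))
          = (\<Sum>i<length ?ls. fourier_char d (?ls ! i) (?y r) * ?a (?ls ! i))"
      proof -
        have "distinct ?ls" using L j by (simp add: fiber_enumeration_def)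
        then have "bij_betw ((!) ?ls) {..<length ?ls} (set ?ls)"
          by (intro bij_betw_nth) auto
        then show ?thesis
          by (subst sum.reindex_bij_betw[symmetric]) (simp_all add: mult.commute)
      qed
      finally show ?thesis .
    qed
    show "cmod (E r) \<le> t j" for r
    proof -
      have "cmod (E r) \<le> (\<Sum>\<^sub>\<infinity>k\<in>D j. cmod (?a k * fourier_char d k (?y r)))"
        unfolding E_def by (rule norm_infsum_bound[OF absD])
      then show ?thesis by (simp add: t_def norm_mult)
    qed
    show "0 \<le> t j" by (rule t0)
  qed
  have coef: "(\<Sum>k\<in>?A. cmod (?a k - approx_coeff d N g L S y f k)) \<le> ?R * T"
  proof -
    have "(\<Sum>k\<in>?A. cmod (?a k - approx_coeff d N g L S y f k))
        = (\<Sum>k\<in>(\<Union>j<length L. set (L ! j)). cmod (?a k - approx_coeff d N g L S y f k))"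
      using L by (simp add: fiber_enumeration_def)
    also have "\<dots> = (\<Sum>j<length L. \<Sum>k\<in>set (L ! j). cmod (?a k - approx_coeff d N g L S y f k))"
      using L by (intro sum.UNION_disjoint) (auto simp: fiber_enumeration_def disjoint_family_on_def)
    also have "\<dots> \<le> (\<Sum>j<length L. ?R * t j)"
    proof (intro sum_mono)
      fix j assume "j \<in> {..<length L}"
      then have j: "j < length L" by simp
      then have "distinct (L ! j)" using L by (simp add: fiber_enumeration_def)
      then have "bij_betw ((!) (L ! j)) {..<length (L ! j)} (set (L ! j))"
        by (intro bij_betw_nth) auto
      then have "(\<Sum>k\<in>set (L ! j). cmod (?a k - approx_coeff d N g L S y f k))
          = (\<Sum>i<length (L ! j). cmod (?a (L ! j ! i) - approx_coeff d N g L S y f (L ! j ! i)))"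
        by (subst sum.reindex_bij_betw[symmetric]) auto
      also have "\<dots> = (\<Sum>i<length (L ! j). cmod (vec_index (fiber_coeffs d N g S y f (L ! j)) i - ?a (L ! j ! i)))"
        using approx_coeff_eq[OF L j] by (intro sum.cong refl) (simp add: norm_minus_commute)
      also have "\<dots> \<le> real (length (L ! j)) * t j" by (rule fiber_err[OF j])
      also have "\<dots> \<le> ?R * t j"
        using length_fiber_le_max_fiber[OF L j] t0 by (intro mult_right_mono) auto
      finally show "(\<Sum>k\<in>set (L ! j). cmod (?a k - approx_coeff d N g L S y f k)) \<le> ?R * t j" .
    qed
    also have "\<dots> = ?R * (\<Sum>j<length L. t j)" by (simp only: sum_distrib_left)
    also have "\<dots> \<le> ?R * T" using t_sum by (intro mult_left_mono) auto
    finally show ?thesis .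
  qed
  let ?rest = "\<Sum>\<^sub>\<infinity>k\<in>?I. ?a k * fourier_char d k x"
  have absI: "(\<lambda>k. cmod (?a k * fourier_char d k x)) summable_on ?I"
    using abs by (rule summable_on_subset_banach) auto
  have fx: "((\<lambda>k. ?a k * fourier_char d k x) has_sum f x) (int_vecs d)"
    using f x by (simp add: korobov_space_def)
  have "((\<lambda>k. ?a k * fourier_char d k x) has_sum (\<Sum>k\<in>?A. ?a k * fourier_char d k x) + ?rest) (?A \<union> ?I)"
    using finite_freq_set absI abs_summable_summable[OF absI] by (intro has_sum_Un_disjoint) auto
  moreover have "?A \<union> ?I = int_vecs d" by (auto simp: freq_set_def)
  ultimately have "f x = (\<Sum>k\<in>?A. ?a k * fourier_char d k x) + ?rest"
    using has_sum_unique[OF fx] by simp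
  then have eq: "f x - lattice_algorithm d \<alpha> \<gamma> N M g L S y f x
      = (\<Sum>k\<in>?A. (?a k - approx_coeff d N g L S y f k) * fourier_char d k x) + ?rest"
    by (simp add: lattice_algorithm_def sum_subtractf left_diff_distrib)
  have "cmod (\<Sum>k\<in>?A. (?a k - approx_coeff d N g L S y f k) * fourier_char d k x)
      \<le> (\<Sum>k\<in>?A. cmod (?a k - approx_coeff d N g L S y f k))"
    by (rule order_trans[OF norm_sum]) (simp add: norm_mult)
  then have on: "cmod (\<Sum>k\<in>?A. (?a k - approx_coeff d N g L S y f k) * fourier_char d k x) \<le> ?R * T"
    using coef by (rule order_trans)
  have "cmod ?rest \<le> (\<Sum>\<^sub>\<infinity>k\<in>?I. cmod (?a k))"
    using norm_infsum_bound[OF absI] by (simp add: norm_mult)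
  then have off: "cmod ?rest \<le> T"
    using tail_inf[OF order_refl] by (rule order_trans)
  have "cmod (f x - lattice_algorithm d \<alpha> \<gamma> N M g L S y f x) \<le> ?R * T + T"
    unfolding eq using on off by (rule norm_triangle_le[OF add_mono])
  then show ?thesis by (simp add: algebra_simps)
qed

text \<open>
  Cauchy-Schwarz against the Korobov norm leaves the sum of \<open>r\<^sup>-\<^sup>2\<close> over weights at least \<open>M\<close>,
  where \<open>r\<^sup>-\<^sup>2 \<le> M\<^sup>l\<^sup>-\<^sup>2 r\<^sup>-\<^sup>l\<close> because \<open>l \<le> 2\<close>.
\<close>

lemma worst_case_error_le:
  assumes N: "0 < N" and S: "0 < S"
    and L: "fiber_enumeration d \<alpha> \<gamma> N M g L" and good: "good_shifts d S y L"
    and l: "l \<in> {1 / \<alpha><..2}" and M: "0 < M"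
  shows "worst_case_error (lattice_algorithm d \<alpha> \<gamma> N M g L S y) d \<alpha> \<gamma>
    \<le> ereal ((1 + real (max_fiber d \<alpha> \<gamma> N M g)) * sqrt (M powr (l - 2) * zeta_prod d \<alpha> \<gamma> l))"
  unfolding worst_case_error_def
proof (intro SUP_least)
  fix f x assume "f \<in> {f \<in> korobov_space d \<alpha> \<gamma>. korobov_norm d \<alpha> \<gamma> f \<le> 1}" and x: "x \<in> unit_cube d"
  then have f: "f \<in> korobov_space d \<alpha> \<gamma>" and norm: "korobov_norm d \<alpha> \<gamma> f \<le> 1" by auto
  let ?a = "\<lambda>k. cmod (fourier_coeff d f k)" and ?r = "korobov_weight d \<alpha> \<gamma>"
  have "sum ?a F \<le> sqrt (M powr (l - 2) * zeta_prod d \<alpha> \<gamma> l)"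
    if F: "finite F" "F \<subseteq> int_vecs d - freq_set d \<alpha> \<gamma> M" for F
  proof -
    have "sum ?a F = (\<Sum>k\<in>F. \<bar>?a k * ?r k\<bar> * \<bar>1 / ?r k\<bar>)"
      using korobov_weight_pos by (intro sum.cong refl) (simp add: abs_mult less_imp_le less_imp_neq[symmetric])
    also have "\<dots> \<le> L2_set (\<lambda>k. ?a k * ?r k) F * L2_set (\<lambda>k. 1 / ?r k) F"
      by (rule L2_set_mult_ineq)
    also have "\<dots> \<le> 1 * sqrt (M powr (l - 2) * zeta_prod d \<alpha> \<gamma> l)"
    proof (intro mult_mono)
      have "(\<Sum>k\<in>F. (?a k * ?r k)\<^sup>2) \<le> (\<Sum>\<^sub>\<infinity>k\<in>int_vecs d. (?a k)\<^sup>2 * (?r k)\<^sup>2)"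
        unfolding power_mult_distrib using F f
        by (intro finite_sum_le_infsum) (auto simp: korobov_space_def)
      also have "\<dots> \<le> 1"
        using norm real_sqrt_le_1_iff unfolding korobov_norm_def by blast
      finally show "L2_set (\<lambda>k. ?a k * ?r k) F \<le> 1" by (simp add: L2_set_def)
      have "(\<Sum>k\<in>F. (1 / ?r k)\<^sup>2) \<le> (\<Sum>k\<in>F. M powr (l - 2) * ?r k powr (- l))"
      proof (intro sum_mono)
        fix k assume "k \<in> F"
        then have k: "M \<le> ?r k" using F by (auto simp: freq_set_def)
        have "(1 / ?r k)\<^sup>2 = ?r k powr (- 2)"
          using korobov_weight_pos[of k] by (simp add: powr_minus powr_numeral power_one_over inverse_eq_divide)
        also have "\<dots> = ?r k powr (l - 2) * ?r k powr (- l)"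
          by (simp add: powr_add[symmetric])
        also have "\<dots> \<le> M powr (l - 2) * ?r k powr (- l)"
          using k M exponent_bounds[OF l] by (intro mult_right_mono powr_mono2') auto
        finally show "(1 / ?r k)\<^sup>2 \<le> M powr (l - 2) * ?r k powr (- l)" .
      qed
      also have "\<dots> = M powr (l - 2) * (\<Sum>k\<in>F. ?r k powr (- l))" by (simp only: sum_distrib_left)
      also have "\<dots> \<le> M powr (l - 2) * zeta_prod d \<alpha> \<gamma> l"
        using F by (intro mult_left_mono sum_korobov_weight_powr_le[OF l]) auto
      finally show "L2_set (\<lambda>k. 1 / ?r k) F \<le> sqrt (M powr (l - 2) * zeta_prod d \<alpha> \<gamma> l)"
        by (simp add: L2_set_def)
    qed auto
    finally show ?thesis by simp
  qed
  then show "ereal (cmod (f x - lattice_algorithm d \<alpha> \<gamma> N M g L S y f x))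
      \<le> ereal ((1 + real (max_fiber d \<alpha> \<gamma> N M g)) * sqrt (M powr (l - 2) * zeta_prod d \<alpha> \<gamma> l))"
    using approximation_error[OF f N S L good _ x] by simp
qed

end

section \<open>Rates in the number of function values\<close>

lemma R_star_le_powr:
  assumes "1 \<le> d" "0 < \<eta>"
  obtains C where "1 \<le> C"
    "\<And>N m\<^sub>0. 1 \<le> N \<Longrightarrow> real m\<^sub>0 \<le> 1 + 2 * ln (real N) \<Longrightarrow> real (R_star d m\<^sub>0) \<le> C * real N powr \<eta>"
proof -
  \<comment> \<open>The logarithm is at most a multiple of \<open>N\<^bsup>\<epsilon>\<^esup>\<close>, and it occurs to a power of at most \<open>d\<close>.\<close>
  define \<epsilon> where "\<epsilon> = \<eta> / real d"
  have \<epsilon>: "0 < \<epsilon>" using assms by (simp add: \<epsilon>_def)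
  define B where "B = 1 + real d + 2 / \<epsilon>"
  have B: "1 \<le> B" using \<epsilon> by (simp add: B_def)
  show thesis
  proof (rule that[of "1 + 3 ^ d * B ^ d"])
    show "1 \<le> 1 + 3 ^ d * B ^ d" using B by simp
    fix N m\<^sub>0 :: nat assume N: "1 \<le> N" and m: "real m\<^sub>0 \<le> 1 + 2 * ln (real N)"
    define x where "x = real N powr \<epsilon>"
    have x: "1 \<le> x" using N \<epsilon> by (simp add: x_def ge_one_powr_ge_zero)
    have "ln (real N) \<le> x / \<epsilon>" using ln_powr_bound[of "real N" \<epsilon>] N \<epsilon> by (simp add: x_def)
    then have "real (m\<^sub>0 + d) \<le> 1 + real d + 2 / \<epsilon> * x" using m by simp
    also have "\<dots> \<le> (1 + real d) * x + 2 / \<epsilon> * x"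
      using x mult_left_mono[OF x, of "1 + real d"] by simp
    finally have le: "real (m\<^sub>0 + d) \<le> B * x" by (simp add: B_def algebra_simps)
    have "real (R_star d m\<^sub>0) \<le> 1 + 3 ^ d * real (m\<^sub>0 + d) ^ (d - 1)"
      by (simp add: R_star_def of_nat_diff mult_right_mono)
    also have "real (m\<^sub>0 + d) ^ (d - 1) \<le> real (m\<^sub>0 + d) ^ d"
      using assms(1) by (intro power_increasing) auto
    also have "real (m\<^sub>0 + d) ^ d \<le> (B * x) ^ d"
      using le by (intro power_mono) auto
    also have "\<dots> = B ^ d * real N powr \<eta>"
      using N assms(1) by (simp add: power_mult_distrib x_def powr_power \<epsilon>_def)
    finally have "real (R_star d m\<^sub>0) \<le> 1 + 3 ^ d * (B ^ d * real N powr \<eta>)" by simp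
    also have "\<dots> \<le> real N powr \<eta> + 3 ^ d * (B ^ d * real N powr \<eta>)"
      using N assms(2) by (simp add: ge_one_powr_ge_zero)
    finally show "real (R_star d m\<^sub>0) \<le> (1 + 3 ^ d * B ^ d) * real N powr \<eta>"
      by (simp add: algebra_simps)
  qed
qed

lemma num_shifts_bounds:
  assumes "1 < K" "2 < N" "1 \<le> R"
  shows "1 \<le> num_shifts K N R" "2 * K * real R * ln (real N) \<le> real (num_shifts K N R)"
    "real (num_shifts K N R) \<le> 2 * K * real R * ln (real N) + 1"
proof -
  have pos: "0 < 2 * K * real R * ln (real N)"
    using assms by (intro mult_pos_pos) auto
  then have "1 \<le> \<lceil>2 * K * real R * ln (real N)\<rceil>" by linarith
  then show "1 \<le> num_shifts K N R" unfolding num_shifts_def by linarith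
  have "real (num_shifts K N R) = of_int \<lceil>2 * K * real R * ln (real N)\<rceil>"
    using pos by (simp add: num_shifts_def)
  then show "2 * K * real R * ln (real N) \<le> real (num_shifts K N R)"
    "real (num_shifts K N R) \<le> 2 * K * real R * ln (real N) + 1"
    by linarith+
qed

text \<open>
  Near \<open>1/\<alpha>\<close> when \<open>\<tau>\<close> is small, and at most 2 for every \<open>\<tau>\<close>.
\<close>

definition rate_exponent :: "real \<Rightarrow> real \<Rightarrow> real" where
  "rate_exponent \<alpha> \<tau> = 1 / max (1 / 2) (\<alpha> - \<tau> / 2)"

context korobov
begin

lemma dyadic_level_le_ln:
  assumes "dyadic_level \<alpha> M m\<^sub>0" "0 < M" "M \<le> real N powr \<alpha>" "1 \<le> N"
  shows "real m\<^sub>0 \<le> 1 + 2 * ln (real N)"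
proof -
  have "M powr (1 / \<alpha>) \<le> (real N powr \<alpha>) powr (1 / \<alpha>)"
    using assms alpha_pos by (intro powr_mono2) auto
  also have "\<dots> = real N" using assms alpha_pos by (simp add: powr_powr)
  finally have "M powr (1 / \<alpha>) \<le> real N" .
  moreover have "2 ^ (m\<^sub>0 - 1) < M powr (1 / \<alpha>)" using assms(1) by (simp add: dyadic_level_def)
  ultimately have "2 ^ (m\<^sub>0 - 1) \<le> real N" by linarith
  then have "ln (2 ^ (m\<^sub>0 - 1)) \<le> ln (real N)"
    using assms(4) by (subst ln_le_cancel_iff) auto
  then have "real (m\<^sub>0 - 1) * ln 2 \<le> ln (real N)" by (simp add: ln_realpow)
  moreover have "real (m\<^sub>0 - 1) * (1 / 2) \<le> real (m\<^sub>0 - 1) * ln 2"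
    using ln2_ge_two_thirds by (intro mult_left_mono) auto
  moreover have "real (m\<^sub>0 - 1) = real m\<^sub>0 - 1" using assms(1) by (simp add: dyadic_level_def of_nat_diff)
  ultimately show ?thesis by linarith
qed

lemma random_setting_threshold:
  assumes "0 < \<delta>" "\<delta> < 1" "random_setting d \<alpha> \<gamma> \<delta> N M m\<^sub>0"
  defines "c \<equiv> (real N - 1) * (1 - \<delta>)"
  shows "M = threshold d \<alpha> \<gamma> c" "(1 - \<delta>) / 2 * real N \<le> c" "c \<le> real N" "0 < c"
proof -
  have N: "2 < N" using assms(3) by (simp add: random_setting_def)
  show "M = threshold d \<alpha> \<gamma> c"
    using assms(3) by (simp add: random_setting_def random_threshold_def c_def)
  have "(1 - \<delta>) * (real N / 2) \<le> (1 - \<delta>) * (real N - 1)"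
    using N assms(2) by (intro mult_left_mono) auto
  then show "(1 - \<delta>) / 2 * real N \<le> c" by (simp add: c_def mult_ac)
  have "(real N - 1) * (1 - \<delta>) \<le> real N * 1" using N assms(1,2) by (intro mult_mono) auto
  then show "c \<le> real N" by (simp add: c_def)
  show "0 < c" using N assms(2) by (simp add: c_def)
qed

lemma eventually_failure_bound_less_1:
  assumes "1 \<le> d" "0 < \<delta>" "\<delta> < 1" "1 < K"
  shows "\<exists>N\<^sub>0. \<forall>N\<ge>N\<^sub>0. \<forall>M m\<^sub>0. random_setting d \<alpha> \<gamma> \<delta> N M m\<^sub>0 \<longrightarrow>
        2 * real N powr (1 - K) * (real (R_star d m\<^sub>0))\<^sup>2 < 1"
proof -
  \<comment> \<open>The square of \<open>R\<^sub>*\<close> then costs \<open>N\<^bsup>(K-1)/2\<^esup>\<close>, half of what \<open>N\<^bsup>1-K\<^esup>\<close> gains.\<close>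
  define \<eta> where "\<eta> = (K - 1) / 4"
  have \<eta>: "0 < \<eta>" using assms(4) by (simp add: \<eta>_def)
  obtain C where C: "1 \<le> C" "\<And>N m\<^sub>0. 1 \<le> N \<Longrightarrow> real m\<^sub>0 \<le> 1 + 2 * ln (real N)
      \<Longrightarrow> real (R_star d m\<^sub>0) \<le> C * real N powr \<eta>"
    using R_star_le_powr[OF assms(1) \<eta>] by blast
  define N\<^sub>0 where "N\<^sub>0 = nat \<lceil>(2 * C\<^sup>2) powr (1 / (2 * \<eta>))\<rceil> + 1"
  have "2 * real N powr (1 - K) * (real (R_star d m\<^sub>0))\<^sup>2 < 1"
    if N: "N\<^sub>0 \<le> N" and rs: "random_setting d \<alpha> \<gamma> \<delta> N M m\<^sub>0" for N M m\<^sub>0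
  proof -
    note th = random_setting_threshold[OF assms(2,3) rs]
    have N2: "2 < N" and M1: "1 < M" and m0: "dyadic_level \<alpha> M m\<^sub>0"
      using rs by (auto simp: random_setting_def)
    have "M \<le> real N powr \<alpha>"
      using threshold_less[OF assms(1) th(4,3)] N2 M1 th(1) by simp
    then have "real m\<^sub>0 \<le> 1 + 2 * ln (real N)"
      using m0 M1 N2 by (intro dyadic_level_le_ln) auto
    then have "real (R_star d m\<^sub>0) \<le> C * real N powr \<eta>" using C(2) N2 by simp
    then have "(real (R_star d m\<^sub>0))\<^sup>2 \<le> (C * real N powr \<eta>)\<^sup>2" by (intro power_mono) auto
    then have "2 * real N powr (1 - K) * (real (R_star d m\<^sub>0))\<^sup>2
        \<le> 2 * real N powr (1 - K) * (C * real N powr \<eta>)\<^sup>2"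
      by (intro mult_left_mono) auto
    also have "\<dots> = 2 * C\<^sup>2 * (real N powr (1 - K) * (real N powr \<eta> * real N powr \<eta>))"
      by (simp add: power2_eq_square)
    also have "\<dots> = 2 * C\<^sup>2 * real N powr (- (2 * \<eta>))"
    proof -
      have "1 - K + (\<eta> + \<eta>) = - (2 * \<eta>)" by (simp add: \<eta>_def field_simps)
      then show ?thesis by (simp only: powr_add[symmetric])
    qed
    also have "\<dots> < 1"
    proof -
      have "(2 * C\<^sup>2) powr (1 / (2 * \<eta>)) < real N"
        using N unfolding N\<^sub>0_def by linarith
      then have "((2 * C\<^sup>2) powr (1 / (2 * \<eta>))) powr (2 * \<eta>) < real N powr (2 * \<eta>)"
        using \<eta> by (intro powr_less_mono2) auto
      then have "2 * C\<^sup>2 < real N powr (2 * \<eta>)"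
        using \<eta> C(1) by (simp add: powr_powr)
      then show ?thesis using N2 by (simp add: powr_minus field_simps)
    qed
    finally show ?thesis .
  qed
  then show ?thesis by blast
qed

lemma rate_exponent_bounds:
  assumes "0 < \<tau>"
  shows "rate_exponent \<alpha> \<tau> \<in> {1 / \<alpha><..2}" "1 / 2 - 1 / rate_exponent \<alpha> \<tau> \<le> 1 / 2 - \<alpha> + \<tau> / 2"
proof -
  define m where "m = max (1 / 2) (\<alpha> - \<tau> / 2)"
  have "m < \<alpha>" "1 / 2 \<le> m" "\<alpha> - \<tau> / 2 \<le> m" using smooth assms by (auto simp: m_def)
  moreover have "rate_exponent \<alpha> \<tau> = 1 / m" by (simp add: rate_exponent_def m_def)
  moreover have "1 / \<alpha> < 1 / m" using calculation by (intro divide_strict_left_mono) auto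
  moreover have "1 / m \<le> 1 / (1 / 2)" using calculation by (intro divide_left_mono) auto
  ultimately show "rate_exponent \<alpha> \<tau> \<in> {1 / \<alpha><..2}" "1 / 2 - 1 / rate_exponent \<alpha> \<tau> \<le> 1 / 2 - \<alpha> + \<tau> / 2"
    by auto
qed

lemma tail_le_powr:
  assumes "1 \<le> d" "0 < \<tau>" "0 < c\<^sub>0"
  defines "l \<equiv> rate_exponent \<alpha> \<tau>"
  obtains C where "0 < C"
    "\<And>N c. 1 \<le> N \<Longrightarrow> c\<^sub>0 * real N \<le> c
      \<Longrightarrow> sqrt (threshold d \<alpha> \<gamma> c powr (l - 2) * zeta_prod d \<alpha> \<gamma> l) \<le> C * real N powr (1 / 2 - \<alpha> + \<tau> / 2)"
proof -
  have l: "l \<in> {1 / \<alpha><..2}" and le: "1 / 2 - 1 / l \<le> 1 / 2 - \<alpha> + \<tau> / 2"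
    using rate_exponent_bounds[OF assms(2)] by (auto simp: l_def)
  note b = exponent_bounds[OF l]
  define Z where "Z = zeta_prod d \<alpha> \<gamma> l"
  have Z: "1 \<le> Z" using zeta_prod_ge_1[OF l] by (simp add: Z_def)
  have ex: "1 / l * ((l - 2) / 2) = 1 / 2 - 1 / l" using b by (simp add: field_simps)
  define C where "C = (c\<^sub>0 / Z) powr (1 / 2 - 1 / l) * sqrt Z"
  show thesis
  proof (rule that[of C])
    show "0 < C" using Z assms(3) by (simp add: C_def)
    fix N c assume N: "1 \<le> (N::nat)" and c: "c\<^sub>0 * real N \<le> c"
    have "0 < c\<^sub>0 * real N" using N assms(3) by simp
    then have c0: "0 < c" using c by linarith
    let ?M = "threshold d \<alpha> \<gamma> c"
    have "(c\<^sub>0 / Z * real N) powr (1 / l) \<le> (c / Z) powr (1 / l)"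
      using c Z assms(3) b by (intro powr_mono2) (auto simp: divide_right_mono)
    also have "\<dots> \<le> ?M" using threshold_attained(2)[OF assms(1) c0 l] by (simp add: Z_def)
    finally have M: "(c\<^sub>0 / Z * real N) powr (1 / l) \<le> ?M" .
    have base: "0 < c\<^sub>0 / Z * real N" using assms(3) Z N by simp
    have "0 < (c\<^sub>0 / Z * real N) powr (1 / l)" using base by (subst powr_gt_zero) linarith
    then have M0: "0 < ?M" using M by linarith
    have "sqrt (?M powr (l - 2) * Z) = ?M powr ((l - 2) / 2) * sqrt Z"
      using M0 by (simp add: real_sqrt_mult powr_half_sqrt[symmetric] powr_powr)
    also have "\<dots> \<le> ((c\<^sub>0 / Z * real N) powr (1 / l)) powr ((l - 2) / 2) * sqrt Z"
      using M base b Z N by (intro mult_right_mono powr_mono2') auto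
    also have "((c\<^sub>0 / Z * real N) powr (1 / l)) powr ((l - 2) / 2)
        = (c\<^sub>0 / Z) powr (1 / 2 - 1 / l) * real N powr (1 / 2 - 1 / l)"
      unfolding powr_powr ex by (rule powr_mult)
    also have "\<dots> * sqrt Z = C * real N powr (1 / 2 - 1 / l)" by (simp add: C_def)
    also have "\<dots> \<le> C * real N powr (1 / 2 - \<alpha> + \<tau> / 2)"
      using le N \<open>0 < C\<close> by (intro mult_left_mono powr_mono) auto
    finally show "sqrt (?M powr (l - 2) * zeta_prod d \<alpha> \<gamma> l) \<le> C * real N powr (1 / 2 - \<alpha> + \<tau> / 2)"
      by (simp add: Z_def)
  qed
qed

text \<open>
  For \<open>e \<ge> -\<alpha>\<close> one has \<open>(N R S)\<^sup>e \<ge> N\<^sup>e (R S)\<^sup>-\<^sup>\<alpha>\<close>. So the left-hand side is what is lost when the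
  number of function values is replaced by \<open>N\<close>, together with the factor \<open>1 + R\<close> of the error
  bound; it is polylogarithmic.
\<close>

lemma sampling_cost_le_powr:
  assumes "1 \<le> d" "1 < K" "0 < \<tau>"
  obtains C where "0 < C"
    "\<And>N m\<^sub>0 R. 2 < N \<Longrightarrow> real m\<^sub>0 \<le> 1 + 2 * ln (real N) \<Longrightarrow> 1 \<le> R \<Longrightarrow> R \<le> R_star d m\<^sub>0
      \<Longrightarrow> (1 + real R) * real (R * num_shifts K N R) powr \<alpha> \<le> C * real N powr (\<tau> / 2)"
proof -
  \<comment> \<open>With \<open>R = O(N\<^sup>\<eta>)\<close> and \<open>S = O(N\<^bsup>2\<eta>\<^esup>)\<close> the left-hand side is of order \<open>N\<^bsup>\<eta>+3\<eta>\<alpha>\<^esup>\<close>.\<close>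
  define \<eta> where "\<eta> = \<tau> / (2 * (1 + 3 * \<alpha>))"
  have \<eta>: "0 < \<eta>" using assms(3) alpha_pos by (simp add: \<eta>_def)
  have \<eta>2: "\<eta> + 3 * \<eta> * \<alpha> = \<tau> / 2"
  proof -
    define q where "q = 1 + 3 * \<alpha>"
    have "\<eta> * q = \<tau> / 2" using alpha_pos by (simp add: \<eta>_def flip: q_def) (simp add: q_def)
    then show ?thesis by (simp add: q_def algebra_simps)
  qed
  obtain C where C: "1 \<le> C" "\<And>N m\<^sub>0. 1 \<le> N \<Longrightarrow> real m\<^sub>0 \<le> 1 + 2 * ln (real N)
      \<Longrightarrow> real (R_star d m\<^sub>0) \<le> C * real N powr \<eta>"
    using R_star_le_powr[OF assms(1) \<eta>] by blast
  define B where "B = C * (C * (2 * K / \<eta> + 1))"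
  have B: "0 < B" using C(1) assms(2) \<eta> by (simp add: B_def add_pos_pos)
  show thesis
  proof (rule that[of "2 * C * B powr \<alpha>"])
    show "0 < 2 * C * B powr \<alpha>" using C(1) B by simp
    fix N m\<^sub>0 R :: nat
    assume N: "2 < N" and m: "real m\<^sub>0 \<le> 1 + 2 * ln (real N)" and R: "1 \<le> R" "R \<le> R_star d m\<^sub>0"
    define x where "x = real N powr \<eta>"
    have x: "1 \<le> x" using N \<eta> by (simp add: x_def ge_one_powr_ge_zero)
    have Rx: "real R \<le> C * x" using C(2)[of N m\<^sub>0] N m R by (simp add: x_def)
    have ln: "ln (real N) \<le> x / \<eta>" using ln_powr_bound[of "real N" \<eta>] N \<eta> by (simp add: x_def)
    have "real (num_shifts K N R) \<le> 2 * K * real R * ln (real N) + 1"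
      using num_shifts_bounds(3)[OF assms(2) N R(1)] .
    also have "\<dots> \<le> 2 * K * (C * x) * (x / \<eta>) + C * x * x"
    proof (intro add_mono mult_mono)
      have "1 * 1 \<le> C * x" using C(1) x by (intro mult_mono) auto
      then have "1 * 1 \<le> (C * x) * x" using x by (intro mult_mono) auto
      then show "1 \<le> C * x * x" by simp
    qed (use Rx ln assms(2) N C(1) x in auto)
    also have "\<dots> = C * (2 * K / \<eta> + 1) * (x * x)" by (simp add: algebra_simps)
    finally have S: "real (num_shifts K N R) \<le> C * (2 * K / \<eta> + 1) * (x * x)" .
    have "real (R * num_shifts K N R) \<le> (C * x) * (C * (2 * K / \<eta> + 1) * (x * x))"
      unfolding of_nat_mult using Rx S C(1) x by (intro mult_mono) auto
    also have "\<dots> = B * real N powr (3 * \<eta>)"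
      by (simp add: B_def x_def powr_add[symmetric])
    finally have "real (R * num_shifts K N R) powr \<alpha> \<le> (B * real N powr (3 * \<eta>)) powr \<alpha>"
      using alpha_pos by (intro powr_mono2) auto
    also have "\<dots> = B powr \<alpha> * real N powr (3 * \<eta> * \<alpha>)"
      using B by (simp add: powr_mult powr_powr)
    finally have RS: "real (R * num_shifts K N R) powr \<alpha> \<le> B powr \<alpha> * real N powr (3 * \<eta> * \<alpha>)" .
    have "1 + real R \<le> 2 * (C * x)" using Rx R(1) by simp
    then have "(1 + real R) * real (R * num_shifts K N R) powr \<alpha>
        \<le> 2 * (C * x) * (B powr \<alpha> * real N powr (3 * \<eta> * \<alpha>))"
      using RS C(1) x by (intro mult_mono) auto
    also have "\<dots> = 2 * C * B powr \<alpha> * (real N powr \<eta> * real N powr (3 * \<eta> * \<alpha>))"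
      by (simp add: x_def mult_ac)
    also have "real N powr \<eta> * real N powr (3 * \<eta> * \<alpha>) = real N powr (\<tau> / 2)"
      by (simp only: powr_add[symmetric] \<eta>2)
    finally show "(1 + real R) * real (R * num_shifts K N R) powr \<alpha> \<le> 2 * C * B powr \<alpha> * real N powr (\<tau> / 2)" .
  qed
qed

text \<open>
  The parameter \<open>c\<close> of the threshold ranges over all values comparable with \<open>N\<close>, so that one
  constant serves both the random choice and the component-by-component choice of \<open>g\<close>.
\<close>

lemma worst_case_error_rate:
  assumes "1 \<le> d" "1 < K" "0 < \<tau>" "0 < c\<^sub>0"
  shows "\<exists>C. \<forall>N c m\<^sub>0 g L R S y. 2 < N \<longrightarrow> c\<^sub>0 * real N \<le> c \<longrightarrow> c \<le> real N \<longrightarrow>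
      1 < threshold d \<alpha> \<gamma> c \<longrightarrow> dyadic_level \<alpha> (threshold d \<alpha> \<gamma> c) m\<^sub>0 \<longrightarrow>
      fiber_enumeration d \<alpha> \<gamma> N (threshold d \<alpha> \<gamma> c) g L \<longrightarrow>
      R = max_fiber d \<alpha> \<gamma> N (threshold d \<alpha> \<gamma> c) g \<longrightarrow> R \<le> R_star d m\<^sub>0 \<longrightarrow>
      S = num_shifts K N R \<longrightarrow> good_shifts d S y L \<longrightarrow>
      worst_case_error (lattice_algorithm d \<alpha> \<gamma> N (threshold d \<alpha> \<gamma> c) g L S y) d \<alpha> \<gamma>
        \<le> ereal (C * real (N * R * S) powr (- \<alpha> + 1 / 2 + \<tau>))"
proof -
  define l where "l = rate_exponent \<alpha> \<tau>"
  have l: "l \<in> {1 / \<alpha><..2}" using rate_exponent_bounds(1)[OF assms(3)] by (simp add: l_def)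
  obtain C1 where C1: "0 < C1" "\<And>N c. 1 \<le> N \<Longrightarrow> c\<^sub>0 * real N \<le> c
      \<Longrightarrow> sqrt (threshold d \<alpha> \<gamma> c powr (l - 2) * zeta_prod d \<alpha> \<gamma> l) \<le> C1 * real N powr (1 / 2 - \<alpha> + \<tau> / 2)"
    using tail_le_powr[OF assms(1,3,4)] unfolding l_def by blast
  obtain C2 where C2: "0 < C2" "\<And>N m\<^sub>0 R. 2 < N \<Longrightarrow> real m\<^sub>0 \<le> 1 + 2 * ln (real N) \<Longrightarrow> 1 \<le> R \<Longrightarrow> R \<le> R_star d m\<^sub>0
      \<Longrightarrow> (1 + real R) * real (R * num_shifts K N R) powr \<alpha> \<le> C2 * real N powr (\<tau> / 2)"
    using sampling_cost_le_powr[OF assms(1-3)] by blast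
  define e where "e = - \<alpha> + 1 / 2 + \<tau>"
  have "worst_case_error (lattice_algorithm d \<alpha> \<gamma> N M g L S y) d \<alpha> \<gamma>
        \<le> ereal (C1 * C2 * real (N * R * S) powr e)"
    if N: "2 < N" and c: "c\<^sub>0 * real N \<le> c" "c \<le> real N"
      and M: "M = threshold d \<alpha> \<gamma> c" "1 < M" "dyadic_level \<alpha> M m\<^sub>0"
      and L: "fiber_enumeration d \<alpha> \<gamma> N M g L"
      and R: "R = max_fiber d \<alpha> \<gamma> N M g" "R \<le> R_star d m\<^sub>0"
      and S: "S = num_shifts K N R" "good_shifts d S y L" for N c m\<^sub>0 g L R S y M
  proof -
    have "0 < c\<^sub>0 * real N" using N assms(4) by simp
    then have c0: "0 < c" using c(1) by linarith
    have R1: "1 \<le> R" using max_fiber_pos[OF M(2)] R(1) by simp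
    have S1: "1 \<le> S" using num_shifts_bounds(1)[OF assms(2) N R1] S(1) by simp
    have "M \<le> real N powr \<alpha>" using threshold_less[OF assms(1) c0 c(2)] N M by simp
    then have m: "real m\<^sub>0 \<le> 1 + 2 * ln (real N)"
      using M N by (intro dyadic_level_le_ln) auto
    have cost: "(1 + real R) * real (R * S) powr \<alpha> \<le> C2 * real N powr (\<tau> / 2)"
      using C2(2)[OF N m R1 R(2)] S(1) by simp
    have RS1: "1 \<le> real (R * S)"
      using R1 S1 by (metis One_nat_def Suc_leI le_eq_less_or_eq mult_is_0 not_less_eq_eq of_nat_1 of_nat_mono neq0_conv)
    have tail: "sqrt (M powr (l - 2) * zeta_prod d \<alpha> \<gamma> l) \<le> C1 * real N powr (1 / 2 - \<alpha> + \<tau> / 2)"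
      using C1(2)[of N c] N c(1) M(1) by simp
    have "(1 + real R) = ((1 + real R) * real (R * S) powr \<alpha>) * real (R * S) powr (- \<alpha>)"
      using R1 S1 by (simp add: powr_minus)
    also have "\<dots> \<le> (C2 * real N powr (\<tau> / 2)) * real (R * S) powr (- \<alpha>)"
      using cost by (intro mult_right_mono) auto
    also have "\<dots> \<le> (C2 * real N powr (\<tau> / 2)) * real (R * S) powr e"
      using RS1 C2(1) assms(3) by (intro mult_left_mono powr_mono) (auto simp: e_def)
    finally have R_le: "1 + real R \<le> C2 * real N powr (\<tau> / 2) * real (R * S) powr e" .
    have "(1 + real R) * sqrt (M powr (l - 2) * zeta_prod d \<alpha> \<gamma> l)
        \<le> (C2 * real N powr (\<tau> / 2) * real (R * S) powr e) * (C1 * real N powr (1 / 2 - \<alpha> + \<tau> / 2))"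
      using R_le tail C2(1) zeta_prod_ge_1[OF l] by (intro mult_mono) auto
    also have "\<dots> = C1 * C2 * (real N powr (\<tau> / 2) * real N powr (1 / 2 - \<alpha> + \<tau> / 2) * real (R * S) powr e)"
      by (simp only: mult_ac)
    also have "real N powr (\<tau> / 2) * real N powr (1 / 2 - \<alpha> + \<tau> / 2) = real N powr e"
    proof -
      have "\<tau> / 2 + (1 / 2 - \<alpha> + \<tau> / 2) = e" by (simp add: e_def)
      then show ?thesis by (simp only: powr_add[symmetric])
    qed
    also have "real N powr e * real (R * S) powr e = real (N * R * S) powr e"
      by (simp add: powr_mult[symmetric] mult.assoc)
    finally have le: "(1 + real R) * sqrt (M powr (l - 2) * zeta_prod d \<alpha> \<gamma> l)
        \<le> C1 * C2 * real (N * R * S) powr e" .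
    have "worst_case_error (lattice_algorithm d \<alpha> \<gamma> N M g L S y) d \<alpha> \<gamma>
        \<le> ereal ((1 + real R) * sqrt (M powr (l - 2) * zeta_prod d \<alpha> \<gamma> l))"
      using worst_case_error_le[OF _ _ L S(2) l] N S1 M R(1) by simp
    then show ?thesis using le by (meson ereal_less_eq(3) order_trans)
  qed
  then show ?thesis unfolding e_def by blast
qed

end

section \<open>The component-by-component construction\<close>

lemma powr_superadditive:
  fixes a b q :: real
  assumes "0 \<le> a" "0 \<le> b" "1 \<le> q"
  shows "a powr q + b powr q \<le> (a + b) powr q"
proof -
  have part: "x powr q \<le> x * (a + b) powr (q - 1)" if "0 \<le> x" "x \<le> a + b" for x
  proof (cases "x = 0")
    case False
    then have "x powr q = x * x powr (q - 1)"
      using that(1) by (simp add: powr_diff)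
    also have "\<dots> \<le> x * (a + b) powr (q - 1)"
      using that assms(3) by (intro mult_left_mono powr_mono2) auto
    finally show ?thesis .
  qed simp
  have "a powr q + b powr q \<le> a * (a + b) powr (q - 1) + b * (a + b) powr (q - 1)"
    using assms by (intro add_mono part) auto
  also have "\<dots> = (a + b) * (a + b) powr (q - 1)" by (simp only: distrib_right)
  also have "\<dots> = (a + b) powr q"
  proof (cases "a + b = 0")
    case False
    have "0 \<le> a + b" using assms by simp
    then show ?thesis using False by (simp add: powr_diff)
  qed (use assms in auto)
  finally show ?thesis .
qed

lemma zeta_prod_Suc:
  "zeta_prod (Suc s) \<alpha> \<gamma> l = zeta_prod s \<alpha> \<gamma> l * (1 + 2 * \<gamma> s powr l * zeta (\<alpha> * l))"
  by (simp add: zeta_prod_def)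

lemma dot_upd_Suc: "dot (Suc s) (g(s := h)) k = dot s g k + h * k s"
  by (simp add: dot_def)

lemma fun_upd_in_int_vecs_Suc: "k \<in> int_vecs s \<Longrightarrow> k(s := t) \<in> int_vecs (Suc s)"
  by (auto simp: int_vecs_def PiE_iff extensional_def)

lemma restrict_in_int_vecs: "restrict k {..<s} \<in> int_vecs s"
  by (simp add: int_vecs_def)

lemma restrict_upd_eq: "k \<in> int_vecs (Suc s) \<Longrightarrow> (restrict k {..<s})(s := k s) = k"
  by (rule ext) (auto simp: int_vecs_def PiE_iff extensional_def)

lemma dot_cong: "(\<And>j. j < d \<Longrightarrow> x j = x' j) \<Longrightarrow> (\<And>j. j < d \<Longrightarrow> y j = y' j) \<Longrightarrow> dot d x y = dot d x' y'"
  by (simp add: dot_def)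

context korobov
begin

lemma korobov_weight_cong:
  "(\<And>j. j < d \<Longrightarrow> k j = k' j) \<Longrightarrow> korobov_weight d \<alpha> \<gamma> k = korobov_weight d \<alpha> \<gamma> k'"
  unfolding korobov_weight_eq by (intro prod.cong refl) auto

lemma summable_korobov_weight_powr:
  assumes "l \<in> {1 / \<alpha><..2}" "D \<subseteq> int_vecs d"
  shows "(\<lambda>k. korobov_weight d \<alpha> \<gamma> k powr (- l)) summable_on D"
proof (rule nonneg_bounded_partial_sums_imp_summable_on)
  show "\<forall>\<^sub>F F in finite_subsets_at_top D. (\<Sum>k\<in>F. korobov_weight d \<alpha> \<gamma> k powr (- l)) \<le> zeta_prod d \<alpha> \<gamma> l"
    using sum_korobov_weight_powr_le[OF assms(1)] assms(2)
    by (intro eventually_finite_subsets_at_top_weakI) auto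
qed simp

lemma inverse_square_eq_powr: "1 / (korobov_weight d \<alpha> \<gamma> k)\<^sup>2 = korobov_weight d \<alpha> \<gamma> k powr (- 2)"
  using korobov_weight_pos[of k] by (simp add: powr_minus powr_numeral inverse_eq_divide)

lemma two_in_exponents: "2 \<in> {1 / \<alpha><..2}"
  using smooth alpha_pos by (simp add: field_simps)

text \<open>
  The inequality \<open>\<Sum> x\<^sub>k \<le> (\<Sum> x\<^sub>k\<^sup>p)\<close> to the power \<open>1/p\<close>, with \<open>p = l/2 \<le> 1\<close>: every single term
  \<open>r\<^sup>-\<^sup>l\<close> is at most the whole sum \<open>T\<close>, so that
  \<open>r\<^sup>-\<^sup>2 = (r\<^sup>-\<^sup>l)\<^bsup>(2-l)/l\<^esup> r\<^sup>-\<^sup>l \<le> T\<^bsup>(2-l)/l\<^esup> r\<^sup>-\<^sup>l\<close>.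
\<close>

lemma infsum_inverse_square_le:
  assumes l: "l \<in> {1 / \<alpha><..2}" and D: "D \<subseteq> int_vecs d"
  shows "(\<Sum>\<^sub>\<infinity>k\<in>D. korobov_weight d \<alpha> \<gamma> k powr (- 2))
    \<le> (\<Sum>\<^sub>\<infinity>k\<in>D. korobov_weight d \<alpha> \<gamma> k powr (- l)) powr (2 / l)"
proof (rule infsum_le_finite_sums)
  let ?r = "korobov_weight d \<alpha> \<gamma>"
  define T where "T = (\<Sum>\<^sub>\<infinity>k\<in>D. ?r k powr (- l))"
  note b = exponent_bounds[OF l]
  note summ = summable_korobov_weight_powr[OF l D]
  show "(\<lambda>k. ?r k powr (- 2)) summable_on D"
    by (rule summable_korobov_weight_powr[OF two_in_exponents D])
  fix F assume F: "finite F" "F \<subseteq> D"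
  have T0: "0 \<le> T" unfolding T_def by (rule infsum_nonneg) simp
  have single: "?r k powr (- l) \<le> T" if "k \<in> F" for k
    using finite_sum_le_infsum[OF summ, of "{k}"] subsetD[OF F(2) that] by (simp add: T_def)
  have "(\<Sum>k\<in>F. ?r k powr (- 2)) \<le> (\<Sum>k\<in>F. T powr ((2 - l) / l) * ?r k powr (- l))"
  proof (intro sum_mono)
    fix k assume k: "k \<in> F"
    have e: "- l * ((2 - l) / l) + - l = - 2" using b by (simp add: field_simps)
    have "?r k powr (- 2) = (?r k powr (- l)) powr ((2 - l) / l) * ?r k powr (- l)"
      unfolding powr_powr powr_add[symmetric] e ..
    also have "\<dots> \<le> T powr ((2 - l) / l) * ?r k powr (- l)"
      using single[OF k] b by (intro mult_right_mono powr_mono2) auto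
    finally show "?r k powr (- 2) \<le> T powr ((2 - l) / l) * ?r k powr (- l)" .
  qed
  also have "\<dots> = T powr ((2 - l) / l) * (\<Sum>k\<in>F. ?r k powr (- l))" by (simp only: sum_distrib_left)
  also have "\<dots> \<le> T powr ((2 - l) / l) * T"
    using finite_sum_le_infsum[OF summ F] by (intro mult_left_mono) (auto simp: T_def)
  also have "\<dots> = T powr (2 / l)"
  proof (cases "T = 0")
    case False
    then have "T powr ((2 - l) / l) * T = T powr ((2 - l) / l) * T powr 1" using T0 by simp
    also have "\<dots> = T powr (2 / l)" unfolding powr_add[symmetric] using b by (simp add: field_simps)
    finally show ?thesis .
  qed simp
  finally show "(\<Sum>k\<in>F. ?r k powr (- 2)) \<le> (\<Sum>\<^sub>\<infinity>k\<in>D. ?r k powr (- l)) powr (2 / l)"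
    by (simp add: T_def)
qed

end

text \<open>
  One step of the construction: the components \<open>g\<^sub>0, \<dots>, g\<^bsub>s-1\<^esub>\<close> are given and a candidate \<open>h\<close>
  for \<open>g\<^sub>s\<close> is appended. Only dual vectors with a nonzero last entry depend on \<open>h\<close>.
\<close>

locale korobov_step = korobov "Suc s" \<alpha> \<gamma> for s \<alpha> \<gamma> +
  fixes N :: nat and g :: "nat \<Rightarrow> int" and l :: real
  assumes prime: "prime N" and l: "l \<in> {1 / \<alpha><..2}"
begin

sublocale prev: korobov s \<alpha> \<gamma>
  by unfold_locales (use smooth gamma in auto)

definition new_terms :: "(nat \<Rightarrow> int) set" where
  "new_terms = {k \<in> int_vecs (Suc s). k s \<noteq> 0}"

definition new_dual :: "int \<Rightarrow> (nat \<Rightarrow> int) set" where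
  "new_dual h = {k \<in> new_terms. int N dvd dot s g k + h * k s}"

abbreviation w :: "(nat \<Rightarrow> int) \<Rightarrow> real" where
  "w k \<equiv> korobov_weight (Suc s) \<alpha> \<gamma> k powr (- l)"

lemma w_eq:
  assumes "k s \<noteq> 0"
  shows "w k = korobov_weight s \<alpha> \<gamma> (restrict k {..<s}) powr (- l) * (\<gamma> s powr l * (1 / \<bar>real_of_int (k s)\<bar> powr (\<alpha> * l)))"
proof -
  have "korobov_weight s \<alpha> \<gamma> (restrict k {..<s}) = korobov_weight s \<alpha> \<gamma> k"
    by (rule prev.korobov_weight_cong) simp
  then show ?thesis
    using assms by (simp only: korobov_weight_powr prev.korobov_weight_powr prod.lessThan_Suc if_False)
qed

lemma sum_new_terms_le:
  assumes F: "finite F" "F \<subseteq> new_terms"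
  shows "(\<Sum>k\<in>F. w k) \<le> 2 * \<gamma> s powr l * zeta (\<alpha> * l) * zeta_prod s \<alpha> \<gamma> l"
proof -
  let ?p = "\<lambda>k. (restrict k {..<s}, k s)"
  let ?u = "\<lambda>k'. korobov_weight s \<alpha> \<gamma> k' powr (- l)" and ?v = "\<lambda>t::int. \<gamma> s powr l * (1 / \<bar>real_of_int t\<bar> powr (\<alpha> * l))"
  let ?A = "(\<lambda>k. restrict k {..<s}) ` F" and ?B = "(\<lambda>k. k s) ` F - {0}"
  have inj: "inj_on ?p F"
  proof (rule inj_onI)
    fix k k' assume "k \<in> F" "k' \<in> F" "?p k = ?p k'"
    then show "k = k'"
      using F(2) restrict_upd_eq[of k s] restrict_upd_eq[of k' s] by (auto simp: new_terms_def)
  qed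
  have "(\<Sum>k\<in>F. w k) = (\<Sum>k\<in>F. (\<lambda>(a, t). ?u a * ?v t) (?p k))"
    using F(2) by (intro sum.cong refl) (auto simp: new_terms_def w_eq)
  also have "\<dots> = (\<Sum>z\<in>?p ` F. (\<lambda>(a, t). ?u a * ?v t) z)"
    using inj by (simp add: sum.reindex)
  also have "\<dots> \<le> (\<Sum>z\<in>?A \<times> ?B. (\<lambda>(a, t). ?u a * ?v t) z)"
    using F by (intro sum_mono2) (auto simp: new_terms_def)
  also have "\<dots> = (\<Sum>a\<in>?A. ?u a) * (\<Sum>t\<in>?B. ?v t)"
    by (simp only: sum_product sum.cartesian_product)
  also have "\<dots> \<le> zeta_prod s \<alpha> \<gamma> l * (\<gamma> s powr l * (2 * zeta (\<alpha> * l)))"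
  proof (intro mult_mono)
    show "(\<Sum>a\<in>?A. ?u a) \<le> zeta_prod s \<alpha> \<gamma> l"
      using F restrict_in_int_vecs by (intro prev.sum_korobov_weight_powr_le[OF l]) auto
    have "(\<Sum>t\<in>?B. ?v t) = \<gamma> s powr l * (\<Sum>t\<in>?B. 1 / \<bar>real_of_int t\<bar> powr (\<alpha> * l))"
      by (simp only: sum_distrib_left)
    also have "\<dots> \<le> \<gamma> s powr l * (2 * zeta (\<alpha> * l))"
      using F exponent_bounds(1)[OF l] by (intro mult_left_mono sum_abs_powr_le) auto
    finally show "(\<Sum>t\<in>?B. ?v t) \<le> \<gamma> s powr l * (2 * zeta (\<alpha> * l))" .
    show "0 \<le> zeta_prod s \<alpha> \<gamma> l" using prev.zeta_prod_ge_1[OF l] by simp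
    show "0 \<le> (\<Sum>t\<in>?B. ?v t)" by (intro sum_nonneg) simp
  qed
  finally show ?thesis by (simp add: mult_ac)
qed

lemma w_pos: "0 < w k"
  using korobov_weight_pos[of k] by simp

text \<open>
  With \<open>k'\<close> the initial part of \<open>k\<close>, the congruence \<open>g \<cdot> k' + h k\<^sub>s \<equiv> 0\<close> determines \<open>h\<close> if \<open>k\<^sub>s\<close> is invertible modulo \<open>N\<close>, and
  then \<open>h \<noteq> 0\<close> rules out that \<open>k'\<close> is itself dual. If \<open>N\<close> divides \<open>k\<^sub>s\<close>, the congruence does not
  involve \<open>h\<close>.
\<close>

lemma card_new_dual_le:
  assumes k: "k \<in> new_terms"
  defines "c \<equiv> card {h \<in> {1..int N - 1}. k \<in> new_dual h}"
  shows "\<not> int N dvd k s \<Longrightarrow> \<not> int N dvd dot s g k \<Longrightarrow> c \<le> 1"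
    and "\<not> int N dvd k s \<Longrightarrow> int N dvd dot s g k \<Longrightarrow> c = 0"
    and "int N dvd k s \<Longrightarrow> \<not> int N dvd dot s g k \<Longrightarrow> c = 0"
    and "c \<le> N - 1"
proof -
  let ?H = "{h \<in> {1..int N - 1}. k \<in> new_dual h}"
  have fin: "finite ?H" by (rule finite_subset[of _ "{1..int N - 1}"]) auto
  have H: "?H = {h \<in> {1..int N - 1}. int N dvd dot s g k + h * k s}"
    using k by (auto simp: new_dual_def)
  have pr: "Factorial_Ring.prime (int N)" using prime by simp
  show "c \<le> N - 1"
    unfolding c_def using card_mono[of "{1..int N - 1}" ?H] by fastforce
  {
    assume n: "\<not> int N dvd k s"
    have uniq: "h = h'" if "h \<in> ?H" "h' \<in> ?H" for h h'
    proof -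
      have "int N dvd (dot s g k + h * k s) - (dot s g k + h' * k s)"
        using that unfolding H by (intro dvd_diff) auto
      then have "int N dvd (h - h') * k s" by (simp add: algebra_simps)
      then have "int N dvd h - h'" using n pr by (simp add: prime_dvd_mult_iff)
      then show ?thesis using that eq_of_dvd_diff by blast
    qed
    show "c \<le> 1"
    proof (cases "?H = {}")
      case False
      then obtain h where "h \<in> ?H" by blast
      then have "?H \<subseteq> {h}" using uniq by blast
      then show ?thesis unfolding c_def using card_mono[of "{h}" ?H] by simp
    next
      case True
      then show ?thesis unfolding c_def by (simp only: card.empty)
    qed
  }
  {
    assume n: "\<not> int N dvd k s" and d: "int N dvd dot s g k"
    have "h \<notin> ?H" for h
    proof
      assume h: "h \<in> ?H"
      then have "int N dvd h * k s" using d unfolding H by (simp add: dvd_add_right_iff)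
      then have "int N dvd h" using n pr by (simp add: prime_dvd_mult_iff)
      moreover have "0 < h" "h < int N" using h by auto
      ultimately show False by (simp add: zdvd_not_zless)
    qed
    then have "?H = {}" by blast
    then show "c = 0" unfolding c_def by (simp only: card.empty)
  }
  {
    assume n: "int N dvd k s" and d: "\<not> int N dvd dot s g k"
    have "h \<notin> ?H" for h
      using n d unfolding H by (auto simp: dvd_add_left_iff)
    then have "?H = {}" by blast
    then show "c = 0" unfolding c_def by (simp only: card.empty)
  }
qed

lemma summable_w: "w summable_on D" if "D \<subseteq> int_vecs (Suc s)"
  by (rule summable_korobov_weight_powr[OF l that])

text \<open>
  Exchanging the sums, every \<open>k\<close> is counted with the number of \<open>h\<close> for which it is dual. If \<open>N\<close>
  does not divide \<open>k\<^sub>s\<close> this number is at most 1, and it is 0 when the initial part of \<open>k\<close> is dual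
  (\<open>F1\<close> collects the rest). If \<open>N\<close> divides \<open>k\<^sub>s\<close> it may be \<open>N - 1\<close>, but only when the initial part
  is dual (\<open>F2\<close>). Dividing the last entry of these by \<open>N\<close> multiplies their terms by
  \<open>N\<^bsup>\<alpha>l\<^esup> \<ge> N - 1\<close> and lands in the part that \<open>F1\<close> leaves out. So the total is at most a
  sum in which every frequency occurs once.
\<close>

lemma sum_new_dual_le:
  "(\<Sum>h\<in>{1..int N - 1}. \<Sum>\<^sub>\<infinity>k\<in>new_dual h. w k) \<le> 2 * \<gamma> s powr l * zeta (\<alpha> * l) * zeta_prod s \<alpha> \<gamma> l"
proof -
  let ?H = "{1..int N - 1}"
  have N: "1 < N" using prime prime_gt_1_nat by blast
  have sub: "new_dual h \<subseteq> new_terms" "new_terms \<subseteq> int_vecs (Suc s)" for h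
    by (auto simp: new_dual_def new_terms_def)
  have "((\<lambda>k. if k \<in> new_dual h then w k else 0) has_sum (\<Sum>\<^sub>\<infinity>k\<in>new_dual h. w k)) new_terms" for h
  proof -
    have "(w has_sum (\<Sum>\<^sub>\<infinity>k\<in>new_dual h. w k)) (new_dual h)"
      using sub by (intro has_sum_infsum summable_w) blast
    then show ?thesis
      using sub(1)[of h] by (subst has_sum_cong_neutral[where T = "new_dual h" and g = w]) auto
  qed
  then have hs: "((\<lambda>k. \<Sum>h\<in>?H. if k \<in> new_dual h then w k else 0) has_sum
      (\<Sum>h\<in>?H. \<Sum>\<^sub>\<infinity>k\<in>new_dual h. w k)) new_terms"
    by (intro has_sum_finite_sum) auto
  have "(\<Sum>k\<in>F. \<Sum>h\<in>?H. if k \<in> new_dual h then w k else 0)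
      \<le> 2 * \<gamma> s powr l * zeta (\<alpha> * l) * zeta_prod s \<alpha> \<gamma> l"
    if F: "finite F" "F \<subseteq> new_terms" for F
  proof -
    define F1 where "F1 = {k \<in> F. \<not> int N dvd k s \<and> \<not> int N dvd dot s g k}"
    define F2 where "F2 = {k \<in> F. int N dvd k s \<and> int N dvd dot s g k}"
    define shrink :: "(nat \<Rightarrow> int) \<Rightarrow> nat \<Rightarrow> int" where "shrink k = k(s := k s div int N)" for k
    have fin: "finite F1" "finite F2" using F by (auto simp: F1_def F2_def)
    have shrink_dot: "dot s g (shrink k) = dot s g k" for k
      by (rule dot_cong) (auto simp: shrink_def)
    have shrink_w: "real (N - 1) * w k \<le> w (shrink k)" and shrink_new: "shrink k \<in> new_terms"
      if k: "k \<in> F2" for k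
    proof -
      have ks: "k s = int N * (k s div int N)" "k s \<noteq> 0" "k \<in> int_vecs (Suc s)"
        using k F by (auto simp: F2_def new_terms_def)
      then have nz: "k s div int N \<noteq> 0" by auto
      have "restrict (shrink k) {..<s} = restrict k {..<s}" by (auto simp: shrink_def)
      define B where "B = korobov_weight s \<alpha> \<gamma> (restrict k {..<s}) powr (- l) * \<gamma> s powr l"
      have "w (shrink k) = B * (1 / \<bar>real_of_int (k s div int N)\<bar> powr (\<alpha> * l))"
        using nz \<open>restrict (shrink k) {..<s} = restrict k {..<s}\<close>
        by (subst w_eq) (auto simp: shrink_def B_def)
      moreover have "w k = B * (1 / (real N powr (\<alpha> * l) * \<bar>real_of_int (k s div int N)\<bar> powr (\<alpha> * l)))"
      proof -
        have "\<bar>real_of_int (k s)\<bar> = real N * \<bar>real_of_int (k s div int N)\<bar>"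
          by (subst ks(1)) (simp add: abs_mult)
        then have "\<bar>real_of_int (k s)\<bar> powr (\<alpha> * l) = real N powr (\<alpha> * l) * \<bar>real_of_int (k s div int N)\<bar> powr (\<alpha> * l)"
          by (simp add: powr_mult)
        then show ?thesis using ks(2) by (simp add: w_eq B_def)
      qed
      ultimately have eq: "w k = w (shrink k) / real N powr (\<alpha> * l)" by simp
      have "real (N - 1) \<le> real N powr 1" using N by simp
      also have "\<dots> \<le> real N powr (\<alpha> * l)"
        using N exponent_bounds(1)[OF l] by (intro powr_mono) auto
      finally have "real (N - 1) * w (shrink k) \<le> real N powr (\<alpha> * l) * w (shrink k)"
        using w_pos[of "shrink k"] by (intro mult_right_mono) auto
      then show "real (N - 1) * w k \<le> w (shrink k)"
        unfolding eq using N by (simp add: field_simps)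
      show "shrink k \<in> new_terms"
        using nz ks(3) by (auto simp: new_terms_def shrink_def int_vecs_def PiE_iff extensional_def)
    qed
    have inj: "inj_on shrink F2"
    proof (rule inj_onI)
      fix k k' assume k: "k \<in> F2" "k' \<in> F2" and eq: "shrink k = shrink k'"
      have "k s div int N = k' s div int N" using fun_cong[OF eq, of s] by (simp add: shrink_def)
      moreover have "k s = int N * (k s div int N)" "k' s = int N * (k' s div int N)"
        using k by (auto simp: F2_def)
      ultimately have ss: "k s = k' s" by metis
      have "k j = k' j" for j
        using fun_cong[OF eq, of j] ss by (cases "j = s") (auto simp: shrink_def)
      then show "k = k'" by (rule ext)
    qed
    have "(\<Sum>k\<in>F. \<Sum>h\<in>?H. if k \<in> new_dual h then w k else 0)
        = (\<Sum>k\<in>F. real (card {h \<in> ?H. k \<in> new_dual h}) * w k)"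
      by (intro sum.cong refl) (simp add: sum.If_cases Int_def)
    also have "\<dots> \<le> (\<Sum>k\<in>F. (if k \<in> F1 then w k else 0) + (if k \<in> F2 then w (shrink k) else 0))"
    proof (intro sum_mono)
      fix k assume k: "k \<in> F"
      define c where "c = card {h \<in> ?H. k \<in> new_dual h}"
      have kn: "k \<in> new_terms" using k F(2) by blast
      note c = card_new_dual_le[OF kn, folded c_def]
      have "real c * w k \<le> (if k \<in> F1 then w k else 0) + (if k \<in> F2 then w (shrink k) else 0)"
      proof (cases "int N dvd k s")
        case True
        show ?thesis
        proof (cases "int N dvd dot s g k")
          case d: True
          then have k2: "k \<in> F2" "k \<notin> F1" using True k by (auto simp: F1_def F2_def)
          have "real c * w k \<le> real (N - 1) * w k"
            using c(4) w_pos[of k] by (intro mult_right_mono) auto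
          then show ?thesis using shrink_w[OF k2(1)] k2 by simp
        next
          case d: False
          then have "c = 0" "k \<notin> F1" "k \<notin> F2" using c(3) True by (auto simp: F1_def F2_def)
          then show ?thesis by simp
        qed
      next
        case False
        show ?thesis
        proof (cases "int N dvd dot s g k")
          case d: True
          then have "c = 0" "k \<notin> F1" "k \<notin> F2" using c(2) False by (auto simp: F1_def F2_def)
          then show ?thesis by simp
        next
          case d: False
          then have "c \<le> 1" "k \<in> F1" "k \<notin> F2" using c(1) False k by (auto simp: F1_def F2_def)
          then show ?thesis using w_pos[of k] by (simp add: mult_left_le_one_le)
        qed
      qed
      then show "real (card {h \<in> ?H. k \<in> new_dual h}) * w k
          \<le> (if k \<in> F1 then w k else 0) + (if k \<in> F2 then w (shrink k) else 0)"
        by (simp only: c_def)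
    qed
    also have "\<dots> = (\<Sum>k\<in>F1. w k) + (\<Sum>k\<in>F2. w (shrink k))"
    proof -
      have "F \<inter> F1 = F1" "F \<inter> F2 = F2" by (auto simp: F1_def F2_def)
      then show ?thesis using F(1) by (simp add: sum.distrib sum.inter_restrict[symmetric])
    qed
    also have "(\<Sum>k\<in>F2. w (shrink k)) = (\<Sum>k\<in>shrink ` F2. w k)"
      using inj by (simp add: sum.reindex)
    also have "(\<Sum>k\<in>F1. w k) + (\<Sum>k\<in>shrink ` F2. w k) = (\<Sum>k\<in>F1 \<union> shrink ` F2. w k)"
    proof (rule sum.union_disjoint[symmetric])
      show "F1 \<inter> shrink ` F2 = {}" by (auto simp: F1_def F2_def shrink_dot)
    qed (use fin in auto)
    also have "\<dots> \<le> 2 * \<gamma> s powr l * zeta (\<alpha> * l) * zeta_prod s \<alpha> \<gamma> l"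
      using fin shrink_new F(2) by (intro sum_new_terms_le) (auto simp: F1_def)
    finally show ?thesis .
  qed
  then have "(\<Sum>\<^sub>\<infinity>k\<in>new_terms. \<Sum>h\<in>?H. if k \<in> new_dual h then w k else 0)
      \<le> 2 * \<gamma> s powr l * zeta (\<alpha> * l) * zeta_prod s \<alpha> \<gamma> l"
    using has_sum_imp_summable[OF hs] by (intro infsum_le_finite_sums) auto
  then show ?thesis using infsumI[OF hs] by simp
qed

lemma cbc_criterion_Suc:
  "cbc_criterion (Suc s) \<alpha> \<gamma> N (g(s := h)) = cbc_criterion s \<alpha> \<gamma> N g
    + (\<Sum>\<^sub>\<infinity>k\<in>new_dual h. korobov_weight (Suc s) \<alpha> \<gamma> k powr (- 2))"
proof -
  let ?f = "\<lambda>k. korobov_weight (Suc s) \<alpha> \<gamma> k powr (- 2)"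
  let ?old = "dual_lattice s N g - {zero_int_vec s}"
  let ?ext = "\<lambda>k::nat \<Rightarrow> int. k(s := 0)"
  have ext_s: "k s = undefined" if "k \<in> int_vecs s" for k
    using that by (auto simp: int_vecs_def PiE_iff extensional_def)
  have inj: "inj_on ?ext ?old"
  proof (rule inj_onI)
    fix k k' assume k: "k \<in> ?old" "k' \<in> ?old" and eq: "?ext k = ?ext k'"
    have "k j = k' j" for j
      using fun_cong[OF eq, of j] ext_s[of k] ext_s[of k'] k by (cases "j = s") (auto simp: dual_lattice_def)
    then show "k = k'" by (rule ext)
  qed
  have zero: "?ext (zero_int_vec s) = zero_int_vec (Suc s)"
    by (rule ext) (auto simp: zero_int_vec_def)
  have dot_ext: "dot s g (restrict k {..<s}) = dot s g k" for k
    by (rule dot_cong) auto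
  have split: "dual_lattice (Suc s) N (g(s := h)) - {zero_int_vec (Suc s)} = ?ext ` ?old \<union> new_dual h"
  proof (intro equalityI subsetI)
    fix k assume k: "k \<in> dual_lattice (Suc s) N (g(s := h)) - {zero_int_vec (Suc s)}"
    then have kv: "k \<in> int_vecs (Suc s)" and dv: "int N dvd dot s g k + h * k s"
      by (auto simp: dual_lattice_def dot_upd_Suc cong_0_iff)
    show "k \<in> ?ext ` ?old \<union> new_dual h"
    proof (cases "k s = 0")
      case True
      have eq: "k = ?ext (restrict k {..<s})" using restrict_upd_eq[OF kv] True by simp
      moreover have "restrict k {..<s} \<in> dual_lattice s N g"
        using dv True restrict_in_int_vecs by (simp add: dual_lattice_def cong_0_iff dot_ext)
      moreover have "restrict k {..<s} \<noteq> zero_int_vec s"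
        using eq zero k by (metis DiffD2 singletonI)
      ultimately show ?thesis by blast
    next
      case False
      then show ?thesis using kv dv by (simp add: new_dual_def new_terms_def)
    qed
  next
    fix k assume "k \<in> ?ext ` ?old \<union> new_dual h"
    then show "k \<in> dual_lattice (Suc s) N (g(s := h)) - {zero_int_vec (Suc s)}"
    proof
      assume "k \<in> ?ext ` ?old"
      then obtain k' where k': "k = ?ext k'" "k' \<in> dual_lattice s N g" "k' \<noteq> zero_int_vec s" by blast
      have "dot s g k = dot s g k'" unfolding k'(1) by (rule dot_cong) auto
      then have "k \<in> dual_lattice (Suc s) N (g(s := h))"
        using k' fun_upd_in_int_vecs_Suc[of k' s 0] by (simp add: dual_lattice_def dot_upd_Suc)
      moreover have "k \<noteq> zero_int_vec (Suc s)"
      proof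
        assume "k = zero_int_vec (Suc s)"
        then have "k' j = 0" if "j < s" for j
          using k'(1) that by (auto simp: zero_int_vec_def fun_eq_iff split: if_splits)
        then have "k' = zero_int_vec s"
          using k'(2) int_vec_nonzero_entry[of k' s] by (auto simp: dual_lattice_def)
        then show False using k'(3) by simp
      qed
      ultimately show ?thesis by blast
    next
      assume "k \<in> new_dual h"
      then show ?thesis
        by (auto simp: new_dual_def new_terms_def dual_lattice_def dot_upd_Suc cong_0_iff zero_int_vec_def)
    qed
  qed
  have sub: "?ext ` ?old \<subseteq> int_vecs (Suc s)" "new_dual h \<subseteq> int_vecs (Suc s)"
    using fun_upd_in_int_vecs_Suc by (auto simp: dual_lattice_def new_dual_def new_terms_def)
  have "cbc_criterion (Suc s) \<alpha> \<gamma> N (g(s := h)) = infsum ?f (?ext ` ?old \<union> new_dual h)"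
    unfolding cbc_criterion_def split by (simp only: inverse_square_eq_powr)
  also have "\<dots> = infsum ?f (?ext ` ?old) + infsum ?f (new_dual h)"
    using sub by (intro infsum_Un_disjoint summable_korobov_weight_powr[OF two_in_exponents])
      (auto simp: new_dual_def new_terms_def)
  also have "infsum ?f (?ext ` ?old) = infsum (\<lambda>k. ?f (?ext k)) ?old"
    using inj by (simp add: infsum_reindex o_def)
  also have "\<dots> = cbc_criterion s \<alpha> \<gamma> N g"
  proof -
    have "korobov_weight (Suc s) \<alpha> \<gamma> (?ext k) = korobov_weight s \<alpha> \<gamma> k" for k
    proof -
      have "korobov_weight (Suc s) \<alpha> \<gamma> (?ext k) = korobov_weight s \<alpha> \<gamma> (?ext k)"
        by (simp add: korobov_weight_eq prev.korobov_weight_eq)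
      also have "\<dots> = korobov_weight s \<alpha> \<gamma> k"
        by (rule prev.korobov_weight_cong) simp
      finally show ?thesis .
    qed
    then show ?thesis unfolding cbc_criterion_def by (simp only: prev.inverse_square_eq_powr)
  qed
  finally show ?thesis .
qed

text \<open>
  The minimizing \<open>h0\<close> is at least as good as some \<open>h\<close> for which the sum of the new terms
  \<open>r\<^sup>-\<^sup>l\<close> does not exceed the bound for the average over all candidates. Old and new contributions are both powers with exponent \<open>2/l \<ge> 1\<close>, and such powers
  are superadditive.
\<close>

lemma cbc_step:
  assumes prev_le: "cbc_criterion s \<alpha> \<gamma> N g \<le> (zeta_prod s \<alpha> \<gamma> l / real (N - 1)) powr (2 / l)"
    and min: "\<And>h. h \<in> {1..int N - 1} \<Longrightarrow>
      cbc_criterion (Suc s) \<alpha> \<gamma> N (g(s := h0)) \<le> cbc_criterion (Suc s) \<alpha> \<gamma> N (g(s := h))"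
  shows "cbc_criterion (Suc s) \<alpha> \<gamma> N (g(s := h0)) \<le> (zeta_prod (Suc s) \<alpha> \<gamma> l / real (N - 1)) powr (2 / l)"
proof -
  let ?H = "{1..int N - 1}" and ?Y = "2 * \<gamma> s powr l * zeta (\<alpha> * l) * zeta_prod s \<alpha> \<gamma> l"
  let ?\<Theta> = "\<lambda>h. \<Sum>\<^sub>\<infinity>k\<in>new_dual h. w k"
  let ?\<theta> = "\<lambda>h. \<Sum>\<^sub>\<infinity>k\<in>new_dual h. korobov_weight (Suc s) \<alpha> \<gamma> k powr (- 2)"
  note b = exponent_bounds[OF l]
  have N: "1 < N" using prime prime_gt_1_nat by blast
  have "\<exists>h\<in>?H. ?\<Theta> h \<le> ?Y / real (N - 1)"
  proof (rule ccontr)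
    assume "\<not> ?thesis"
    then have "(\<Sum>h\<in>?H. ?Y / real (N - 1)) < (\<Sum>h\<in>?H. ?\<Theta> h)"
      using N by (intro sum_strict_mono) (auto simp: not_le)
    moreover have "(\<Sum>h\<in>?H. ?Y / real (N - 1)) = ?Y"
      using N by (simp add: nat_diff_distrib)
    ultimately show False using sum_new_dual_le by linarith
  qed
  then obtain h where h: "h \<in> ?H" "?\<Theta> h \<le> ?Y / real (N - 1)" by blast
  have "?\<theta> h0 \<le> ?\<theta> h" using min[OF h(1)] by (simp add: cbc_criterion_Suc)
  also have "\<dots> \<le> ?\<Theta> h powr (2 / l)"
    by (rule infsum_inverse_square_le[OF l]) (auto simp: new_dual_def new_terms_def)
  also have "\<dots> \<le> (?Y / real (N - 1)) powr (2 / l)"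
    using h(2) b by (intro powr_mono2 infsum_nonneg) auto
  finally have "cbc_criterion (Suc s) \<alpha> \<gamma> N (g(s := h0))
      \<le> (zeta_prod s \<alpha> \<gamma> l / real (N - 1)) powr (2 / l) + (?Y / real (N - 1)) powr (2 / l)"
    using prev_le by (simp add: cbc_criterion_Suc)
  also have "\<dots> \<le> (zeta_prod s \<alpha> \<gamma> l / real (N - 1) + ?Y / real (N - 1)) powr (2 / l)"
    using prev.zeta_prod_ge_1[OF l] zeta_ge_1[OF b(1)] b by (intro powr_superadditive) auto
  also have "zeta_prod s \<alpha> \<gamma> l / real (N - 1) + ?Y / real (N - 1) = zeta_prod (Suc s) \<alpha> \<gamma> l / real (N - 1)"
    by (simp add: zeta_prod_Suc add_divide_distrib[symmetric] algebra_simps)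
  finally show ?thesis .
qed

end

context korobov
begin

text \<open>
  The induction starts in dimension 0, where the sum is empty. The prescribed choice \<open>g\<^sub>0 = 1\<close> is
  also a minimizer: in dimension 1 being dual means that \<open>N\<close> divides \<open>k\<^sub>0\<close>, for every \<open>g\<^sub>0\<close>.
\<close>

lemma cbc_criterion_le:
  assumes "prime N" "cbc_output d \<alpha> \<gamma> N g" and l: "l \<in> {1 / \<alpha><..2}" and "s \<le> d"
  shows "cbc_criterion s \<alpha> \<gamma> N (restrict g {..<s}) \<le> (zeta_prod s \<alpha> \<gamma> l / real (N - 1)) powr (2 / l)"
  using \<open>s \<le> d\<close>
proof (induction s)
  case 0
  have "dual_lattice 0 N (restrict g {..<0}) - {zero_int_vec 0} = {}"
    by (auto simp: dual_lattice_def int_vecs_def zero_int_vec_def)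
  then show ?case unfolding cbc_criterion_def by (simp only: infsum_empty powr_ge_zero)
next
  case (Suc s)
  interpret korobov_step s \<alpha> \<gamma> N "restrict g {..<s}" l
    by unfold_locales (use smooth gamma Suc.prems assms(1) l in auto)
  have upd: "(restrict g {..<s})(s := g s) = restrict g {..<Suc s}"
    by (rule ext) (auto simp: less_Suc_eq)
  have "cbc_criterion (Suc s) \<alpha> \<gamma> N ((restrict g {..<s})(s := g s))
      \<le> cbc_criterion (Suc s) \<alpha> \<gamma> N ((restrict g {..<s})(s := h))" if h: "h \<in> {1..int N - 1}" for h
  proof (cases "s = 0")
    case True
    have "new_dual h' = {k \<in> new_terms. int N dvd k s}" if "h' \<in> {1..int N - 1}" for h'
    proof -
      have "\<not> int N dvd h'" using that by (auto simp: zdvd_not_zless)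
      then have "int N dvd h' * k s \<longleftrightarrow> int N dvd k s" for k :: "nat \<Rightarrow> int"
        using assms(1) by (simp add: prime_dvd_mult_iff)
      then show ?thesis unfolding new_dual_def using True by (simp add: dot_def)
    qed
    moreover have "g s \<in> {1..int N - 1}"
      using assms(2) Suc.prems by (auto simp: cbc_output_def gen_vecs_def PiE_iff)
    ultimately show ?thesis using h by (simp only: cbc_criterion_Suc)
  next
    case False
    then have "is_arg_min (\<lambda>h. cbc_criterion (Suc s) \<alpha> \<gamma> N ((restrict g {..<s})(s := h))) (\<lambda>h. h \<in> {1..int N - 1}) (g s)"
      using assms(2) Suc.prems by (simp add: cbc_output_def)
    then show ?thesis using h by (auto simp: is_arg_min_linorder)
  qed
  then show ?case
    using cbc_step[of "g s"] Suc by (simp only: upd)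
qed

lemma cbc_separated:
  assumes "1 \<le> d" "prime N" "cbc_output d \<alpha> \<gamma> N g"
    and M: "M = cbc_threshold d \<alpha> \<gamma> N"
  shows "separated d \<alpha> \<gamma> N M g"
  unfolding separated_def
proof
  fix k assume k: "k \<in> dual_lattice d N g - {zero_int_vec d}"
  let ?r = "korobov_weight d \<alpha> \<gamma>"
  have N: "1 < N" using assms(2) prime_gt_1_nat by blast
  obtain l where l: "l \<in> {1 / \<alpha><..2}"
    and M': "M = (real N / 2 / zeta_prod d \<alpha> \<gamma> l) powr (1 / l)"
    using threshold_attained(1)[OF assms(1), of "real N / 2"] N unfolding M cbc_threshold_def by auto
  define Z where "Z = zeta_prod d \<alpha> \<gamma> l"
  note b = exponent_bounds[OF l]
  have Z: "1 \<le> Z" using zeta_prod_ge_1[OF l] by (simp add: Z_def)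
  have "restrict g {..<d} = g"
    using assms(3) by (auto simp: cbc_output_def gen_vecs_def PiE_restrict)
  have "?r k powr (- 2) = sum (\<lambda>k. ?r k powr (- 2)) {k}" by simp
  also have "\<dots> \<le> (\<Sum>\<^sub>\<infinity>k\<in>dual_lattice d N g - {zero_int_vec d}. ?r k powr (- 2))"
    using k by (intro finite_sum_le_infsum summable_korobov_weight_powr[OF two_in_exponents])
      (auto simp: dual_lattice_def)
  also have "\<dots> = cbc_criterion d \<alpha> \<gamma> N g"
    unfolding cbc_criterion_def by (simp only: inverse_square_eq_powr)
  also have "\<dots> \<le> (Z / real (N - 1)) powr (2 / l)"
    using cbc_criterion_le[OF assms(2,3) l order_refl] \<open>restrict g {..<d} = g\<close> by (simp add: Z_def)
  also have "\<dots> \<le> (2 * Z / real N) powr (2 / l)"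
  proof (intro powr_mono2)
    have "Z * real N \<le> Z * (2 * real (N - 1))" using N Z by (intro mult_left_mono) auto
    then show "Z / real (N - 1) \<le> 2 * Z / real N" using N by (simp add: field_simps)
  qed (use b Z in auto)
  also have "\<dots> = M powr (- 2)"
  proof -
    have "2 * Z / real N = (real N / 2 / Z) powr (- 1)"
      using N Z by (simp add: powr_minus)
    then have "(2 * Z / real N) powr (2 / l) = (real N / 2 / Z) powr (- 1 * (2 / l))"
      by (simp only: powr_powr)
    also have "\<dots> = M powr (- 2)" unfolding M' Z_def powr_powr by simp
    finally show ?thesis .
  qed
  finally have le: "?r k powr (- 2) \<le> M powr (- 2)" .
  show "M \<le> ?r k"
  proof (rule ccontr)
    assume "\<not> M \<le> ?r k"
    then have "M powr (- 2) < ?r k powr (- 2)"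
      using korobov_weight_pos[of k] by (intro powr_less_mono2_neg) auto
    then show False using le by simp
  qed
qed

end

section \<open>Translations of the torus and characters\<close>

lemma sinh_le_mult_cosh:
  assumes "0 \<le> (t::real)"
  shows "sinh t \<le> t * cosh t"
proof -
  have "(\<lambda>t. t * cosh t - sinh t) 0 \<le> (\<lambda>t::real. t * cosh t - sinh t) t"
  proof (rule DERIV_nonneg_imp_nondecreasing[OF assms])
    fix x :: real assume "0 \<le> x"
    then show "\<exists>y. ((\<lambda>t. t * cosh t - sinh t) has_real_derivative y) (at x) \<and> 0 \<le> y"
      by (intro exI[of _ "x * sinh x"]) (auto intro!: derivative_eq_intros)
  qed
  then show ?thesis by simp
qed

lemma cosh_le_exp_half_square: "cosh (x::real) \<le> exp (x\<^sup>2 / 2)"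
proof -
  have pos: "cosh t \<le> exp (t\<^sup>2 / 2)" if "0 \<le> t" for t :: real
  proof -
    have "(\<lambda>t. - (cosh t * exp (- t\<^sup>2 / 2))) 0 \<le> (\<lambda>t::real. - (cosh t * exp (- t\<^sup>2 / 2))) t"
    proof (rule DERIV_nonneg_imp_nondecreasing[OF that])
      fix x :: real assume "0 \<le> x"
      then have "0 \<le> (x * cosh x - sinh x) * exp (- x\<^sup>2 / 2)"
        using sinh_le_mult_cosh by simp
      then show "\<exists>y. ((\<lambda>t. - (cosh t * exp (- t\<^sup>2 / 2))) has_real_derivative y) (at x) \<and> 0 \<le> y"
        by (intro exI[of _ "(x * cosh x - sinh x) * exp (- x\<^sup>2 / 2)"])
          (auto intro!: derivative_eq_intros simp: algebra_simps)
    qed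
    then have "cosh t * exp (- t\<^sup>2 / 2) \<le> 1" by simp
    then show ?thesis by (simp add: exp_minus field_simps)
  qed
  show ?thesis using pos[of "\<bar>x\<bar>"] by simp
qed

text \<open>
  With \<open>u\<close> and \<open>v\<close> as in the proof the left-hand side is \<open>4 cosh u cosh v\<close>, and
  \<open>u\<^sup>2/2 + v\<^sup>2/2 = a\<^sup>2/4\<close>. The exponent is half of what Hoeffding's lemma gives for a variable with
  values in \<open>[-1, 1]\<close>; this gain compensates for treating real and imaginary parts separately.
\<close>

lemma sum_exp_quarter_turns_le:
  fixes z :: complex and a :: real
  assumes "cmod z = 1"
  shows "exp (a * Re z) + exp (a * Re (\<i> * z)) + exp (a * Re (- z)) + exp (a * Re (- \<i> * z)) \<le> 4 * exp (a\<^sup>2 / 4)"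
proof -
  define u v where "u = a * (Re z + Im z) / 2" and "v = a * (Re z - Im z) / 2"
  have sq: "(Re z)\<^sup>2 + (Im z)\<^sup>2 = 1" using assms cmod_power2[of z] by simp
  have "u\<^sup>2 / 2 + v\<^sup>2 / 2 = a\<^sup>2 * ((Re z)\<^sup>2 + (Im z)\<^sup>2) / 4"
    by (simp add: u_def v_def power2_eq_square field_simps)
  then have uv: "u\<^sup>2 / 2 + v\<^sup>2 / 2 = a\<^sup>2 / 4" using sq by simp
  have "exp (a * Re z) + exp (a * Re (\<i> * z)) + exp (a * Re (- z)) + exp (a * Re (- \<i> * z))
      = 4 * (cosh u * cosh v)"
  proof -
    have "a * Re z = u + v" "a * Im z = u - v" by (simp_all add: u_def v_def field_simps)
    then have "exp (a * Re z) = exp u * exp v" "exp (- (a * Re z)) = exp (- u) * exp (- v)"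
      "exp (a * Im z) = exp u * exp (- v)" "exp (- (a * Im z)) = exp (- u) * exp v"
      by (simp_all add: exp_add[symmetric])
    then show ?thesis by (simp add: cosh_def algebra_simps)
  qed
  also have "\<dots> \<le> 4 * (exp (u\<^sup>2 / 2) * exp (v\<^sup>2 / 2))"
    by (intro mult_left_mono mult_mono cosh_le_exp_half_square) auto
  also have "\<dots> = 4 * exp (a\<^sup>2 / 4)" by (simp add: exp_add[symmetric] uv)
  finally show ?thesis .
qed

lemma measurable_component_compose:
  assumes "g \<in> N \<rightarrow>\<^sub>M L" "i \<in> I"
  shows "(\<lambda>x. g (x i)) \<in> Pi\<^sub>M I (\<lambda>_. N) \<rightarrow>\<^sub>M L"
  using measurable_compose[OF measurable_component_singleton[OF assms(2), where M = "\<lambda>_. N"] assms(1)] .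

abbreviation unit_measure :: "real measure" where
  "unit_measure \<equiv> restrict_space lborel {0..<1}"

lemma prob_space_unit_measure: "prob_space unit_measure"
  by (rule prob_space_restrict_space) auto

lemma space_unit_measure [simp]: "space unit_measure = {0..<1}"
  by (simp add: space_restrict_space)

lemma measurable_unit_measure_id: "(\<lambda>x. x) \<in> borel_measurable unit_measure"
  by (rule measurable_restrict_space1) simp

lemma measurable_frac_shift: "(\<lambda>x. frac (x + b)) \<in> unit_measure \<rightarrow>\<^sub>M unit_measure"
proof (rule measurable_restrict_space2)
  show "(\<lambda>x. frac (x + b)) \<in> unit_measure \<rightarrow>\<^sub>M lborel"
    using measurable_unit_measure_id unfolding frac_def by measurable
qed (auto simp: frac_lt_1)

lemma emeasure_lborel_translate:
  fixes c :: real
  assumes "B \<in> sets borel"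
  shows "emeasure lborel ((\<lambda>x. c + x) -` B) = emeasure lborel B"
proof -
  have "emeasure lborel B = emeasure (distr lborel borel ((+) c)) B"
    by (simp add: lborel_distr_plus)
  also have "\<dots> = emeasure lborel ((\<lambda>x. c + x) -` B)"
    using assms by (subst emeasure_distr) auto
  finally show ?thesis by simp
qed

text \<open>
  Let \<open>c\<close> be the fractional part of \<open>b\<close>. Adding it modulo 1 translates \<open>[0, 1 - c)\<close> to \<open>[c, 1)\<close> and \<open>[1 - c, 1)\<close> to \<open>[0, c)\<close>.
\<close>

lemma emeasure_frac_shift:
  assumes "A \<in> sets unit_measure"
  shows "emeasure unit_measure ((\<lambda>x. frac (x + b)) -` A \<inter> {0..<1}) = emeasure unit_measure A"
proof -
  define c where "c = frac b"
  have c: "0 \<le> c" "c < 1" by (auto simp: c_def frac_lt_1)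
  have A: "A \<in> sets borel" "A \<subseteq> {0..<1}"
    using assms by (auto simp: sets_restrict_space)
  have pre: "(\<lambda>x. frac (x + b)) -` A \<inter> {0..<1}
      = (\<lambda>x. c + x) -` (A \<inter> {c..<1}) \<union> (\<lambda>x. (c - 1) + x) -` (A \<inter> {0..<c})" (is "?P = ?P1 \<union> ?P2")
  proof (rule Set.set_eqI)
    fix x
    have split: "c + x = x + b - of_int \<lfloor>b\<rfloor>" by (simp add: c_def frac_def)
    have "frac (x + b) = frac (c + x)" unfolding split frac_def by simp
    moreover have "x \<in> {0..<1} \<Longrightarrow> frac (c + x) = (if c + x < 1 then c + x else (c - 1) + x)"
      using c by (auto simp: frac_eq) (auto simp: frac_unique_iff)
    ultimately show "x \<in> ?P \<longleftrightarrow> x \<in> ?P1 \<union> ?P2"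
      using A(2) c by (cases "x \<in> {0..<1}") (auto split: if_splits)
  qed
  have "emeasure unit_measure ?P = emeasure lborel ?P"
    by (rule emeasure_restrict_space) auto
  also have "\<dots> = emeasure lborel (?P1 \<union> ?P2)" by (simp only: pre)
  also have "\<dots> = emeasure lborel ?P1 + emeasure lborel ?P2"
  proof (rule plus_emeasure[symmetric])
    have "(\<lambda>x::real. e + x) -` B \<in> sets lborel" if "B \<in> sets borel" for e B
      using measurable_sets[of "\<lambda>x::real. e + x" borel borel B] that by simp
    then show "?P1 \<in> sets lborel" "?P2 \<in> sets lborel" using A by auto
    show "?P1 \<inter> ?P2 = {}" using c by auto
  qed
  also have "\<dots> = emeasure lborel (A \<inter> {c..<1}) + emeasure lborel (A \<inter> {0..<c})"
    using A by (intro arg_cong2[where f = plus] emeasure_lborel_translate) auto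
  also have "\<dots> = emeasure lborel ((A \<inter> {c..<1}) \<union> (A \<inter> {0..<c}))"
    using A by (intro plus_emeasure) auto
  also have "(A \<inter> {c..<1}) \<union> (A \<inter> {0..<c}) = A" using A(2) c by auto
  also have "emeasure lborel A = emeasure unit_measure A"
    using A by (intro emeasure_restrict_space[symmetric]) auto
  finally show ?thesis .
qed

lemma prob_space_cube_measure: "prob_space (cube_measure d)"
  unfolding cube_measure_def by (rule prob_space_PiM) (rule prob_space_unit_measure)

lemma space_cube_measure: "space (cube_measure d) = unit_cube d"
  by (simp add: cube_measure_def space_PiM unit_cube_def)

lemma measurable_frac_vec_shift:
  "(\<lambda>x. frac_vec d (\<lambda>j. x j + b j)) \<in> cube_measure d \<rightarrow>\<^sub>M cube_measure d"
  unfolding cube_measure_def frac_vec_def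
proof (rule measurable_restrict)
  fix j assume "j \<in> {..<d}"
  then show "(\<lambda>x. frac (x j + b j)) \<in> Pi\<^sub>M {..<d} (\<lambda>_. unit_measure) \<rightarrow>\<^sub>M unit_measure"
    by (rule measurable_component_compose[OF measurable_frac_shift])
qed

lemma distr_frac_vec_shift:
  "distr (cube_measure d) (cube_measure d) (\<lambda>x. frac_vec d (\<lambda>j. x j + b j)) = cube_measure d"
proof -
  interpret U: prob_space unit_measure by (rule prob_space_unit_measure)
  interpret P: product_prob_space "\<lambda>_. unit_measure" "{..<d}" by unfold_locales
  let ?T = "\<lambda>x. frac_vec d (\<lambda>j. x j + b j)"
  have "distr (cube_measure d) (cube_measure d) ?T = Pi\<^sub>M {..<d} (\<lambda>_. unit_measure)"
  proof (rule P.PiM_eqI)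
    fix A assume A: "\<And>j. j \<in> {..<d} \<Longrightarrow> A j \<in> sets unit_measure"
    have B: "(\<lambda>x. frac (x + b j)) -` A j \<inter> {0..<1} \<in> sets unit_measure" if "j \<in> {..<d}" for j
      using measurable_sets[OF measurable_frac_shift A[OF that]] by simp
    have "Pi\<^sub>E {..<d} A \<in> sets (cube_measure d)"
      unfolding cube_measure_def using A by (intro sets_PiM_I_finite) auto
    then have "emeasure (distr (cube_measure d) (cube_measure d) ?T) (Pi\<^sub>E {..<d} A)
        = emeasure (cube_measure d) (?T -` Pi\<^sub>E {..<d} A \<inter> space (cube_measure d))"
      by (rule emeasure_distr[OF measurable_frac_vec_shift])
    also have "?T -` Pi\<^sub>E {..<d} A \<inter> space (cube_measure d)
        = Pi\<^sub>E {..<d} (\<lambda>j. (\<lambda>x. frac (x + b j)) -` A j \<inter> {0..<1})"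
      by (auto simp: space_cube_measure unit_cube_def frac_vec_def PiE_iff)
    also have "emeasure (cube_measure d) \<dots> = (\<Prod>j<d. emeasure unit_measure ((\<lambda>x. frac (x + b j)) -` A j \<inter> {0..<1}))"
      unfolding cube_measure_def using B by (intro P.emeasure_PiM) auto
    also have "\<dots> = (\<Prod>j<d. emeasure unit_measure (A j))"
      using A by (intro prod.cong refl emeasure_frac_shift) auto
    finally show "emeasure (distr (cube_measure d) (cube_measure d) ?T) (Pi\<^sub>E {..<d} A)
      = (\<Prod>j\<in>{..<d}. emeasure unit_measure (A j))" .
  qed (auto simp: cube_measure_def)
  then show ?thesis by (simp add: cube_measure_def)
qed

lemma measurable_fourier_char: "fourier_char d k \<in> borel_measurable (cube_measure d)"
proof -
  have "(\<lambda>x. x j) \<in> borel_measurable (cube_measure d)" if "j < d" for j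
    unfolding cube_measure_def
    using measurable_component_compose[OF measurable_unit_measure_id, of j "{..<d}"] that by simp
  then have "(\<lambda>x. dot d (\<lambda>j. real_of_int (k j)) x) \<in> borel_measurable (cube_measure d)"
    unfolding dot_def by (intro borel_measurable_sum borel_measurable_times) auto
  then show ?thesis
    unfolding fourier_char_def[abs_def] by measurable
qed

text \<open>
  Translating the coordinate \<open>y\<^sub>p\<close> by \<open>1/(4 h\<^sub>p)\<close> multiplies the character by \<open>\<i>\<close> and preserves
  the measure. So the expectation equals the mean of those for \<open>c\<close>, \<open>\<i>c\<close>, \<open>-c\<close>, \<open>-\<i>c\<close>, and the
  bound holds pointwise for the mean of the four integrands.
\<close>

lemma mgf_fourier_char_le:
  assumes p: "p < d" "h p \<noteq> 0" and c: "cmod c = 1"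
  shows "(\<integral>y. exp (a * Re (c * fourier_char d h y)) \<partial>cube_measure d) \<le> exp (a\<^sup>2 / 4)"
    and "integrable (cube_measure d) (\<lambda>y. exp (a * Re (c * fourier_char d h y)))"
proof -
  interpret prob_space "cube_measure d" by (rule prob_space_cube_measure)
  define F where "F c y = exp (a * Re (c * fourier_char d h y))" for c y
  have meas: "F c \<in> borel_measurable (cube_measure d)" for c
    unfolding F_def[abs_def] using measurable_fourier_char[of d h] by measurable
  have int: "integrable (cube_measure d) (F c)" if "cmod c = 1" for c
  proof (rule integrable_const_bound)
    have "F c y \<le> exp \<bar>a\<bar>" for y
    proof -
      have "\<bar>Re (c * fourier_char d h y)\<bar> \<le> 1"
        using abs_Re_le_cmod[of "c * fourier_char d h y"] that by (simp add: norm_mult)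
      then have "\<bar>a\<bar> * \<bar>Re (c * fourier_char d h y)\<bar> \<le> \<bar>a\<bar> * 1" by (intro mult_left_mono) auto
      then have "a * Re (c * fourier_char d h y) \<le> \<bar>a\<bar>"
        by (metis abs_le_D1 abs_mult mult.right_neutral)
      then show ?thesis by (simp add: F_def)
    qed
    then show "AE y in cube_measure d. norm (F c y) \<le> exp \<bar>a\<bar>" by (simp add: F_def)
  qed (rule meas)
  then show "integrable (cube_measure d) (\<lambda>y. exp (a * Re (c * fourier_char d h y)))"
    using c unfolding F_def by blast
  define b where "b = (\<lambda>j. if j = p then 1 / (4 * real_of_int (h p)) else 0)"
  have "dot d (\<lambda>j. real_of_int (h j)) b = (\<Sum>j<d. if j = p then 1 / 4 else 0)"
    unfolding dot_def using p(2) by (intro sum.cong refl) (simp add: b_def)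
  also have "\<dots> = 1 / 4" using p(1) by simp
  finally have quarter: "dot d (\<lambda>j. real_of_int (h j)) b = 1 / 4" .
  have "fourier_char d h b = cis (pi / 2)" unfolding fourier_char_cis quarter by simp
  then have rot: "fourier_char d h (frac_vec d (\<lambda>j. y j + b j)) = \<i> * fourier_char d h y" for y
    by (simp add: fourier_char_frac fourier_char_add mult.commute)
  have turn: "(\<integral>y. F c y \<partial>cube_measure d) = (\<integral>y. F (\<i> * c) y \<partial>cube_measure d)" for c
  proof -
    let ?T = "\<lambda>x. frac_vec d (\<lambda>j. x j + b j)"
    have "(\<integral>y. F c y \<partial>cube_measure d) = (\<integral>y. F c y \<partial>distr (cube_measure d) (cube_measure d) ?T)"
      by (simp only: distr_frac_vec_shift)
    also have "\<dots> = (\<integral>y. F c (?T y) \<partial>cube_measure d)"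
      by (rule integral_distr[OF measurable_frac_vec_shift meas])
    also have "\<dots> = (\<integral>y. F (\<i> * c) y \<partial>cube_measure d)"
      by (simp add: F_def rot mult_ac)
    finally show ?thesis .
  qed
  have t1: "(\<integral>y. F (\<i> * c) y \<partial>cube_measure d) = (\<integral>y. F c y \<partial>cube_measure d)"
    using turn[of c] by simp
  have t2: "(\<integral>y. F (- c) y \<partial>cube_measure d) = (\<integral>y. F c y \<partial>cube_measure d)"
    using turn[of "\<i> * c"] turn[of c] by (simp add: mult.assoc[symmetric])
  have t3: "(\<integral>y. F (- \<i> * c) y \<partial>cube_measure d) = (\<integral>y. F c y \<partial>cube_measure d)"
    using turn[of "- c"] t2 by simp
  have ints: "integrable (cube_measure d) (F c)" "integrable (cube_measure d) (F (\<i> * c))"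
    "integrable (cube_measure d) (F (- c))" "integrable (cube_measure d) (F (- \<i> * c))"
    using c by (auto intro!: int simp: norm_mult)
  have "4 * (\<integral>y. F c y \<partial>cube_measure d) = (\<integral>y. F c y \<partial>cube_measure d) + (\<integral>y. F (\<i> * c) y \<partial>cube_measure d)
      + (\<integral>y. F (- c) y \<partial>cube_measure d) + (\<integral>y. F (- \<i> * c) y \<partial>cube_measure d)"
    using t1 t2 t3 by simp
  also have "\<dots> = (\<integral>y. F c y + F (\<i> * c) y + F (- c) y + F (- \<i> * c) y \<partial>cube_measure d)"
    using ints by simp
  also have "\<dots> \<le> (\<integral>y. 4 * exp (a\<^sup>2 / 4) \<partial>cube_measure d)"
  proof (rule integral_mono)
    show "F c y + F (\<i> * c) y + F (- c) y + F (- \<i> * c) y \<le> 4 * exp (a\<^sup>2 / 4)" for y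
      using sum_exp_quarter_turns_le[of "c * fourier_char d h y" a] c
      by (simp add: F_def norm_mult mult.assoc)
  qed (use ints in auto)
  also have "\<dots> = 4 * exp (a\<^sup>2 / 4)" using prob_space by simp
  finally show "(\<integral>y. exp (a * Re (c * fourier_char d h y)) \<partial>cube_measure d) \<le> exp (a\<^sup>2 / 4)"
    by (simp add: F_def)
qed

section \<open>Concentration of character sums at random shifts\<close>

abbreviation shift_measure :: "nat \<Rightarrow> (nat \<times> nat \<Rightarrow> nat \<Rightarrow> real) measure" where
  "shift_measure d \<equiv> PiM UNIV (\<lambda>_. cube_measure d)"

lemma prob_space_shift_measure: "prob_space (shift_measure d)"
  by (rule prob_space_PiM) (rule prob_space_cube_measure)

lemma measurable_shift_fourier_char: "(\<lambda>\<omega>. fourier_char d k (\<omega> r)) \<in> borel_measurable (shift_measure d)"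
  by (rule measurable_component_compose[OF measurable_fourier_char]) simp

text \<open>
  Chernoff bound: the shifts are independent, so the moment generating function of the sum is at most
  \<open>exp (a\<^sup>2/4)\<close> to the power \<open>card J\<close>.
\<close>

lemma prob_Re_char_sum_ge:
  assumes J: "finite J" "J \<noteq> {}" and p: "p < d" "h p \<noteq> 0" and c: "cmod c = 1" and u: "0 < u"
  shows "measure (shift_measure d) {\<omega> \<in> space (shift_measure d). u \<le> Re (c * (\<Sum>r\<in>J. fourier_char d h (\<omega> r)))}
    \<le> exp (- (u\<^sup>2 / real (card J)))"
proof -
  interpret Q: prob_space "shift_measure d" by (rule prob_space_shift_measure)
  interpret C: prob_space "cube_measure d" by (rule prob_space_cube_measure)
  interpret P: product_prob_space "\<lambda>_::nat \<times> nat. cube_measure d" UNIV by unfold_locales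
  define n where "n = real (card J)"
  have n: "0 < n" using J by (simp add: n_def card_gt_0_iff)
  \<comment> \<open>The minimizer of the exponent \<open>n a\<^sup>2/4 - a u\<close>.\<close>
  define a where "a = 2 * u / n"
  have a: "0 < a" using u n by (simp add: a_def)
  let ?X = "\<lambda>\<omega>. Re (c * (\<Sum>r\<in>J. fourier_char d h (\<omega> r)))"
  let ?F = "\<lambda>y. exp (a * Re (c * fourier_char d h y))"
  have prod: "exp (a * ?X \<omega>) = (\<Prod>r\<in>J. ?F (\<omega> r))" for \<omega>
    by (simp add: exp_sum[OF J(1), symmetric] sum_distrib_left Re_sum)
  have bound: "?X \<omega> \<le> n" for \<omega>
  proof -
    have "?X \<omega> \<le> cmod (c * (\<Sum>r\<in>J. fourier_char d h (\<omega> r)))" by (rule complex_Re_le_cmod)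
    also have "\<dots> \<le> (\<Sum>r\<in>J. cmod (fourier_char d h (\<omega> r)))"
      using c by (simp add: norm_mult norm_sum del: cmod_fourier_char)
    finally show ?thesis by (simp add: n_def)
  qed
  have meas: "(\<lambda>\<omega>. exp (a * ?X \<omega>)) \<in> borel_measurable (shift_measure d)"
    using measurable_shift_fourier_char[of d h] by measurable
  have int: "integrable (shift_measure d) (\<lambda>\<omega>. exp (a * ?X \<omega>))"
  proof (rule Q.integrable_const_bound[OF _ meas])
    show "AE \<omega> in shift_measure d. norm (exp (a * ?X \<omega>)) \<le> exp (a * n)"
      using bound a by (simp add: mult_left_mono)
  qed
  have "(\<integral>\<omega>. exp (a * ?X \<omega>) \<partial>shift_measure d) = (\<integral>\<omega>. (\<Prod>r\<in>J. ?F (restrict \<omega> J r)) \<partial>shift_measure d)"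
    unfolding prod by (intro Bochner_Integration.integral_cong refl prod.cong) auto
  also have "\<dots> = (\<integral>\<omega>. (\<Prod>r\<in>J. ?F (\<omega> r)) \<partial>distr (shift_measure d) (Pi\<^sub>M J (\<lambda>_. cube_measure d)) (\<lambda>\<omega>. restrict \<omega> J))"
  proof (rule integral_distr[symmetric])
    show "(\<lambda>\<omega>. restrict \<omega> J) \<in> shift_measure d \<rightarrow>\<^sub>M Pi\<^sub>M J (\<lambda>_. cube_measure d)"
      by (rule measurable_restrict_subset) simp
    have "(\<lambda>\<omega>. ?F (\<omega> r)) \<in> borel_measurable (Pi\<^sub>M J (\<lambda>_. cube_measure d))" if "r \<in> J" for r
    proof -
      have "(\<lambda>\<omega>. fourier_char d h (\<omega> r)) \<in> borel_measurable (Pi\<^sub>M J (\<lambda>_. cube_measure d))"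
        using that by (rule measurable_component_compose[OF measurable_fourier_char])
      then show ?thesis by measurable
    qed
    then show "(\<lambda>\<omega>. \<Prod>r\<in>J. ?F (\<omega> r)) \<in> borel_measurable (Pi\<^sub>M J (\<lambda>_. cube_measure d))"
      by (rule borel_measurable_prod)
  qed
  also have "\<dots> = (\<integral>\<omega>. (\<Prod>r\<in>J. ?F (\<omega> r)) \<partial>Pi\<^sub>M J (\<lambda>_. cube_measure d))"
    using P.distr_PiM_restrict_finite[OF J(1)] by simp
  also have "\<dots> = (\<Prod>r\<in>J. \<integral>y. ?F y \<partial>cube_measure d)"
    using J(1) mgf_fourier_char_le(2)[of p d h c, OF p c] by (intro P.product_integral_prod) auto
  also have "\<dots> \<le> (\<Prod>r\<in>J. exp (a\<^sup>2 / 4))"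
    using mgf_fourier_char_le(1)[of p d h c, OF p c] by (intro prod_mono) (auto intro!: integral_nonneg)
  also have "\<dots> = exp (n * (a\<^sup>2 / 4))"
    by (simp only: n_def exp_of_nat_mult prod_constant)
  finally have mgf: "(\<integral>\<omega>. exp (a * ?X \<omega>) \<partial>shift_measure d) \<le> exp (n * (a\<^sup>2 / 4))" .
  have "measure (shift_measure d) {\<omega> \<in> space (shift_measure d). u \<le> ?X \<omega>}
      \<le> exp (- a * u) * (\<integral>\<omega>\<in>space (shift_measure d). exp (a * ?X \<omega>) \<partial>shift_measure d)"
  proof (rule Q.Chernoff_ineq_ge[OF a])
    show "set_integrable (shift_measure d) (space (shift_measure d)) (\<lambda>\<omega>. exp (a * ?X \<omega>))"
      using int by (simp add: set_integrable_def cong: Bochner_Integration.integrable_cong)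
  qed simp
  also have "\<dots> \<le> exp (- a * u) * exp (n * (a\<^sup>2 / 4))"
    using mgf set_integral_space[OF int] by simp
  also have "\<dots> = exp (- a * u + n * (a\<^sup>2 / 4))" by (simp only: exp_add)
  also have "- a * u + n * (a\<^sup>2 / 4) = - (u\<^sup>2 / n)"
    using n by (simp add: a_def power2_eq_square field_simps)
  finally show ?thesis by (simp add: n_def)
qed

lemma cmod_gt_imp_quarter:
  assumes "u < cmod z" "0 < u"
  shows "\<exists>c\<in>{1, \<i>, - 1, - \<i>}. u / sqrt 2 \<le> Re (c * z)"
proof (rule ccontr)
  assume "\<not> ?thesis"
  then have "\<bar>Re z\<bar> \<le> u / sqrt 2" "\<bar>Im z\<bar> \<le> u / sqrt 2" by auto
  then have "(Re z)\<^sup>2 \<le> (u / sqrt 2)\<^sup>2" "(Im z)\<^sup>2 \<le> (u / sqrt 2)\<^sup>2"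
    by (metis abs_ge_zero power2_abs power_mono)+
  then have "(cmod z)\<^sup>2 \<le> u\<^sup>2" by (simp add: cmod_power2 power_divide)
  then show False using assms by (simp add: power2_le_iff_abs_le)
qed

text \<open>
  If \<open>\<bar>z\<bar> > u\<close>, one of the four numbers \<open>\<plusminus>Re z\<close>, \<open>\<plusminus>Im z\<close> is at least \<open>u/\<surd>2\<close>.
\<close>

lemma prob_char_sum_large_le:
  assumes J: "finite J" "J \<noteq> {}" and p: "p < d" "h p \<noteq> 0" and u: "0 < u"
  shows "{\<omega> \<in> space (shift_measure d). u < cmod (\<Sum>r\<in>J. fourier_char d h (\<omega> r))} \<in> sets (shift_measure d)"
    and "measure (shift_measure d) {\<omega> \<in> space (shift_measure d). u < cmod (\<Sum>r\<in>J. fourier_char d h (\<omega> r))}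
      \<le> 4 * exp (- (u\<^sup>2 / (2 * real (card J))))"
proof -
  interpret Q: prob_space "shift_measure d" by (rule prob_space_shift_measure)
  let ?Z = "\<lambda>\<omega>. \<Sum>r\<in>J. fourier_char d h (\<omega> r)"
  let ?E = "\<lambda>c. {\<omega> \<in> space (shift_measure d). u / sqrt 2 \<le> Re (c * ?Z \<omega>)}"
  have Z: "?Z \<in> borel_measurable (shift_measure d)"
    using measurable_shift_fourier_char[of d h] by measurable
  then show "{\<omega> \<in> space (shift_measure d). u < cmod (?Z \<omega>)} \<in> sets (shift_measure d)"
    by measurable
  have E: "?E c \<in> sets (shift_measure d)" for c using Z by measurable
  have sub: "{\<omega> \<in> space (shift_measure d). u < cmod (?Z \<omega>)} \<subseteq> (\<Union>c\<in>{1, \<i>, - 1, - \<i>}. ?E c)"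
  proof
    fix \<omega> assume \<omega>: "\<omega> \<in> {\<omega> \<in> space (shift_measure d). u < cmod (?Z \<omega>)}"
    then obtain c where "c \<in> {1, \<i>, - 1, - \<i>}" "u / sqrt 2 \<le> Re (c * ?Z \<omega>)"
      using cmod_gt_imp_quarter[OF _ u, of "?Z \<omega>"] by blast
    then show "\<omega> \<in> (\<Union>c\<in>{1, \<i>, - 1, - \<i>}. ?E c)" using \<omega> by blast
  qed
  have "(\<Union>c\<in>{1, \<i>, - 1, - \<i>}. ?E c) \<in> sets (shift_measure d)"
    using E by (intro sets.finite_UN) auto
  with sub have "measure (shift_measure d) {\<omega> \<in> space (shift_measure d). u < cmod (?Z \<omega>)}
      \<le> measure (shift_measure d) (\<Union>c\<in>{1, \<i>, - 1, - \<i>}. ?E c)"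
    by (rule Q.finite_measure_mono)
  also have "\<dots> \<le> (\<Sum>c\<in>{1, \<i>, - 1, - \<i>}. measure (shift_measure d) (?E c))"
    using E by (intro measure_UNION_le) auto
  also have "\<dots> \<le> (\<Sum>c\<in>{1, \<i>, - 1, - \<i> :: complex}. exp (- (u\<^sup>2 / (2 * real (card J)))))"
  proof (intro sum_mono)
    fix c :: complex assume "c \<in> {1, \<i>, - 1, - \<i>}"
    then have "cmod c = 1" by auto
    then show "measure (shift_measure d) (?E c) \<le> exp (- (u\<^sup>2 / (2 * real (card J))))"
      using prob_Re_char_sum_ge[of J p d h c "u / sqrt 2", OF J p] u by (simp add: power_divide)
  qed
  also have "\<dots> = real (card {1, \<i>, - 1, - \<i>}) * exp (- (u\<^sup>2 / (2 * real (card J))))" by simp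
  also have "\<dots> \<le> real 4 * exp (- (u\<^sup>2 / (2 * real (card J))))"
    by (intro mult_right_mono) (simp_all add: card_insert_if)
  finally show "measure (shift_measure d) {\<omega> \<in> space (shift_measure d). u < cmod (?Z \<omega>)}
      \<le> 4 * exp (- (u\<^sup>2 / (2 * real (card J))))" by simp
qed

section \<open>Gram matrices of random shifts\<close>

lemma l2norm_power2_eq: "(l2norm n u)\<^sup>2 = (\<Sum>i<n. (cmod (u i))\<^sup>2)"
  by (simp add: l2norm_def L2_set_def sum_nonneg)

lemma sum_remove_square_le:
  fixes x :: "nat \<Rightarrow> real"
  assumes "i < n"
  shows "(\<Sum>j\<in>{..<n} - {i}. \<bar>x j\<bar>)\<^sup>2 \<le> real (n - 1) * ((\<Sum>j<n. (x j)\<^sup>2) - (x i)\<^sup>2)"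
proof -
  let ?A = "{..<n} - {i}"
  have "(\<Sum>j\<in>?A. \<bar>x j\<bar>) \<le> sqrt (real (n - 1)) * L2_set x ?A"
    using L2_set_mult_ineq[of "\<lambda>_. 1" x ?A] assms by (simp add: L2_set_constant)
  then have "(\<Sum>j\<in>?A. \<bar>x j\<bar>)\<^sup>2 \<le> (sqrt (real (n - 1)) * L2_set x ?A)\<^sup>2"
    by (intro power_mono sum_nonneg) auto
  also have "\<dots> = real (n - 1) * (\<Sum>j\<in>?A. (x j)\<^sup>2)"
    by (simp add: power_mult_distrib L2_set_def sum_nonneg)
  also have "(\<Sum>j\<in>?A. (x j)\<^sup>2) = (\<Sum>j<n. (x j)\<^sup>2) - (x i)\<^sup>2"
    using assms by (subst sum_diff1) auto
  finally show ?thesis .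
qed

text \<open>
  The off-diagonal part has operator norm at most \<open>(n - 1) S\<close>, as the matrix with all off-diagonal
  entries equal to \<open>S\<close> has.
\<close>

lemma diagonally_dominant_lower_bound:
  fixes G :: "nat \<Rightarrow> nat \<Rightarrow> complex"
  assumes S: "0 \<le> S"
    and diag: "\<And>i. i < n \<Longrightarrow> G i i = of_real (real n * S)"
    and off: "\<And>i j. i < n \<Longrightarrow> j < n \<Longrightarrow> i \<noteq> j \<Longrightarrow> cmod (G i j) \<le> S"
  shows "S * l2norm n v \<le> l2norm n (\<lambda>i. \<Sum>j<n. G i j * v j)"
proof (cases "n = 0")
  case False
  define E where "E i = (\<Sum>j\<in>{..<n} - {i}. G i j * v j)" for i
  define V where "V = (\<Sum>j<n. (cmod (v j))\<^sup>2)"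
  have row: "(\<Sum>j<n. G i j * v j) = of_real (real n * S) * v i + E i" if "i < n" for i
    using that diag[OF that] by (subst sum.remove[of _ i]) (auto simp: E_def)
  have "(l2norm n E)\<^sup>2 = (\<Sum>i<n. (cmod (E i))\<^sup>2)" by (rule l2norm_power2_eq)
  also have "\<dots> \<le> (\<Sum>i<n. S\<^sup>2 * (real (n - 1) * (V - (cmod (v i))\<^sup>2)))"
  proof (intro sum_mono)
    fix i assume "i \<in> {..<n}"
    then have i: "i < n" by simp
    have "cmod (E i) \<le> (\<Sum>j\<in>{..<n} - {i}. cmod (G i j * v j))" unfolding E_def by (rule norm_sum)
    also have "\<dots> \<le> (\<Sum>j\<in>{..<n} - {i}. S * \<bar>cmod (v j)\<bar>)"
      using off[OF i] by (intro sum_mono) (auto simp: norm_mult intro!: mult_right_mono)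
    also have "\<dots> = S * (\<Sum>j\<in>{..<n} - {i}. \<bar>cmod (v j)\<bar>)" by (simp only: sum_distrib_left)
    finally have "(cmod (E i))\<^sup>2 \<le> (S * (\<Sum>j\<in>{..<n} - {i}. \<bar>cmod (v j)\<bar>))\<^sup>2"
      by (intro power_mono) auto
    also have "\<dots> = S\<^sup>2 * (\<Sum>j\<in>{..<n} - {i}. \<bar>cmod (v j)\<bar>)\<^sup>2" by (simp only: power_mult_distrib)
    also have "\<dots> \<le> S\<^sup>2 * (real (n - 1) * (V - (cmod (v i))\<^sup>2))"
      unfolding V_def by (intro mult_left_mono sum_remove_square_le i) auto
    finally show "(cmod (E i))\<^sup>2 \<le> S\<^sup>2 * (real (n - 1) * (V - (cmod (v i))\<^sup>2))" .
  qed
  also have "\<dots> = S\<^sup>2 * (real (n - 1) * (real n * V - V))"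
  proof -
    have "(\<Sum>i<n. V - (cmod (v i))\<^sup>2) = real n * V - V"
      by (simp add: sum_subtractf flip: V_def)
    then show ?thesis by (simp only: sum_distrib_left[symmetric])
  qed
  also have "\<dots> = (S * real (n - 1) * l2norm n v)\<^sup>2"
  proof -
    have "real n * V - V = real (n - 1) * V" using False by (simp add: of_nat_diff algebra_simps)
    moreover have "V = (l2norm n v)\<^sup>2" by (simp add: V_def l2norm_power2_eq)
    ultimately show ?thesis by (simp add: power2_eq_square)
  qed
  finally have E: "l2norm n E \<le> S * real (n - 1) * l2norm n v"
    using S by (intro power2_le_imp_le[of "l2norm n E"]) auto
  have "real n * S * l2norm n v = l2norm n (\<lambda>i. of_real (real n * S) * v i)"
    unfolding l2norm_scale using S by (simp add: norm_mult)
  also have "\<dots> \<le> L2_set (\<lambda>i. cmod (\<Sum>j<n. G i j * v j) + cmod (E i)) {..<n}"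
    unfolding l2norm_def
  proof (intro L2_set_mono)
    fix i assume "i \<in> {..<n}"
    then have "of_real (real n * S) * v i = (\<Sum>j<n. G i j * v j) - E i" using row[of i] by simp
    then show "cmod (of_real (real n * S) * v i) \<le> cmod (\<Sum>j<n. G i j * v j) + cmod (E i)"
      by (simp add: norm_triangle_ineq4)
  qed auto
  also have "\<dots> \<le> l2norm n (\<lambda>i. \<Sum>j<n. G i j * v j) + l2norm n E"
    unfolding l2norm_def by (rule L2_set_triangle_ineq)
  finally have "real n * S * l2norm n v \<le> l2norm n (\<lambda>i. \<Sum>j<n. G i j * v j) + S * real (n - 1) * l2norm n v"
    using E by linarith
  moreover have "real n * S * l2norm n v - S * real (n - 1) * l2norm n v = S * l2norm n v"
    using False by (simp add: of_nat_diff algebra_simps)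
  ultimately show ?thesis by linarith
qed (simp add: l2norm_def)

lemma l2norm_limit:
  assumes "\<And>i. i < n \<Longrightarrow> (\<lambda>m. u m i) \<longlonglongrightarrow> v i"
  shows "(\<lambda>m. l2norm n (u m)) \<longlonglongrightarrow> l2norm n v"
  unfolding l2norm_def L2_set_def using assms by (intro tendsto_intros) auto

text \<open>
  Both sides are continuous in the vector. Restricting to a countable dense set of entries is what
  makes the event of good shifts measurable.
\<close>

lemma lower_bound_countable:
  assumes D: "\<And>X. open X \<Longrightarrow> X \<noteq> {} \<Longrightarrow> \<exists>z\<in>D. z \<in> X"
  shows "(\<forall>v. S * l2norm n v \<le> l2norm n (\<lambda>i. \<Sum>j<n. G i j * v j))
    \<longleftrightarrow> (\<forall>v\<in>{..<n} \<rightarrow>\<^sub>E D. S * l2norm n v \<le> l2norm n (\<lambda>i. \<Sum>j<n. G i j * v j))"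
proof (intro iffI allI)
  fix v :: "nat \<Rightarrow> complex"
  assume le: "\<forall>v\<in>{..<n} \<rightarrow>\<^sub>E D. S * l2norm n v \<le> l2norm n (\<lambda>i. \<Sum>j<n. G i j * v j)"
  define a where "a m i = (SOME z. z \<in> D \<and> dist z (v i) < 1 / real (Suc m))" for m i
  have "\<exists>z. z \<in> D \<and> dist z (v i) < 1 / real (Suc m)" for m i
    using D[of "ball (v i) (1 / real (Suc m))"] by (auto simp: dist_commute)
  then have "a m i \<in> D \<and> dist (a m i) (v i) < 1 / real (Suc m)" for m i
    unfolding a_def by (rule someI_ex)
  then have a: "\<And>m i. a m i \<in> D" "\<And>m i. dist (a m i) (v i) < 1 / real (Suc m)"
    by blast+
  have lim: "(\<lambda>m. a m i) \<longlonglongrightarrow> v i" for i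
  proof (rule metric_LIMSEQ_I)
    fix r :: real assume "0 < r"
    then obtain M where M: "1 / real (Suc M) < r" using nat_approx_posE by blast
    have "dist (a m i) (v i) < r" if "M \<le> m" for m
    proof -
      have "1 / real (Suc m) \<le> 1 / real (Suc M)" using that by (intro divide_left_mono) auto
      then show ?thesis using a(2)[of m i] M by linarith
    qed
    then show "\<exists>M. \<forall>m\<ge>M. dist (a m i) (v i) < r" by blast
  qed
  show "S * l2norm n v \<le> l2norm n (\<lambda>i. \<Sum>j<n. G i j * v j)"
  proof (rule LIMSEQ_le)
    show "(\<lambda>m. S * l2norm n (a m)) \<longlonglongrightarrow> S * l2norm n v"
      using lim by (intro tendsto_mult_left l2norm_limit)
    show "(\<lambda>m. l2norm n (\<lambda>i. \<Sum>j<n. G i j * a m j)) \<longlonglongrightarrow> l2norm n (\<lambda>i. \<Sum>j<n. G i j * v j)"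
      using lim by (intro l2norm_limit tendsto_sum tendsto_mult_left)
    have "S * l2norm n (a m) \<le> l2norm n (\<lambda>i. \<Sum>j<n. G i j * a m j)" for m
    proof -
      let ?a = "restrict (a m) {..<n}"
      have "?a \<in> {..<n} \<rightarrow>\<^sub>E D" using a(1) by simp
      then have "S * l2norm n ?a \<le> l2norm n (\<lambda>i. \<Sum>j<n. G i j * ?a j)" using le by blast
      moreover have "l2norm n ?a = l2norm n (a m)" by (intro l2norm_cong) simp
      moreover have "(\<Sum>j<n. G i j * ?a j) = (\<Sum>j<n. G i j * a m j)" for i by (intro sum.cong) auto
      ultimately show ?thesis by simp
    qed
    then show "\<exists>M. \<forall>m\<ge>M. S * l2norm n (a m) \<le> l2norm n (\<lambda>i. \<Sum>j<n. G i j * a m j)" by blast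
  qed
qed auto

lemma good_shifts_iff:
  assumes "0 < S"
  shows "good_shifts d S y L \<longleftrightarrow> (\<forall>j<length L. \<forall>v. real S * l2norm (length (L ! j)) v
    \<le> l2norm (length (L ! j)) (\<lambda>i. \<Sum>i'<length (L ! j). gram_matrix d S y (L ! j) $$ (i, i') * v i'))"
  unfolding good_shifts_def using assms inverse_norm_le_iff[OF gram_matrix_carrier, of "real S" d S y] by simp

lemma gram_matrix_char:
  assumes "i < length ls" "j < length ls" "0 < S"
  shows "gram_matrix d S y ls $$ (i, j)
    = (\<Sum>p\<in>(\<lambda>r. (r div S, r mod S)) ` {..<length ls * S}. fourier_char d (\<lambda>t. (ls ! j) t - (ls ! i) t) (y p))"
proof -
  have inj: "inj_on (\<lambda>r. (r div S, r mod S)) {..<length ls * S}"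
    by (rule inj_onI) (metis div_mult_mod_eq prod.inject)
  have "cnj (fourier_char d k x) * fourier_char d k' x = fourier_char d (\<lambda>t. k' t - k t) x" for k k' x
    by (simp add: fourier_char_cis cis_cnj cis_mult dot_def sum_subtractf algebra_simps)
  then have "gram_matrix d S y ls $$ (i, j)
      = (\<Sum>r<length ls * S. fourier_char d (\<lambda>t. (ls ! j) t - (ls ! i) t) (y (r div S, r mod S)))"
    using assms by (simp add: gram_matrix_index shift_matrix_def)
  then show ?thesis using inj by (simp add: sum.reindex)
qed

lemma measurable_gram_entry:
  assumes "i < length ls" "j < length ls" "0 < S"
  shows "(\<lambda>\<omega>. gram_matrix d S \<omega> ls $$ (i, j)) \<in> borel_measurable (shift_measure d)"
  unfolding gram_matrix_char[OF assms] by (intro borel_measurable_sum measurable_shift_fourier_char)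

lemma good_shifts_measurable:
  assumes "0 < S"
  shows "{\<omega> \<in> space (shift_measure d). good_shifts d S \<omega> L} \<in> sets (shift_measure d)"
proof (rule countable_dense_setE)
  fix D :: "complex set"
  assume D: "countable D" "\<And>X. open X \<Longrightarrow> X \<noteq> {} \<Longrightarrow> \<exists>z\<in>D. z \<in> X"
  have meas: "{\<omega> \<in> space (shift_measure d). \<forall>j\<in>{..<length L}. \<forall>v\<in>{..<length (L ! j)} \<rightarrow>\<^sub>E D.
      real S * l2norm (length (L ! j)) v
      \<le> l2norm (length (L ! j)) (\<lambda>i. \<Sum>i'<length (L ! j). gram_matrix d S \<omega> (L ! j) $$ (i, i') * v i')}
      \<in> sets (shift_measure d)"
  proof (intro sets.sets_Collect_countable_All')
    fix j v assume "j \<in> {..<length L}" "v \<in> {..<length (L ! j)} \<rightarrow>\<^sub>E D"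
    let ?n = "length (L ! j)"
    let ?row = "\<lambda>\<omega> i. \<Sum>i'<?n. gram_matrix d S \<omega> (L ! j) $$ (i, i') * v i'"
    have "(\<lambda>\<omega>. ?row \<omega> i) \<in> borel_measurable (shift_measure d)" if "i < ?n" for i
      using that assms by (intro borel_measurable_sum borel_measurable_times measurable_gram_entry) auto
    then have "(\<lambda>\<omega>. \<Sum>i<?n. (cmod (?row \<omega> i))\<^sup>2) \<in> borel_measurable (shift_measure d)"
      by (intro borel_measurable_sum borel_measurable_power borel_measurable_norm) auto
    moreover have "sqrt \<in> borel_measurable borel"
      by (intro borel_measurable_continuous_onI continuous_on_real_sqrt continuous_on_id)
    ultimately have "(\<lambda>\<omega>. l2norm ?n (?row \<omega>)) \<in> borel_measurable (shift_measure d)"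
      unfolding l2norm_def L2_set_def by (rule measurable_compose)
    then show "{\<omega> \<in> space (shift_measure d). real S * l2norm ?n v
        \<le> l2norm ?n (\<lambda>i. \<Sum>i'<?n. gram_matrix d S \<omega> (L ! j) $$ (i, i') * v i')} \<in> sets (shift_measure d)"
      by measurable
  qed (use D(1) in \<open>auto intro: countable_PiE\<close>)
  have dense: "(\<forall>v. real S * l2norm n v \<le> l2norm n (\<lambda>i. \<Sum>i'<n. G i i' * v i'))
      \<longleftrightarrow> (\<forall>v\<in>{..<n} \<rightarrow>\<^sub>E D. real S * l2norm n v \<le> l2norm n (\<lambda>i. \<Sum>i'<n. G i i' * v i'))"
    for n and G :: "nat \<Rightarrow> nat \<Rightarrow> complex"
    by (rule lower_bound_countable) (rule D(2))
  have "good_shifts d S \<omega> L \<longleftrightarrow> (\<forall>j\<in>{..<length L}. \<forall>v\<in>{..<length (L ! j)} \<rightarrow>\<^sub>E D.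
      real S * l2norm (length (L ! j)) v
      \<le> l2norm (length (L ! j)) (\<lambda>i. \<Sum>i'<length (L ! j). gram_matrix d S \<omega> (L ! j) $$ (i, i') * v i'))" for \<omega>
    unfolding good_shifts_iff[OF assms] dense by auto
  then show ?thesis using meas by simp
qed

lemma good_shifts_if_small_off_diagonal:
  assumes S: "0 < S"
    and off: "\<And>j i i'. j < length L \<Longrightarrow> i < i' \<Longrightarrow> i' < length (L ! j)
      \<Longrightarrow> cmod (gram_matrix d S y (L ! j) $$ (i, i')) \<le> real S"
  shows "good_shifts d S y L"
  unfolding good_shifts_iff[OF S]
proof (intro allI impI)
  fix j v assume j: "j < length L"
  let ?G = "gram_matrix d S y (L ! j)" and ?n = "length (L ! j)"
  have herm: "?G $$ (i, i') = cnj (?G $$ (i', i))" if "i < ?n" "i' < ?n" for i i'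
    using that by (simp add: gram_matrix_index mult.commute)
  show "real S * l2norm ?n v \<le> l2norm ?n (\<lambda>i. \<Sum>i'<?n. ?G $$ (i, i') * v i')"
  proof (rule diagonally_dominant_lower_bound)
    fix i assume i: "i < ?n"
    have "cnj (fourier_char d k x) * fourier_char d k x = 1" for k x
      by (simp add: fourier_char_cis cis_cnj cis_mult)
    then show "?G $$ (i, i) = of_real (real ?n * real S)"
      using i by (simp add: gram_matrix_index shift_matrix_def)
    fix i' assume i': "i' < ?n" "i \<noteq> i'"
    show "cmod (?G $$ (i, i')) \<le> real S"
    proof (cases "i < i'")
      case True
      then show ?thesis using off[OF j] i' by blast
    next
      case False
      then have "cmod (?G $$ (i', i)) \<le> real S" using off[OF j, of i' i] i i' by simp
      then show ?thesis using herm[OF i i'(1)] by simp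
    qed
  qed simp
qed

context korobov
begin

text \<open>
  Different fibers belong to different residues modulo \<open>N\<close>.
\<close>

lemma length_fiber_enumeration_le:
  assumes "0 < N" "fiber_enumeration d \<alpha> \<gamma> N M g L"
  shows "length L \<le> N"
proof -
  obtain l where l: "\<And>i j. i < length L \<Longrightarrow> j < length L \<Longrightarrow> [dot d (l i) g = dot d (l j) g] (mod int N) \<Longrightarrow> i = j"
    using fiber_enumeration_fibers[OF assms(2)] by metis
  have "inj_on (\<lambda>j. dot d (l j) g mod int N) {..<length L}"
    using l by (intro inj_onI) (auto simp: cong_def)
  then have "card {..<length L} \<le> card {0..<int N}"
    by (rule card_inj_on_le) (use assms(1) in auto)
  then show ?thesis by simp
qed

text \<open>
  A fiber with \<open>v\<close> elements has Gram entries that are sums of \<open>v S\<close> terms, so one of them exceeds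
  \<open>S\<close> with probability at most \<open>4 exp (-S/(2v))\<close>, and \<open>S \<ge> 2 K R ln N\<close> with \<open>v \<le> R\<close> turns this
  into \<open>4 N\<^sup>-\<^sup>K\<close>. By symmetry only pairs \<open>i < i'\<close> have to be considered.
\<close>

lemma prob_good_shifts_ge:
  assumes K: "1 < K" and N: "2 < N" and M: "1 < M" and L: "fiber_enumeration d \<alpha> \<gamma> N M g L"
    and R: "max_fiber d \<alpha> \<gamma> N M g \<le> R\<^sub>0"
  defines "S \<equiv> num_shifts K N (max_fiber d \<alpha> \<gamma> N M g)"
  shows "1 - 2 * real N powr (1 - K) * (real R\<^sub>0)\<^sup>2
    \<le> measure (shift_measure d) {\<omega> \<in> space (shift_measure d). good_shifts d S \<omega> L}"
proof -
  interpret Q: prob_space "shift_measure d" by (rule prob_space_shift_measure)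
  define R where "R = max_fiber d \<alpha> \<gamma> N M g"
  have R1: "1 \<le> R" using max_fiber_pos[OF M] by (simp add: R_def)
  have S: "0 < S" "2 * K * real R * ln (real N) \<le> real S"
    using num_shifts_bounds[OF K N R1] by (auto simp: S_def R_def)
  let ?E = "\<lambda>j i i'. {\<omega> \<in> space (shift_measure d). real S < cmod (gram_matrix d S \<omega> (L ! j) $$ (i, i'))}"
  define I where "I = (SIGMA j:{..<length L}. SIGMA i':{..<length (L ! j)}. {..<i'})"
  have finI: "finite I" by (simp add: I_def)
  have single: "?E j i i' \<in> sets (shift_measure d)"
    "measure (shift_measure d) (?E j i i') \<le> 4 * real N powr (- K)"
    if j: "j < length L" and i: "i < i'" "i' < length (L ! j)" for j i i'
  proof -
    let ?ls = "L ! j" and ?J = "(\<lambda>r. (r div S, r mod S)) ` {..<length (L ! j) * S}"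
    let ?h = "\<lambda>t. (?ls ! i') t - (?ls ! i) t"
    define n where "n = length ?ls"
    have n: "0 < n" "n \<le> R"
      using i length_fiber_le_max_fiber[OF L j] by (auto simp: n_def R_def)
    have "inj_on (\<lambda>r. (r div S, r mod S)) {..<length ?ls * S}"
      by (rule inj_onI) (metis div_mult_mod_eq prod.inject)
    then have cardJ: "card ?J = n * S" by (simp add: card_image n_def)
    have J: "finite ?J" "?J \<noteq> {}" using n S(1) by (simp_all add: n_def lessThan_empty_iff)
    have "distinct ?ls" using L j by (simp add: fiber_enumeration_def)
    then have ne: "?ls ! i \<noteq> ?ls ! i'" using i by (simp add: nth_eq_iff_index_eq)
    have "set ?ls \<subseteq> freq_set d \<alpha> \<gamma> M" using L j unfolding fiber_enumeration_def by blast
    moreover have "?ls ! i \<in> set ?ls" "?ls ! i' \<in> set ?ls" using i by simp_all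
    ultimately have vecs: "?ls ! i \<in> int_vecs d" "?ls ! i' \<in> int_vecs d"
      by (auto simp: freq_set_def)
    have "\<exists>p<d. ?h p \<noteq> 0"
    proof (rule ccontr)
      assume "\<not> (\<exists>p<d. ?h p \<noteq> 0)"
      then have "\<And>t. t \<in> {..<d} \<Longrightarrow> (?ls ! i) t = (?ls ! i') t" by auto
      then show False
        using vecs ne PiE_ext[of "?ls ! i" "{..<d}" "\<lambda>_. UNIV" "?ls ! i'"] by (auto simp: int_vecs_def)
    qed
    then obtain p where p: "p < d" "?h p \<noteq> 0" by blast
    have E_eq: "?E j i i' = {\<omega> \<in> space (shift_measure d). real S < cmod (\<Sum>q\<in>?J. fourier_char d ?h (\<omega> q))}"
      using gram_matrix_char[of i ?ls i' S d] i S(1) by simp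
    have Spos: "0 < real S" using S(1) by simp
    show "?E j i i' \<in> sets (shift_measure d)"
      unfolding E_eq by (rule prob_char_sum_large_le(1)[where p = p]) (use J p Spos in auto)
    have "measure (shift_measure d) (?E j i i') \<le> 4 * exp (- ((real S)\<^sup>2 / (2 * real (card ?J))))"
      unfolding E_eq by (rule prob_char_sum_large_le(2)[where p = p]) (use J p Spos in auto)
    also have "(real S)\<^sup>2 / (2 * real (card ?J)) = real S / (2 * real n)"
      unfolding cardJ using S(1) n by (simp add: power2_eq_square)
    also have "4 * exp (- (real S / (2 * real n))) \<le> 4 * exp (- (K * ln (real N)))"
    proof -
      have "K * ln (real N) * (2 * real n) \<le> K * ln (real N) * (2 * real R)"
        using n K N by (intro mult_left_mono) auto
      also have "\<dots> \<le> real S" using S(2) by (simp add: mult_ac)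
      finally have "K * ln (real N) \<le> real S / (2 * real n)" using n by (simp add: pos_le_divide_eq)
      then show ?thesis by simp
    qed
    also have "exp (- (K * ln (real N))) = real N powr (- K)" using N by (simp add: powr_def)
    finally show "measure (shift_measure d) (?E j i i') \<le> 4 * real N powr (- K)" .
  qed
  let ?B = "\<Union>(j, i', i)\<in>I. ?E j i i'"
  have B: "?B \<in> sets (shift_measure d)"
    using finI single(1) by (intro sets.finite_UN) (auto simp: I_def)
  have "measure (shift_measure d) ?B \<le> (\<Sum>(j, i', i)\<in>I. measure (shift_measure d) (?E j i i'))"
    unfolding case_prod_unfold using finI single(1) by (intro measure_UNION_le) (auto simp: I_def)
  also have "\<dots> \<le> (\<Sum>(j, i', i)\<in>I. 4 * real N powr (- K))"
    using single(2) by (intro sum_mono) (auto simp: I_def)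
  also have "\<dots> = real (card I) * (4 * real N powr (- K))" by (simp add: case_prod_unfold)
  also have "\<dots> \<le> (real N * (real R\<^sub>0)\<^sup>2 / 2) * (4 * real N powr (- K))"
  proof (intro mult_right_mono)
    have "card I = (\<Sum>j<length L. \<Sum>i'<length (L ! j). i')"
      by (simp add: I_def card_SigmaI)
    also have "\<dots> \<le> (\<Sum>j<length L. R\<^sub>0 * (R\<^sub>0 - 1) div 2)"
    proof (intro sum_mono)
      fix j assume "j \<in> {..<length L}"
      then have "length (L ! j) \<le> R\<^sub>0" using length_fiber_le_max_fiber[OF L, of j] R by simp
      then have "(\<Sum>i'<length (L ! j). i') \<le> (\<Sum>i'<R\<^sub>0. i')" by (intro sum_mono2) auto
      also have "\<dots> = R\<^sub>0 * (R\<^sub>0 - 1) div 2"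
        using Sum_Ico_nat[of 0 R\<^sub>0] by (simp add: atLeast0LessThan)
      finally show "(\<Sum>i'<length (L ! j). i') \<le> R\<^sub>0 * (R\<^sub>0 - 1) div 2" .
    qed
    also have "\<dots> \<le> N * (R\<^sub>0 * (R\<^sub>0 - 1) div 2)"
      using length_fiber_enumeration_le[OF _ L] N by simp
    finally have "card I \<le> N * (R\<^sub>0 * (R\<^sub>0 - 1) div 2)" .
    moreover have "2 * (R\<^sub>0 * (R\<^sub>0 - 1) div 2) \<le> R\<^sub>0 * R\<^sub>0"
    proof -
      have "2 * (R\<^sub>0 * (R\<^sub>0 - 1) div 2) \<le> R\<^sub>0 * (R\<^sub>0 - 1)" by simp
      also have "\<dots> \<le> R\<^sub>0 * R\<^sub>0" by (intro mult_left_mono) auto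
      finally show ?thesis .
    qed
    ultimately have "2 * card I \<le> N * (R\<^sub>0 * R\<^sub>0)"
      by (metis (no_types, lifting) mult.left_commute mult_le_mono2 order_trans)
    then have "real (2 * card I) \<le> real (N * (R\<^sub>0 * R\<^sub>0))" by (simp only: of_nat_le_iff)
    then show "real (card I) \<le> real N * (real R\<^sub>0)\<^sup>2 / 2" by (simp add: power2_eq_square)
  qed simp
  also have "\<dots> = 2 * real N powr (1 - K) * (real R\<^sub>0)\<^sup>2"
  proof -
    have "real N powr (1 - K) = real N * real N powr (- K)"
      using N powr_add[of "real N" 1 "- K"] by simp
    then show ?thesis by simp
  qed
  finally have "measure (shift_measure d) ?B \<le> 2 * real N powr (1 - K) * (real R\<^sub>0)\<^sup>2" .
  moreover have "measure (shift_measure d) (space (shift_measure d) - ?B) = 1 - measure (shift_measure d) ?B"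
    using B by (rule Q.prob_compl)
  moreover have "measure (shift_measure d) (space (shift_measure d) - ?B)
      \<le> measure (shift_measure d) {\<omega> \<in> space (shift_measure d). good_shifts d S \<omega> L}"
  proof (rule Q.finite_measure_mono)
    show "space (shift_measure d) - ?B \<subseteq> {\<omega> \<in> space (shift_measure d). good_shifts d S \<omega> L}"
    proof
      fix \<omega> assume \<omega>: "\<omega> \<in> space (shift_measure d) - ?B"
      have "good_shifts d S \<omega> L"
      proof (rule good_shifts_if_small_off_diagonal[OF S(1)])
        fix j i i' assume "j < length L" "i < i'" "i' < length (L ! j)"
        then have "(j, i', i) \<in> I" by (simp add: I_def)
        then have "\<omega> \<notin> ?E j i i'" using \<omega> by blast
        then show "cmod (gram_matrix d S \<omega> (L ! j) $$ (i, i')) \<le> real S" using \<omega> by simp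
      qed
      then show "\<omega> \<in> {\<omega> \<in> space (shift_measure d). good_shifts d S \<omega> L}" using \<omega> by simp
    qed
  qed (rule good_shifts_measurable[OF S(1)])
  ultimately show ?thesis by linarith
qed

end

section \<open>The joint law of generator and shifts\<close>

lemma measure_uniform_pair:
  assumes "finite G" "G \<noteq> {}" "prob_space M" "H \<subseteq> G" and A: "\<And>g. g \<in> H \<Longrightarrow> A g \<in> sets M"
  shows "measure (uniform_count_measure G \<Otimes>\<^sub>M M) (SIGMA g:H. A g) = (\<Sum>g\<in>H. measure M (A g)) / real (card G)"
proof -
  interpret M: prob_space M by fact
  interpret G: prob_space "uniform_count_measure G" using assms by (intro prob_space_uniform_count_measure)
  interpret pair_prob_space "uniform_count_measure G" M by unfold_locales
  let ?P = "uniform_count_measure G \<Otimes>\<^sub>M M"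
  have fin: "finite H" using assms finite_subset by blast
  have rect: "{g} \<times> A g \<in> sets ?P" "measure ?P ({g} \<times> A g) = measure M (A g) / real (card G)" if g: "g \<in> H" for g
  proof -
    have gs: "{g} \<in> sets (uniform_count_measure G)"
      using g assms(4) by (auto simp: sets_uniform_count_measure)
    show "{g} \<times> A g \<in> sets ?P" using gs A[OF g] by (rule pair_measureI)
    have "emeasure ?P ({g} \<times> A g) = emeasure (uniform_count_measure G) {g} * emeasure M (A g)"
      using gs A[OF g] by (rule M.emeasure_pair_measure_Times)
    also have "\<dots> = ennreal (1 / real (card G) * measure M (A g))"
      using assms g by (subst emeasure_uniform_count_measure)
        (auto simp: M.emeasure_eq_measure ennreal_mult'[symmetric])
    finally show "measure ?P ({g} \<times> A g) = measure M (A g) / real (card G)"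
      by (simp add: measure_def)
  qed
  have "(SIGMA g:H. A g) = (\<Union>g\<in>H. {g} \<times> A g)" by auto
  also have "measure ?P \<dots> = (\<Sum>g\<in>H. measure ?P ({g} \<times> A g))"
    using fin rect(1) by (intro finite_measure_finite_Union) (auto simp: disjoint_family_on_def)
  also have "\<dots> = (\<Sum>g\<in>H. measure M (A g)) / real (card G)"
    using rect(2) by (simp add: sum_divide_distrib)
  finally show ?thesis .
qed

context korobov
begin

lemma joint_probabilities:
  assumes d: "1 \<le> d" and \<delta>: "0 < \<delta>" "\<delta> < 1" and K: "1 < K" and rs: "random_setting d \<alpha> \<gamma> \<delta> N M m\<^sub>0"
    and q: "q = 1 - 2 * real N powr (1 - K) * (real (R_star d m\<^sub>0))\<^sup>2" "0 < q"
    and L: "\<And>g. g \<in> gen_vecs d N \<Longrightarrow> fiber_enumeration d \<alpha> \<gamma> N M g (L g)"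
  defines "good_y \<equiv> \<lambda>\<omega>. good_shifts d (num_shifts K N (max_fiber d \<alpha> \<gamma> N M (fst \<omega>))) (snd \<omega>) (L (fst \<omega>))"
  shows "\<And>g\<^sub>0. g\<^sub>0 \<in> gen_vecs d N \<Longrightarrow> good_generator d \<alpha> \<gamma> N M m\<^sub>0 g\<^sub>0
      \<Longrightarrow> q \<le> \<P>(\<omega> in joint_measure d N. good_y \<omega> \<bar> fst \<omega> = g\<^sub>0)"
    and "\<delta> * q \<le> \<P>(\<omega> in joint_measure d N. good_generator d \<alpha> \<gamma> N M m\<^sub>0 (fst \<omega>) \<and> good_y \<omega>)"
proof -
  have N: "2 < N" and M: "1 < M" using rs by (auto simp: random_setting_def)
  interpret Q: prob_space "shift_measure d" by (rule prob_space_shift_measure)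
  let ?G = "gen_vecs d N"
  define Y where "Y g = {\<omega> \<in> space (shift_measure d). good_shifts d (num_shifts K N (max_fiber d \<alpha> \<gamma> N M g)) \<omega> (L g)}" for g
  have cardG: "0 < card ?G" using N by (simp add: card_gen_vecs)
  then have G: "?G \<noteq> {}" by auto
  have space: "space (joint_measure d N) = ?G \<times> space (shift_measure d)"
    by (simp add: joint_measure_def space_pair_measure space_uniform_count_measure)
  have Y: "Y g \<in> sets (shift_measure d)" for g
    unfolding Y_def using num_shifts_bounds(1)[OF K N max_fiber_pos[OF M, of N g]]
    by (intro good_shifts_measurable) auto
  have Yq: "q \<le> measure (shift_measure d) (Y g)" if "g \<in> ?G" "good_generator d \<alpha> \<gamma> N M m\<^sub>0 g" for g
    unfolding Y_def q(1) using that
    by (intro prob_good_shifts_ge[OF K N M L]) (auto simp: good_generator_def)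
  have pair: "measure (joint_measure d N) (SIGMA g:H. A g) = (\<Sum>g\<in>H. measure (shift_measure d) (A g)) / real (card ?G)"
    if "H \<subseteq> ?G" "\<And>g. g \<in> H \<Longrightarrow> A g \<in> sets (shift_measure d)" for H A
    unfolding joint_measure_def using that G
    by (intro measure_uniform_pair prob_space_shift_measure) auto
  show "q \<le> \<P>(\<omega> in joint_measure d N. good_y \<omega> \<bar> fst \<omega> = g\<^sub>0)"
    if g0: "g\<^sub>0 \<in> ?G" "good_generator d \<alpha> \<gamma> N M m\<^sub>0 g\<^sub>0" for g\<^sub>0
  proof -
    have "{\<omega> \<in> space (joint_measure d N). good_y \<omega> \<and> fst \<omega> = g\<^sub>0} = (SIGMA g:{g\<^sub>0}. Y g)"
      using g0 by (auto simp: space good_y_def Y_def)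
    then have num: "\<P>(\<omega> in joint_measure d N. good_y \<omega> \<and> fst \<omega> = g\<^sub>0) = measure (shift_measure d) (Y g\<^sub>0) / real (card ?G)"
      using pair[of "{g\<^sub>0}" Y] Y g0 by simp
    have "{\<omega> \<in> space (joint_measure d N). fst \<omega> = g\<^sub>0} = (SIGMA g:{g\<^sub>0}. space (shift_measure d))"
      using g0 by (auto simp: space)
    then have den: "\<P>(\<omega> in joint_measure d N. fst \<omega> = g\<^sub>0) = 1 / real (card ?G)"
      using pair[of "{g\<^sub>0}" "\<lambda>_. space (shift_measure d)"] g0 Q.prob_space by simp
    show ?thesis
      unfolding cond_prob_def num den using Yq[OF g0] G by simp
  qed
  let ?H = "{g \<in> ?G. good_generator d \<alpha> \<gamma> N M m\<^sub>0 g}"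
  have "\<delta> \<le> real (card ?H) / real (card ?G)"
    using prob_good_generator_ge[OF d \<delta> rs]
    by (simp add: space_uniform_count_measure measure_uniform_count_measure)
  then have "\<delta> * q \<le> real (card ?H) / real (card ?G) * q" using q(2) by (intro mult_right_mono) auto
  also have "\<dots> = (\<Sum>g\<in>?H. q) / real (card ?G)" by simp
  also have "\<dots> \<le> (\<Sum>g\<in>?H. measure (shift_measure d) (Y g)) / real (card ?G)"
    using Yq by (intro divide_right_mono sum_mono) auto
  also have "\<dots> = measure (joint_measure d N) (SIGMA g:?H. Y g)"
    using Y by (intro pair[symmetric]) auto
  also have "(SIGMA g:?H. Y g) = {\<omega> \<in> space (joint_measure d N). good_generator d \<alpha> \<gamma> N M m\<^sub>0 (fst \<omega>) \<and> good_y \<omega>}"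
    by (auto simp: space good_y_def Y_def)
  finally show "\<delta> * q \<le> \<P>(\<omega> in joint_measure d N. good_generator d \<alpha> \<gamma> N M m\<^sub>0 (fst \<omega>) \<and> good_y \<omega>)" .
qed

lemma dyadic_level_exists:
  assumes "1 < M"
  shows "\<exists>m\<^sub>0. dyadic_level \<alpha> M m\<^sub>0"
proof -
  have one: "1 < M powr (1 / \<alpha>)" using assms alpha_pos by (simp add: gr_one_powr)
  obtain n where n: "M powr (1 / \<alpha>) < 2 ^ n" using real_arch_pow[of 2 "M powr (1 / \<alpha>)"] by auto
  define m where "m = (LEAST n. M powr (1 / \<alpha>) \<le> 2 ^ n)"
  have m: "M powr (1 / \<alpha>) \<le> 2 ^ m"
    unfolding m_def by (rule LeastI[of _ n]) (use n in simp)
  have "m \<noteq> 0"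
  proof
    assume "m = 0"
    then show False using m one by simp
  qed
  then have "\<not> M powr (1 / \<alpha>) \<le> 2 ^ (m - 1)" unfolding m_def by (intro not_less_Least) (simp add: m_def)
  then show ?thesis using m \<open>m \<noteq> 0\<close> by (intro exI[of _ m]) (simp add: dyadic_level_def)
qed

end

section \<open>Success probability and convergence rate\<close>

theorem theorem1:
  fixes d :: nat and \<alpha> \<delta> K :: real and \<gamma> :: "nat \<Rightarrow> real"
  assumes "1 \<le> d" and "1 / 2 < \<alpha>"
    and "\<And>j. j < d \<Longrightarrow> 0 < \<gamma> j \<and> \<gamma> j \<le> 1"
    and "0 < \<delta>" and "\<delta> < 1" and "1 < K"
  shows
    "(\<forall>N M m\<^sub>0. random_setting d \<alpha> \<gamma> \<delta> N M m\<^sub>0 \<longrightarrow>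
        \<P>(g in uniform_count_measure (gen_vecs d N). good_generator d \<alpha> \<gamma> N M m\<^sub>0 g) \<ge> \<delta>)
     \<and>
     (\<exists>N\<^sub>0. \<forall>N\<ge>N\<^sub>0. \<forall>M m\<^sub>0. random_setting d \<alpha> \<gamma> \<delta> N M m\<^sub>0 \<longrightarrow>
        2 * real N powr (1 - K) * (real (R_star d m\<^sub>0))\<^sup>2 < 1)
     \<and>
     (\<forall>N M m\<^sub>0 L.
        random_setting d \<alpha> \<gamma> \<delta> N M m\<^sub>0 \<longrightarrow>
        2 * real N powr (1 - K) * (real (R_star d m\<^sub>0))\<^sup>2 < 1 \<longrightarrow>
        (\<forall>g\<in>gen_vecs d N. fiber_enumeration d \<alpha> \<gamma> N M g (L g)) \<longrightarrow>
        (\<forall>g\<^sub>0\<in>gen_vecs d N. good_generator d \<alpha> \<gamma> N M m\<^sub>0 g\<^sub>0 \<longrightarrow>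
           \<P>(\<omega> in joint_measure d N.
               good_shifts d (num_shifts K N (max_fiber d \<alpha> \<gamma> N M (fst \<omega>))) (snd \<omega>) (L (fst \<omega>))
               \<bar> fst \<omega> = g\<^sub>0)
             \<ge> 1 - 2 * real N powr (1 - K) * (real (R_star d m\<^sub>0))\<^sup>2) \<and>
        \<P>(\<omega> in joint_measure d N. good_generator d \<alpha> \<gamma> N M m\<^sub>0 (fst \<omega>) \<and>
            good_shifts d (num_shifts K N (max_fiber d \<alpha> \<gamma> N M (fst \<omega>))) (snd \<omega>) (L (fst \<omega>)))
          \<ge> \<delta> * (1 - 2 * real N powr (1 - K) * (real (R_star d m\<^sub>0))\<^sup>2) \<and>
        \<delta> * (1 - 2 * real N powr (1 - K) * (real (R_star d m\<^sub>0))\<^sup>2) > 0)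
     \<and>
     (\<forall>\<tau>\<in>{0<..1}. \<exists>C.
        (\<forall>N M m\<^sub>0 g L R S y.
           random_setting d \<alpha> \<gamma> \<delta> N M m\<^sub>0 \<longrightarrow>
           g \<in> gen_vecs d N \<longrightarrow>
           fiber_enumeration d \<alpha> \<gamma> N M g L \<longrightarrow>
           R = max_fiber d \<alpha> \<gamma> N M g \<longrightarrow>
           S = num_shifts K N R \<longrightarrow>
           (\<forall>m<R. \<forall>s<S. y (m, s) \<in> unit_cube d) \<longrightarrow>
           good_generator d \<alpha> \<gamma> N M m\<^sub>0 g \<longrightarrow>
           good_shifts d S y L \<longrightarrow>
           worst_case_error (lattice_algorithm d \<alpha> \<gamma> N M g L S y) d \<alpha> \<gamma>
             \<le> ereal (C * real (N * R * S) powr (- \<alpha> + 1 / 2 + \<tau>)))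
        \<and>
        (\<forall>N M g L R S y.
           \<alpha> \<in> \<nat> \<longrightarrow>
           prime N \<longrightarrow> 2 < N \<longrightarrow>
           M = cbc_threshold d \<alpha> \<gamma> N \<longrightarrow> 1 < M \<longrightarrow>
           cbc_output d \<alpha> \<gamma> N g \<longrightarrow>
           fiber_enumeration d \<alpha> \<gamma> N M g L \<longrightarrow>
           R = max_fiber d \<alpha> \<gamma> N M g \<longrightarrow>
           S = num_shifts K N R \<longrightarrow>
           (\<forall>m<R. \<forall>s<S. y (m, s) \<in> unit_cube d) \<longrightarrow>
           good_shifts d S y L \<longrightarrow>
           worst_case_error (lattice_algorithm d \<alpha> \<gamma> N M g L S y) d \<alpha> \<gamma>
             \<le> ereal (C * real (N * R * S) powr (- \<alpha> + 1 / 2 + \<tau>))))"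
proof -
  interpret korobov d \<alpha> \<gamma> using assms by unfold_locales auto
  show ?thesis
    (is "?generators \<and> ?small \<and> (\<forall>N M m\<^sub>0 L. ?setting N M m\<^sub>0 \<longrightarrow> ?lt N m\<^sub>0 \<longrightarrow> ?enum N M L \<longrightarrow> ?shifts N M m\<^sub>0 L)
      \<and> (\<forall>\<tau>\<in>_. \<exists>C. ?random \<tau> C \<and> ?cbc \<tau> C)")
  proof (intro conjI)
    show ?generators using prob_good_generator_ge[OF assms(1,4,5)] by blast
    show ?small by (rule eventually_failure_bound_less_1[OF assms(1,4-6)])
    show "\<forall>N M m\<^sub>0 L. ?setting N M m\<^sub>0 \<longrightarrow> ?lt N m\<^sub>0 \<longrightarrow> ?enum N M L \<longrightarrow> ?shifts N M m\<^sub>0 L"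
    proof (intro allI impI)
      fix N M m\<^sub>0 L
      assume rs: "?setting N M m\<^sub>0" and lt: "?lt N m\<^sub>0" and L: "?enum N M L"
      define q where "q = 1 - 2 * real N powr (1 - K) * (real (R_star d m\<^sub>0))\<^sup>2"
      have q: "0 < q" using lt by (simp add: q_def)
      note joint = joint_probabilities[OF assms(1,4-6) rs q_def q, of L]
      show "?shifts N M m\<^sub>0 L"
        unfolding q_def[symmetric] using joint L q assms(4) by simp
    qed
    show "\<forall>\<tau>\<in>{0<..1}. \<exists>C. ?random \<tau> C \<and> ?cbc \<tau> C"
    proof
      fix \<tau> :: real assume "\<tau> \<in> {0<..1}"
      then have \<tau>: "0 < \<tau>" by simp
      \<comment> \<open>Both thresholds have \<open>c \<ge> c\<^sub>0 N\<close>: the random one because \<open>N - 1 \<ge> N/2\<close>, the other one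
        because \<open>c = N/2\<close>.\<close>
      define c\<^sub>0 where "c\<^sub>0 = (1 - \<delta>) / 2"
      have c0: "0 < c\<^sub>0" "c\<^sub>0 \<le> 1 / 2" using assms(4,5) by (auto simp: c\<^sub>0_def)
      obtain C where C: "\<And>N c m\<^sub>0 g L R S y. 2 < N \<Longrightarrow> c\<^sub>0 * real N \<le> c \<Longrightarrow> c \<le> real N \<Longrightarrow>
          1 < threshold d \<alpha> \<gamma> c \<Longrightarrow> dyadic_level \<alpha> (threshold d \<alpha> \<gamma> c) m\<^sub>0 \<Longrightarrow>
          fiber_enumeration d \<alpha> \<gamma> N (threshold d \<alpha> \<gamma> c) g L \<Longrightarrow>
          R = max_fiber d \<alpha> \<gamma> N (threshold d \<alpha> \<gamma> c) g \<Longrightarrow> R \<le> R_star d m\<^sub>0 \<Longrightarrow>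
          S = num_shifts K N R \<Longrightarrow> good_shifts d S y L \<Longrightarrow>
          worst_case_error (lattice_algorithm d \<alpha> \<gamma> N (threshold d \<alpha> \<gamma> c) g L S y) d \<alpha> \<gamma>
            \<le> ereal (C * real (N * R * S) powr (- \<alpha> + 1 / 2 + \<tau>))"
        using worst_case_error_rate[OF assms(1,6) \<tau> c0(1)] by metis
      show "\<exists>C. ?random \<tau> C \<and> ?cbc \<tau> C"
      proof (intro exI[of _ C] conjI allI impI)
        fix N M m\<^sub>0 g L R S y
        assume rs: "random_setting d \<alpha> \<gamma> \<delta> N M m\<^sub>0" and L: "fiber_enumeration d \<alpha> \<gamma> N M g L"
          and R: "R = max_fiber d \<alpha> \<gamma> N M g" and S: "S = num_shifts K N R"
          and good: "good_generator d \<alpha> \<gamma> N M m\<^sub>0 g" "good_shifts d S y L"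
        note th = random_setting_threshold[OF assms(4,5) rs]
        have "2 < N" "1 < M" "dyadic_level \<alpha> M m\<^sub>0" using rs by (auto simp: random_setting_def)
        moreover have "R \<le> R_star d m\<^sub>0" using good(1) R by (simp add: good_generator_def)
        ultimately show "worst_case_error (lattice_algorithm d \<alpha> \<gamma> N M g L S y) d \<alpha> \<gamma>
             \<le> ereal (C * real (N * R * S) powr (- \<alpha> + 1 / 2 + \<tau>))"
          using C[OF _ th(2)[folded c\<^sub>0_def] th(3), folded th(1)] L R S good(2) by blast
      next
        fix N M g L R S y
        assume N: "prime N" "2 < N" and M: "M = cbc_threshold d \<alpha> \<gamma> N" "1 < M"
          and cbc: "cbc_output d \<alpha> \<gamma> N g" and L: "fiber_enumeration d \<alpha> \<gamma> N M g L"
          and R: "R = max_fiber d \<alpha> \<gamma> N M g" and S: "S = num_shifts K N R" and good: "good_shifts d S y L"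
        have th: "M = threshold d \<alpha> \<gamma> (real N / 2)" using M(1) by (simp add: cbc_threshold_def)
        obtain m\<^sub>0 where m0: "dyadic_level \<alpha> M m\<^sub>0" using dyadic_level_exists[OF M(2)] by blast
        have "R \<le> R_star d m\<^sub>0"
          unfolding R using card_fiber_le_R_star[OF cbc_separated[OF assms(1) N(1) cbc M(1)] m0]
          by (rule max_fiber_le)
        moreover have "c\<^sub>0 * real N \<le> real N / 2"
          using mult_right_mono[OF c0(2), of "real N"] by simp
        ultimately show "worst_case_error (lattice_algorithm d \<alpha> \<gamma> N M g L S y) d \<alpha> \<gamma>
             \<le> ereal (C * real (N * R * S) powr (- \<alpha> + 1 / 2 + \<tau>))"
          using C[of N "real N / 2", folded th] N M m0 L R S good by simp
      qed
    qed
  qed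
qed

end
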